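(* Let $X$ be an $n$-tuple of self-adjoint elements of a tracial $W^*$-probability space $(\mathcal{A},\tau)$, let $C\in M_n(\mathbb{R})$ be symmetric positive definite, and let $S$ be a semicircular family in $(\mathcal{A},\tau)$ with covariance $C$, free from $X$. For $t\ge0$ put $$X_t=e^{-tC^{-1}}X+\left(I_n-e^{-2tC^{-1}}\right)^{1/2}S.$$ Then for all $t>0$ $$\Phi^*(X_t|V_C)^{1/2}\le\frac{e^{-2t\|C\|_{op}^{-1}}}{\sqrt{1-e^{-2t\|C\|_{op}^{-1}}}}\,\|C^{-1}\|_{op}^{1/2}\,\Sigma^*(X|V_C).$$
   Context: A tracial $W^*$-probability space is a von Neumann algebra with a faithful normal tracial state. A matrix $B\in M_n(\mathbb{C})$ acts on tuples by $(BX)_i=\sum_jB_{i,j}X_j$. $\langle X,Y\rangle_2=\sum_i\tau(X_i^*Y_i)$. $\|\cdot\|_{op}$ is the matrix operator norm. Semicircular family with covariance $C$: self-adjoint $(S_1,\dots,S_n)$ with $\tau(S_{i_1}\cdots S_{i_k})=\sum_{\pi\in NC_2(k)}\prod_{\{a,b\}\in\pi}C_{i_a,i_b}$ ($NC_2(k)$: non-crossing pairings of $\{1,\dots,k\}$). On $\mathbb{C}\langle t_1,\dots,t_n\rangle$: $\partial_jm=\sum_{m=at_jb}a\otimes b^{op}$, $D_jm=\sum_{m=at_jb}ba$ on monomials, extended linearly; $DV=(D_1V,\dots,D_nV)$; $\mathcal{J}P=(\partial_jp_i)_{i,j}$. $V_C=\frac12\sum_{i,j}(C^{-1})_{i,j}t_it_j$,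 so $[DV_C](X)=C^{-1}X$. Free Stein kernel of $X$ with respect to $V$: $A\in L^2(M_n(\mathcal{A}\bar\otimes\mathcal{A}^{op}),(\tau\otimes\tau^{op})\circ Tr)$ with $\langle[DV](X),P(X)\rangle_2=\langle A,[\mathcal{J}P](X)\rangle_{HS}$ for all $P\in\mathbb{C}\langle t_1,\dots,t_n\rangle^n$, where $\langle A,B\rangle_{HS}=\sum_{i,j}\langle A_{i,j},B_{i,j}\rangle_{\tau\otimes\tau^{op}}$. Free Stein discrepancy: $\Sigma^*(X|V)=\inf_A\|A-(1\otimes1^{op})\otimes I_n\|_{HS}$ over all such kernels ($+\infty$ if none). Conjugate variables of $X$: $\xi_1,\dots,\xi_n\in L^2(W^*(X),\tau)$ with $\langle\xi_j,p(X)\rangle_2=\langle1\otimes1^{op},[\partial_jp](X)\rangle_{\tau\otimes\tau^{op}}$ for all polynomials $p$. Free Fisher information: $\Phi^*(X|V)=\sum_j\|\xi_j-[D_jV](X)\|_2^2$ if they exist and $+\infty$ otherwise. *)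

theory Defs
  imports "HOL-Analysis.Analysis" "HOL-Library.Poly_Mapping" "HOL-Library.Disjoint_Sets"
begin

section \<open>Complex Hilbert spaces and von Neumann algebras\<close>

text \<open>Inner products are conjugate-linear in the first argument. Completeness comes from the
  class \<^class>\<open>banach\<close>.\<close>

class complex_hilbert = banach +
  fixes scaleC :: "complex \<Rightarrow> 'a \<Rightarrow> 'a" (infixr "*\<^sub>C" 75)
    and cinner :: "'a \<Rightarrow> 'a \<Rightarrow> complex"
  assumes scaleC_add_right: "c *\<^sub>C (x + y) = c *\<^sub>C x + c *\<^sub>C y"
    and scaleC_add_left: "(c + d) *\<^sub>C x = c *\<^sub>C x + d *\<^sub>C x"
    and scaleC_scaleC: "c *\<^sub>C (d *\<^sub>C x) = (c * d) *\<^sub>C x"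
    and scaleR_scaleC: "r *\<^sub>R x = complex_of_real r *\<^sub>C x"
    and cinner_commute: "cinner x y = cnj (cinner y x)"
    and cinner_add_right: "cinner x (y + z) = cinner x y + cinner x z"
    and cinner_scaleC_right: "cinner x (c *\<^sub>C y) = c * cinner x y"
    and norm_eq_sqrt_cinner: "norm x = sqrt (Re (cinner x x))"

text \<open>Operators are real-linear bounded functions; the complex-linear ones form
  \<open>bounded_ops\<close>, that is, \<open>B(H)\<close>.\<close>

type_synonym 'h oper = "'h \<Rightarrow>\<^sub>L 'h"

definition bounded_ops :: "'h::complex_hilbert oper set" where
  "bounded_ops = {T. \<forall>c x. blinfun_apply T (c *\<^sub>C x) = c *\<^sub>C blinfun_apply T x}"

definition adj :: "'h::complex_hilbert oper \<Rightarrow> 'h oper" where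
  "adj T = (THE T'. \<forall>x y. cinner (blinfun_apply T' x) y = cinner x (blinfun_apply T y))"

definition op_scaleC :: "complex \<Rightarrow> 'h::complex_hilbert oper \<Rightarrow> 'h oper" where
  "op_scaleC c T = Blinfun (\<lambda>x. c *\<^sub>C blinfun_apply T x)"

definition commutant :: "'h::complex_hilbert oper set \<Rightarrow> 'h oper set" where
  "commutant Z = {T \<in> bounded_ops. \<forall>z\<in>Z. T o\<^sub>L z = z o\<^sub>L T}"

definition von_neumann_algebra :: "'h::complex_hilbert oper set \<Rightarrow> bool" where
  "von_neumann_algebra M \<longleftrightarrow>
     M \<subseteq> bounded_ops \<and> adj ` M \<subseteq> M \<and> commutant (commutant M) = M"

definition vn_generated :: "'h::complex_hilbert oper set \<Rightarrow> 'h oper set" where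
  "vn_generated Z = commutant (commutant (Z \<union> adj ` Z))"

text \<open>A functional on \<open>M\<close> is normal if it is ultraweakly continuous, that is, given by two
  square-summable sequences of vectors.\<close>

definition normal_functional ::
    "'h::complex_hilbert oper set \<Rightarrow> ('h oper \<Rightarrow> complex) \<Rightarrow> bool" where
  "normal_functional M \<tau> \<longleftrightarrow>
     (\<exists>\<xi> \<eta> :: nat \<Rightarrow> 'h.
        summable (\<lambda>k. (norm (\<xi> k))\<^sup>2) \<and> summable (\<lambda>k. (norm (\<eta> k))\<^sup>2) \<and>
        (\<forall>a\<in>M. (\<lambda>k. cinner (\<xi> k) (blinfun_apply a (\<eta> k))) sums \<tau> a))"

text \<open>Only the values of \<open>\<tau>\<close> on \<open>M\<close> matter.\<close>

definition tracial_W_star_probability_space ::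
    "'h::complex_hilbert oper set \<Rightarrow> ('h oper \<Rightarrow> complex) \<Rightarrow> bool" where
  "tracial_W_star_probability_space M \<tau> \<longleftrightarrow>
     von_neumann_algebra M \<and>
     (\<forall>a\<in>M. \<forall>b\<in>M. \<tau> (a + b) = \<tau> a + \<tau> b) \<and>
     (\<forall>c. \<forall>a\<in>M. \<tau> (op_scaleC c a) = c * \<tau> a) \<and>
     (\<forall>a\<in>M. \<tau> (adj a o\<^sub>L a) \<in> \<real>\<^sub>\<ge>\<^sub>0) \<and>
     \<tau> id_blinfun = 1 \<and>
     normal_functional M \<tau> \<and>
     (\<forall>a\<in>M. \<tau> (adj a o\<^sub>L a) = 0 \<longrightarrow> a = 0) \<and>
     (\<forall>a\<in>M. \<forall>b\<in>M. \<tau> (a o\<^sub>L b) = \<tau> (b o\<^sub>L a))"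

definition self_adjoint_tuple :: "'h::complex_hilbert oper set \<Rightarrow> ('n \<Rightarrow> 'h oper) \<Rightarrow> bool" where
  "self_adjoint_tuple M X \<longleftrightarrow> (\<forall>i. X i \<in> M \<and> adj (X i) = X i)"


section \<open>Noncommutative polynomials\<close>

text \<open>Words in the index type are the monomials of \<open>\<complex>\<langle>t\<^sub>1,\<dots>,t\<^sub>n\<rangle>\<close>; the pair \<open>(a, b)\<close> of words
  stands for the basis element \<open>a \<otimes> b\<^sup>o\<^sup>p\<close> of \<open>\<complex>\<langle>t\<rangle> \<otimes> \<complex>\<langle>t\<rangle>\<^sup>o\<^sup>p\<close>.\<close>

type_synonym 'n ncpoly = "'n list \<Rightarrow>\<^sub>0 complex"
type_synonym 'n ncbipoly = "('n list \<times> 'n list) \<Rightarrow>\<^sub>0 complex"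

definition op_prod :: "'h::complex_hilbert oper list \<Rightarrow> 'h oper" where
  "op_prod Ts = foldr (o\<^sub>L) Ts id_blinfun"

definition word_eval :: "('n \<Rightarrow> 'h::complex_hilbert oper) \<Rightarrow> 'n list \<Rightarrow> 'h oper" where
  "word_eval X w = op_prod (map X w)"

definition poly_eval :: "('n \<Rightarrow> 'h::complex_hilbert oper) \<Rightarrow> 'n ncpoly \<Rightarrow> 'h oper" where
  "poly_eval X p = (\<Sum>w \<in> Poly_Mapping.keys p. op_scaleC (Poly_Mapping.lookup p w) (word_eval X w))"

definition free_diff :: "'n \<Rightarrow> 'n ncpoly \<Rightarrow> 'n ncbipoly" where
  "free_diff j p =
     (\<Sum>w \<in> Poly_Mapping.keys p. \<Sum>k \<in> {k. k < length w \<and> w ! k = j}.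
        Poly_Mapping.single (take k w, drop (Suc k) w) (Poly_Mapping.lookup p w))"

definition cyclic_diff :: "'n \<Rightarrow> 'n ncpoly \<Rightarrow> 'n ncpoly" where
  "cyclic_diff j p =
     (\<Sum>w \<in> Poly_Mapping.keys p. \<Sum>k \<in> {k. k < length w \<and> w ! k = j}.
        Poly_Mapping.single (drop (Suc k) w @ take k w) (Poly_Mapping.lookup p w))"

definition gaussian_potential :: "real^'n^'n \<Rightarrow> 'n::finite ncpoly" where
  "gaussian_potential C =
     (\<Sum>i\<in>UNIV. \<Sum>j\<in>UNIV. Poly_Mapping.single [i, j] (complex_of_real (matrix_inv C $ i $ j / 2)))"


section \<open>Hilbert space completions\<close>

text \<open>For a semi-inner product \<open>ip\<close> on a vector space \<open>K\<close>, elements of the Hilbert space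
  completion are represented by Cauchy sequences in \<open>K\<close>. Everything below depends on such a sequence
  only through its class modulo null sequences; a vector \<open>v\<close> of \<open>K\<close> is represented by the constant
  sequence \<open>\<lambda>_. v\<close>.\<close>

definition semi_norm :: "('v \<Rightarrow> 'v \<Rightarrow> complex) \<Rightarrow> 'v \<Rightarrow> real" where
  "semi_norm ip v = sqrt (Re (ip v v))"

definition hcompletion ::
    "('v::ab_group_add \<Rightarrow> 'v \<Rightarrow> complex) \<Rightarrow> 'v set \<Rightarrow> (nat \<Rightarrow> 'v) set" where
  "hcompletion ip K =
     {f. (\<forall>k. f k \<in> K) \<and> (\<forall>e>0. \<exists>N. \<forall>m\<ge>N. \<forall>n\<ge>N. semi_norm ip (f m - f n) < e)}"

definition hinner :: "('v \<Rightarrow> 'v \<Rightarrow> complex) \<Rightarrow> (nat \<Rightarrow> 'v) \<Rightarrow> (nat \<Rightarrow> 'v) \<Rightarrow> complex" where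
  "hinner ip f g = lim (\<lambda>k. ip (f k) (g k))"

definition hnorm :: "('v \<Rightarrow> 'v \<Rightarrow> complex) \<Rightarrow> (nat \<Rightarrow> 'v) \<Rightarrow> real" where
  "hnorm ip f = lim (\<lambda>k. semi_norm ip (f k))"

definition inner2 ::
    "('h::complex_hilbert oper \<Rightarrow> complex) \<Rightarrow> 'h oper \<Rightarrow> 'h oper \<Rightarrow> complex" where
  "inner2 \<tau> a b = \<tau> (adj a o\<^sub>L b)"

definition L2 :: "('h::complex_hilbert oper \<Rightarrow> complex) \<Rightarrow> 'h oper set \<Rightarrow> (nat \<Rightarrow> 'h oper) set" where
  "L2 \<tau> N = hcompletion (inner2 \<tau>) N"

text \<open>The algebraic tensor product of \<open>M\<close> and \<open>M\<^sup>o\<^sup>p\<close> is represented by formal linear combinations of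
  pairs \<open>(a, b)\<close>, standing for \<open>a \<otimes> b\<^sup>o\<^sup>p\<close>. Since \<open>(b\<^sup>o\<^sup>p)\<^sup>* d\<^sup>o\<^sup>p = (d b\<^sup>*)\<^sup>o\<^sup>p\<close>, the inner product given
  by \<open>\<tau> \<otimes> \<tau>\<^sup>o\<^sup>p\<close> satisfies \<open>\<langle>a \<otimes> b\<^sup>o\<^sup>p, c \<otimes> d\<^sup>o\<^sup>p\<rangle> = \<tau>(a\<^sup>* c) \<tau>(d b\<^sup>*)\<close>. Its kernel on formal combinations
  consists of the combinations that vanish in the tensor product. The completion is
  \<open>L\<^sup>2(M \<otimes> M\<^sup>o\<^sup>p, \<tau> \<otimes> \<tau>\<^sup>o\<^sup>p)\<close> for the von Neumann algebra tensor product, in which the algebraic tensor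
  product is dense in 2-norm.\<close>

type_synonym 'h tensor = "('h oper \<times> 'h oper) \<Rightarrow>\<^sub>0 complex"

definition alg_tensor_op :: "'h::complex_hilbert oper set \<Rightarrow> 'h tensor set" where
  "alg_tensor_op M = {u. Poly_Mapping.keys u \<subseteq> M \<times> M}"

definition tensor_one :: "'h::complex_hilbert tensor" where
  "tensor_one = Poly_Mapping.single (id_blinfun, id_blinfun) 1"

definition tensor_inner ::
    "('h::complex_hilbert oper \<Rightarrow> complex) \<Rightarrow> 'h tensor \<Rightarrow> 'h tensor \<Rightarrow> complex" where
  "tensor_inner \<tau> u v =
     (\<Sum>(a, b) \<in> Poly_Mapping.keys u. \<Sum>(c, d) \<in> Poly_Mapping.keys v.
        cnj (Poly_Mapping.lookup u (a, b)) * Poly_Mapping.lookup v (c, d)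
          * (\<tau> (adj a o\<^sub>L c) * \<tau> (d o\<^sub>L adj b)))"

definition L2_tensor ::
    "('h::complex_hilbert oper \<Rightarrow> complex) \<Rightarrow> 'h oper set \<Rightarrow> (nat \<Rightarrow> 'h tensor) set" where
  "L2_tensor \<tau> M = hcompletion (tensor_inner \<tau>) (alg_tensor_op M)"

definition bipoly_eval :: "('n \<Rightarrow> 'h::complex_hilbert oper) \<Rightarrow> 'n ncbipoly \<Rightarrow> 'h tensor" where
  "bipoly_eval X q =
     (\<Sum>(v, w) \<in> Poly_Mapping.keys q.
        Poly_Mapping.single (word_eval X v, word_eval X w) (Poly_Mapping.lookup q (v, w)))"

text \<open>With respect to \<open>(\<tau> \<otimes> \<tau>\<^sup>o\<^sup>p) \<circ> Tr\<close> the inner product of two matrices is the sum of the inner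
  products of their entries, so \<open>L\<^sup>2\<close> of the matrix algebra consists of the matrices with entries in
  \<open>L\<^sup>2(M \<otimes> M\<^sup>o\<^sup>p)\<close>.\<close>

type_synonym ('n, 'h) L2_matrix = "'n \<Rightarrow> 'n \<Rightarrow> nat \<Rightarrow> 'h tensor"

definition hs_inner ::
    "('h::complex_hilbert oper \<Rightarrow> complex) \<Rightarrow> ('n::finite, 'h) L2_matrix \<Rightarrow> ('n, 'h) L2_matrix \<Rightarrow> complex"
  where
  "hs_inner \<tau> A B = (\<Sum>i\<in>UNIV. \<Sum>j\<in>UNIV. hinner (tensor_inner \<tau>) (A i j) (B i j))"

definition hs_norm ::
    "('h::complex_hilbert oper \<Rightarrow> complex) \<Rightarrow> ('n::finite, 'h) L2_matrix \<Rightarrow> real" where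
  "hs_norm \<tau> A = sqrt (\<Sum>i\<in>UNIV. \<Sum>j\<in>UNIV. (hnorm (tensor_inner \<tau>) (A i j))\<^sup>2)"

definition identity_L2_matrix :: "('n, 'h::complex_hilbert) L2_matrix" where
  "identity_L2_matrix = (\<lambda>i j _. if i = j then tensor_one else 0)"

definition jacobian_eval ::
    "('n \<Rightarrow> 'h::complex_hilbert oper) \<Rightarrow> ('n \<Rightarrow> 'n ncpoly) \<Rightarrow> ('n, 'h) L2_matrix" where
  "jacobian_eval X P = (\<lambda>i j _. bipoly_eval X (free_diff j (P i)))"


section \<open>Free Stein discrepancy and free Fisher information\<close>

definition free_stein_kernel ::
    "'h::complex_hilbert oper set \<Rightarrow> ('h oper \<Rightarrow> complex) \<Rightarrow> 'n::finite ncpoly \<Rightarrow> ('n \<Rightarrow> 'h oper)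
      \<Rightarrow> ('n, 'h) L2_matrix \<Rightarrow> bool" where
  "free_stein_kernel M \<tau> V X A \<longleftrightarrow>
     (\<forall>i j. A i j \<in> L2_tensor \<tau> M) \<and>
     (\<forall>P :: 'n \<Rightarrow> 'n ncpoly.
        (\<Sum>i\<in>UNIV. inner2 \<tau> (poly_eval X (cyclic_diff i V)) (poly_eval X (P i)))
          = hs_inner \<tau> A (jacobian_eval X P))"

definition free_stein_discrepancy ::
    "'h::complex_hilbert oper set \<Rightarrow> ('h oper \<Rightarrow> complex) \<Rightarrow> 'n::finite ncpoly \<Rightarrow> ('n \<Rightarrow> 'h oper)
      \<Rightarrow> ennreal" where
  "free_stein_discrepancy M \<tau> V X =
     (INF A \<in> {A. free_stein_kernel M \<tau> V X A}.
        ennreal (hs_norm \<tau> (\<lambda>i j k. A i j k - identity_L2_matrix i j k)))"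

definition conjugate_variables ::
    "('h::complex_hilbert oper \<Rightarrow> complex) \<Rightarrow> ('n \<Rightarrow> 'h oper) \<Rightarrow> ('n \<Rightarrow> nat \<Rightarrow> 'h oper) \<Rightarrow> bool" where
  "conjugate_variables \<tau> X \<xi> \<longleftrightarrow>
     (\<forall>j. \<xi> j \<in> L2 \<tau> (vn_generated (range X))) \<and>
     (\<forall>j. \<forall>p :: 'n ncpoly.
        hinner (inner2 \<tau>) (\<xi> j) (\<lambda>_. poly_eval X p)
          = tensor_inner \<tau> tensor_one (bipoly_eval X (free_diff j p)))"

text \<open>Conjugate variables are unique as elements of \<open>L\<^sup>2\<close>, so the choice only concerns the
  representing Cauchy sequences.\<close>

definition free_fisher_information ::
    "('h::complex_hilbert oper \<Rightarrow> complex) \<Rightarrow> 'n::finite ncpoly \<Rightarrow> ('n \<Rightarrow> 'h oper) \<Rightarrow> ennreal" where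
  "free_fisher_information \<tau> V X =
     (if \<exists>\<xi>. conjugate_variables \<tau> X \<xi>
      then let \<xi> = (SOME \<xi>. conjugate_variables \<tau> X \<xi>)
           in ennreal (\<Sum>j\<in>UNIV. (hnorm (inner2 \<tau>) (\<lambda>k. \<xi> j k - poly_eval X (cyclic_diff j V)))\<^sup>2)
      else \<infinity>)"

definition ennreal_sqrt :: "ennreal \<Rightarrow> ennreal" where
  "ennreal_sqrt x = (if x = \<infinity> then \<infinity> else ennreal (sqrt (enn2real x)))"


section \<open>Semicircular families and freeness\<close>

text \<open>Non-crossing pairings of the positions \<open>{0..<k}\<close> of a word of length \<open>k\<close>.\<close>

definition NC2 :: "nat \<Rightarrow> nat set set set" where
  "NC2 k = {\<pi>. partition_on {..<k} \<pi> \<and> (\<forall>B\<in>\<pi>. card B = 2) \<and>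
     \<not> (\<exists>B\<in>\<pi>. \<exists>B'\<in>\<pi>. B \<noteq> B' \<and>
          (\<exists>a b c d. a < b \<and> b < c \<and> c < d \<and> a \<in> B \<and> c \<in> B \<and> b \<in> B' \<and> d \<in> B'))}"

definition semicircular_family ::
    "'h::complex_hilbert oper set \<Rightarrow> ('h oper \<Rightarrow> complex) \<Rightarrow> real^'n^'n \<Rightarrow> ('n::finite \<Rightarrow> 'h oper) \<Rightarrow> bool"
  where
  "semicircular_family M \<tau> C S \<longleftrightarrow>
     self_adjoint_tuple M S \<and>
     (\<forall>w :: 'n list.
        \<tau> (word_eval S w)
          = (\<Sum>\<pi> \<in> NC2 (length w). \<Prod>B\<in>\<pi>. complex_of_real (C $ (w ! Min B) $ (w ! Max B))))"

text \<open>Freeness of the algebras \<open>\<complex>\<langle>X\<rangle>\<close> and \<open>\<complex>\<langle>Y\<rangle>\<close>: alternating products of centred elements are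
  centred. The Boolean tag records the algebra from which a factor is taken.\<close>

definition free_from ::
    "('h::complex_hilbert oper \<Rightarrow> complex) \<Rightarrow> ('m \<Rightarrow> 'h oper) \<Rightarrow> ('n \<Rightarrow> 'h oper) \<Rightarrow> bool" where
  "free_from \<tau> X Y \<longleftrightarrow>
     (\<forall>fs :: (bool \<times> 'h oper) list.
        fs \<noteq> [] \<and>
        (\<forall>(s, a) \<in> set fs. a \<in> (if s then range (poly_eval X) else range (poly_eval Y)) \<and> \<tau> a = 0) \<and>
        successively (\<lambda>f g. fst f \<noteq> fst g) fs
        \<longrightarrow> \<tau> (op_prod (map snd fs)) = 0)"


section \<open>Matrices and the Ornstein--Uhlenbeck interpolation\<close>

text \<open>Exponential and power for the matrix product (the componentwise product is the
  library's \<open>*\<close> on vectors).\<close>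

primrec mat_pow :: "real^'n^'n \<Rightarrow> nat \<Rightarrow> real^'n^'n::finite" where
  "mat_pow A 0 = mat 1"
| "mat_pow A (Suc k) = A ** mat_pow A k"

definition mat_exp :: "real^'n^'n \<Rightarrow> real^'n^'n::finite" where
  "mat_exp A = suminf (\<lambda>k. (1 / fact k) *\<^sub>R mat_pow A k)"

definition pos_semidefinite :: "real^'n^'n::finite \<Rightarrow> bool" where
  "pos_semidefinite A \<longleftrightarrow> transpose A = A \<and> (\<forall>v. 0 \<le> v \<bullet> (A *v v))"

definition pos_definite :: "real^'n^'n::finite \<Rightarrow> bool" where
  "pos_definite A \<longleftrightarrow> transpose A = A \<and> (\<forall>v. v \<noteq> 0 \<longrightarrow> 0 < v \<bullet> (A *v v))"

definition mat_sqrt :: "real^'n^'n \<Rightarrow> real^'n^'n::finite" where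
  "mat_sqrt A = (THE B. pos_semidefinite B \<and> B ** B = A)"

definition mat_opnorm :: "real^'n^'n::finite \<Rightarrow> real" where
  "mat_opnorm A = onorm ((*v) A)"

definition mat_act :: "real^'n^'n::finite \<Rightarrow> ('n \<Rightarrow> 'h::complex_hilbert oper) \<Rightarrow> 'n \<Rightarrow> 'h oper" where
  "mat_act B X = (\<lambda>i. \<Sum>j\<in>UNIV. B $ i $ j *\<^sub>R X j)"

definition ou_interpolation ::
    "real^'n^'n::finite \<Rightarrow> ('n \<Rightarrow> 'h::complex_hilbert oper) \<Rightarrow> ('n \<Rightarrow> 'h oper) \<Rightarrow> real \<Rightarrow> 'n \<Rightarrow> 'h oper"
  where
  "ou_interpolation C X S t =
     (\<lambda>i. mat_act (mat_exp ((- t) *\<^sub>R matrix_inv C)) X i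
        + mat_act (mat_sqrt (mat 1 - mat_exp ((- 2 * t) *\<^sub>R matrix_inv C))) S i)"

end

theory Submission
  imports Defs "HOL-Library.Function_Algebras"
begin

text \<open>
  Write \<open>Y = X\<^sub>t = E X + R S\<close> with \<open>E = e\<^sup>-\<^sup>t\<^sup>/\<^sup>C\<close> and \<open>R = (1 - E\<^sup>2)\<^sup>1\<^sup>/\<^sup>2\<close>, and let \<open>A\<close> be a Stein kernel of \<open>X\<close>.
  All matrices are functions of \<open>C\<close> and are handled in an eigenbasis of \<open>C\<close>
  (\<open>symmetric_matrix_spectral\<close>, locale \<open>orthonormal_frame\<close>).

  The heart of the proof is integration by parts. The moments of \<open>S\<close> satisfy the Schwinger--Dyson
  equation \<open>\<tau>(S\<^sub>i p) = \<Sum>\<^sub>j C\<^sub>i\<^sub>j (\<tau> \<otimes> \<tau>)(\<partial>\<^sub>j p)\<close>, by cutting a non-crossing pairing at the partner of its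
  first point (\<open>nc_moment_Cons\<close>), and \<open>X\<close> satisfies Stein's identity. Freeness extends both to
  polynomials in \<open>X\<close> and \<open>S\<close> together (\<open>free_integration_by_parts\<close>): both sides are multilinear in the
  factors of a product, hence it is enough to compare them on alternating products of centred elements,
  where they vanish unless the product is a single factor. Applied to \<open>Y\<close> this gives
  \<open>\<langle>C\<^sup>-\<^sup>1 Y, P(Y)\<rangle> - \<langle>1, J P(Y)\<rangle> = \<langle>E (A - 1) E, J P(Y)\<rangle>\<close>, because \<open>E\<^sup>2 + C\<^sup>-\<^sup>1 R C R = 1\<close>.

  The right side is the pairing of \<open>P(Y)\<close> with a vector of \<open>L\<^sup>2\<close>. Replacing \<open>a \<otimes> b\<close> by \<open>a S\<^sub>j b\<close> turns a
  tensor over \<open>X\<close> into an operator; integration by parts in \<open>S\<close> shows that this map \<open>#\<close> satisfies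
  \<open>\<langle>B # S, P(Y)\<rangle> = \<langle>B C R, J P(Y)\<rangle>\<close> and \<open>\<parallel>B # S\<parallel> = \<parallel>B C\<^sup>1\<^sup>/\<^sup>2\<parallel>\<close>. With \<open>B = E (A - 1) E R\<^sup>-\<^sup>1 C\<^sup>-\<^sup>1\<close> the pairing
  is the one above, and the norm of \<open>B # S\<close> is at most \<open>\<parallel>E\<parallel> \<parallel>E R\<^sup>-\<^sup>1 C\<^sup>-\<^sup>1\<^sup>/\<^sup>2\<parallel> \<parallel>A - 1\<parallel>\<close>, which is the stated
  constant times the discrepancy (\<open>score_bound\<close>). Here \<open>A\<close> is first projected onto tensors over \<open>X\<close>
  and approximated by polynomials, so that only finite sums occur.

  It remains to pass from a bounded functional on polynomials to the Fisher information
  (\<open>free_fisher_information_bound\<close>). Existence of conjugate variables is the Riesz lemma. The norm of any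
  choice of them in \<open>L\<^sup>2(W\<^sup>*(Y))\<close> is controlled by their values on polynomials since these are dense
  (\<open>poly_eval_dense\<close>), which is the double commutant theorem combined with normality of \<open>\<tau>\<close>.
\<close>

section \<open>Semi-inner products and the Riesz representation\<close>

text \<open>The forms used here (2-norms, tensor products, pullbacks along evaluations) are degenerate, and
  some are positive only on a subspace \<open>K\<close> of their type. Completions are given by Cauchy sequences, so
  the Hilbert space facts are stated for vectors of \<open>K\<close> and for limits along such sequences.\<close>

locale semi_inner =
  fixes K :: "'v::ab_group_add set"
    and sc :: "complex \<Rightarrow> 'v \<Rightarrow> 'v"
    and ip :: "'v \<Rightarrow> 'v \<Rightarrow> complex"
  assumes K_zero: "0 \<in> K"
    and K_add: "x \<in> K \<Longrightarrow> y \<in> K \<Longrightarrow> x + y \<in> K"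
    and K_sc: "x \<in> K \<Longrightarrow> sc c x \<in> K"
    and sc_minus_one: "x \<in> K \<Longrightarrow> sc (-1) x = - x"
    and ip_add: "x \<in> K \<Longrightarrow> y \<in> K \<Longrightarrow> z \<in> K \<Longrightarrow> ip x (y + z) = ip x y + ip x z"
    and ip_sc: "x \<in> K \<Longrightarrow> y \<in> K \<Longrightarrow> ip x (sc c y) = c * ip x y"
    and ip_herm: "x \<in> K \<Longrightarrow> y \<in> K \<Longrightarrow> ip x y = cnj (ip y x)"
    and ip_pos: "x \<in> K \<Longrightarrow> 0 \<le> Re (ip x x)"
begin

abbreviation nrm :: "'v \<Rightarrow> real" where
  "nrm \<equiv> semi_norm ip"

lemma K_minus: "x \<in> K \<Longrightarrow> - x \<in> K"
  using K_sc[of x "-1"] sc_minus_one[of x] by simp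

lemma K_diff: "x \<in> K \<Longrightarrow> y \<in> K \<Longrightarrow> x - y \<in> K"
  using K_add[of x "- y"] K_minus[of y] by simp

lemma ip_minus: "x \<in> K \<Longrightarrow> y \<in> K \<Longrightarrow> ip x (- y) = - ip x y"
  using ip_sc[of x y "-1"] sc_minus_one[of y] by simp

lemma ip_diff: "x \<in> K \<Longrightarrow> y \<in> K \<Longrightarrow> z \<in> K \<Longrightarrow> ip x (y - z) = ip x y - ip x z"
  using ip_add[of x y "- z"] K_minus[of z] ip_minus[of x z] by simp

lemma ip_zero: "x \<in> K \<Longrightarrow> ip x 0 = 0"
  using ip_diff[of x 0 0] K_zero by simp

lemma ip_add_left: "x \<in> K \<Longrightarrow> y \<in> K \<Longrightarrow> z \<in> K \<Longrightarrow> ip (x + y) z = ip x z + ip y z"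
  using ip_herm[of "x + y" z] ip_herm[of x z] ip_herm[of y z] K_add ip_add[of z x y] by simp

lemma ip_diff_left: "x \<in> K \<Longrightarrow> y \<in> K \<Longrightarrow> z \<in> K \<Longrightarrow> ip (x - y) z = ip x z - ip y z"
  using ip_herm[of "x - y" z] ip_herm[of x z] ip_herm[of y z] K_diff ip_diff[of z x y] by simp

lemma ip_minus_left: "x \<in> K \<Longrightarrow> z \<in> K \<Longrightarrow> ip (- x) z = - ip x z"
  using ip_herm[of "- x" z] ip_herm[of x z] K_minus ip_minus[of z x] by simp

lemma ip_sc_left: "x \<in> K \<Longrightarrow> z \<in> K \<Longrightarrow> ip (sc c x) z = cnj c * ip x z"
  using ip_herm[of "sc c x" z] ip_herm[of x z] K_sc ip_sc[of z x c] by simp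

lemma ip_zero_left: "x \<in> K \<Longrightarrow> ip 0 x = 0"
  using ip_herm[of 0 x] ip_zero[of x] K_zero by simp

lemma K_sum: "(\<And>i. i \<in> I \<Longrightarrow> f i \<in> K) \<Longrightarrow> (\<Sum>i\<in>I. f i) \<in> K"
  by (induction I rule: infinite_finite_induct) (simp_all add: K_zero K_add)

lemma ip_sum:
  "x \<in> K \<Longrightarrow> (\<And>i. i \<in> I \<Longrightarrow> f i \<in> K) \<Longrightarrow> ip x (\<Sum>i\<in>I. f i) = (\<Sum>i\<in>I. ip x (f i))"
  by (induction I rule: infinite_finite_induct) (simp_all add: ip_zero ip_add K_sum)

lemma ip_sum_left:
  "x \<in> K \<Longrightarrow> (\<And>i. i \<in> I \<Longrightarrow> f i \<in> K) \<Longrightarrow> ip (\<Sum>i\<in>I. f i) x = (\<Sum>i\<in>I. ip (f i) x)"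
  by (induction I rule: infinite_finite_induct) (simp_all add: ip_zero_left ip_add_left K_sum)

lemma ip_self_real: assumes "x \<in> K" shows "ip x x = complex_of_real ((nrm x)\<^sup>2)"
proof -
  have "Im (ip x x) = 0"
    using ip_herm[OF assms assms] by (metis Reals_cnj_iff complex_is_Real_iff)
  then show ?thesis
    using ip_pos[OF assms] by (simp add: semi_norm_def complex_eq_iff)
qed

lemma nrm_sq: "x \<in> K \<Longrightarrow> (nrm x)\<^sup>2 = Re (ip x x)"
  using ip_pos by (simp add: semi_norm_def)

lemma nrm_nonneg: "x \<in> K \<Longrightarrow> 0 \<le> nrm x"
  using ip_pos by (simp add: semi_norm_def)

lemma nrm_sc: assumes "x \<in> K" shows "nrm (sc c x) = cmod c * nrm x"
proof -
  have "ip (sc c x) (sc c x) = (c * cnj c) * ip x x"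
    using assms K_sc ip_sc_left ip_sc by (simp add: mult.assoc)
  also have "\<dots> = complex_of_real ((cmod c * nrm x)\<^sup>2)"
    by (simp add: complex_norm_square[symmetric] ip_self_real[OF assms] power_mult_distrib
        del: of_real_power flip: of_real_mult)
  finally show ?thesis
    using nrm_nonneg[OF assms] by (simp add: semi_norm_def del: of_real_power)
qed

lemma nrm_minus: "x \<in> K \<Longrightarrow> nrm (- x) = nrm x"
  using nrm_sc[of x "-1"] sc_minus_one[of x] by simp

lemma nrm_zero: "nrm 0 = 0"
  using ip_zero[OF K_zero] by (simp add: semi_norm_def)

lemma nrm_add_sq:
  assumes "x \<in> K" "y \<in> K"
  shows "(nrm (x + y))\<^sup>2 = (nrm x)\<^sup>2 + (nrm y)\<^sup>2 + 2 * Re (ip x y)"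
proof -
  have "Re (ip y x) = Re (ip x y)" using ip_herm[OF assms] by simp
  then show ?thesis
    using assms K_add by (simp add: nrm_sq ip_add ip_add_left)
qed

lemma nrm_diff_sq:
  assumes "x \<in> K" "y \<in> K"
  shows "(nrm (x - y))\<^sup>2 = (nrm x)\<^sup>2 + (nrm y)\<^sup>2 - 2 * Re (ip x y)"
  using nrm_add_sq[of x "- y"] assms K_minus by (simp add: nrm_minus ip_minus)

lemma parallelogram:
  assumes "x \<in> K" "y \<in> K"
  shows "(nrm (x + y))\<^sup>2 + (nrm (x - y))\<^sup>2 = 2 * (nrm x)\<^sup>2 + 2 * (nrm y)\<^sup>2"
  using nrm_add_sq[OF assms] nrm_diff_sq[OF assms] by simp

text \<open>Cauchy--Schwarz for a degenerate form: the vector \<open>y\<close> is moved along \<open>x\<close> by an amount that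
  stays meaningful when \<open>x\<close> is a null vector.\<close>

lemma Cauchy_Schwarz:
  assumes x: "x \<in> K" and y: "y \<in> K"
  shows "cmod (ip x y) \<le> nrm x * nrm y"
proof -
  define d where "d = ip x y"
  have quad: "0 \<le> (s * cmod d)\<^sup>2 * (nrm x)\<^sup>2 + (nrm y)\<^sup>2 - 2 * s * (cmod d)\<^sup>2" for s :: real
  proof -
    have "0 \<le> (nrm (sc (s * d) x - y))\<^sup>2" by simp
    also have "\<dots> = (nrm (sc (s * d) x))\<^sup>2 + (nrm y)\<^sup>2 - 2 * Re (ip (sc (s * d) x) y)"
      using nrm_diff_sq[of "sc (s * d) x" y] K_sc x y by simp
    also have "ip (sc (s * d) x) y = s * (cnj d * d)"
      using ip_sc_left[OF x y] by (simp add: d_def)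
    also have "cnj d * d = complex_of_real ((cmod d)\<^sup>2)"
      by (simp only: complex_norm_square mult.commute)
    finally show ?thesis
      by (simp add: nrm_sc[OF x] norm_mult power_mult_distrib)
  qed
  show ?thesis
  proof (cases "d = 0")
    case True
    then show ?thesis using nrm_nonneg x y by (simp add: d_def)
  next
    case False
    then have d0: "(cmod d)\<^sup>2 > 0" by simp
    show ?thesis
    proof (cases "nrm x = 0")
      case True
      with quad[of "((nrm y)\<^sup>2 + 1) / (2 * (cmod d)\<^sup>2)"] d0 show ?thesis
        by (simp add: field_simps)
    next
      case False
      then have x0: "(nrm x)\<^sup>2 > 0" by simp
      have "0 \<le> (nrm y)\<^sup>2 - (cmod d)\<^sup>2 / (nrm x)\<^sup>2"
      proof -
        have "(1 / (nrm x)\<^sup>2 * cmod d)\<^sup>2 * (nrm x)\<^sup>2 = (cmod d)\<^sup>2 / (nrm x)\<^sup>2"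
          using \<open>nrm x \<noteq> 0\<close> by (simp add: power2_eq_square)
        then show ?thesis using quad[of "1 / (nrm x)\<^sup>2"] by simp
      qed
      then have "(cmod d)\<^sup>2 \<le> (nrm x * nrm y)\<^sup>2"
        using x0 by (simp add: field_simps power_mult_distrib)
      then show ?thesis
        using nrm_nonneg[OF x] nrm_nonneg[OF y] unfolding d_def
        by (meson mult_nonneg_nonneg power2_le_imp_le)
    qed
  qed
qed

lemma nrm_triangle:
  assumes "x \<in> K" "y \<in> K"
  shows "nrm (x + y) \<le> nrm x + nrm y"
proof -
  have "Re (ip x y) \<le> nrm x * nrm y"
    using Cauchy_Schwarz[OF assms] complex_Re_le_cmod order_trans by blast
  then have "(nrm (x + y))\<^sup>2 \<le> (nrm x + nrm y)\<^sup>2"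
    using nrm_add_sq[OF assms] by (simp add: power2_sum)
  then show ?thesis
    using nrm_nonneg assms by (meson add_nonneg_nonneg power2_le_imp_le)
qed

lemma nrm_triangle_diff:
  assumes "x \<in> K" "y \<in> K"
  shows "\<bar>nrm x - nrm y\<bar> \<le> nrm (x - y)"
  using nrm_triangle[of "x - y" y] nrm_triangle[of "y - x" x] nrm_minus[of "x - y"] assms K_diff
  by simp

abbreviation Comp :: "(nat \<Rightarrow> 'v) set" where
  "Comp \<equiv> hcompletion ip K"

lemma Comp_in: "f \<in> Comp \<Longrightarrow> f k \<in> K"
  by (simp add: hcompletion_def)

lemma Comp_cauchy: "f \<in> Comp \<Longrightarrow> e > 0 \<Longrightarrow> \<exists>N. \<forall>m\<ge>N. \<forall>n\<ge>N. nrm (f m - f n) < e"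
  by (simp add: hcompletion_def)

lemma Comp_const: "x \<in> K \<Longrightarrow> (\<lambda>_. x) \<in> Comp"
  by (simp add: hcompletion_def nrm_zero)

lemma Comp_add: assumes f: "f \<in> Comp" and g: "g \<in> Comp" shows "(\<lambda>k. f k + g k) \<in> Comp"
proof -
  have "\<exists>N. \<forall>m\<ge>N. \<forall>n\<ge>N. nrm (f m + g m - (f n + g n)) < e" if "e > 0" for e
  proof -
    obtain N1 where N1: "\<forall>m\<ge>N1. \<forall>n\<ge>N1. nrm (f m - f n) < e / 2"
      using Comp_cauchy[OF f, of "e / 2"] \<open>e > 0\<close> by auto
    obtain N2 where N2: "\<forall>m\<ge>N2. \<forall>n\<ge>N2. nrm (g m - g n) < e / 2"
      using Comp_cauchy[OF g, of "e / 2"] \<open>e > 0\<close> by auto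
    have "nrm (f m + g m - (f n + g n)) < e" if "m \<ge> max N1 N2" "n \<ge> max N1 N2" for m n
    proof -
      have "f m + g m - (f n + g n) = (f m - f n) + (g m - g n)" by simp
      then have "nrm (f m + g m - (f n + g n)) \<le> nrm (f m - f n) + nrm (g m - g n)"
        using nrm_triangle[of "f m - f n" "g m - g n"] Comp_in[OF f] Comp_in[OF g] K_diff by metis
      also have "\<dots> < e / 2 + e / 2" using N1 N2 that by (intro add_strict_mono) auto
      finally show ?thesis by simp
    qed
    then show ?thesis by blast
  qed
  then show ?thesis unfolding hcompletion_def using Comp_in[OF f] Comp_in[OF g] K_add by simp
qed

lemma Comp_minus: assumes f: "f \<in> Comp" shows "(\<lambda>k. - f k) \<in> Comp"
proof -
  have "nrm (- f m - - f n) = nrm (f m - f n)" for m n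
    using nrm_minus[OF K_diff[OF Comp_in[OF f] Comp_in[OF f]], of m n] by simp
  then show ?thesis using f K_minus unfolding hcompletion_def by simp
qed

lemma Comp_diff: "f \<in> Comp \<Longrightarrow> g \<in> Comp \<Longrightarrow> (\<lambda>k. f k - g k) \<in> Comp"
  using Comp_add[of f "\<lambda>k. - g k"] Comp_minus[of g] by simp

lemma nrm_Comp_LIMSEQ: assumes f: "f \<in> Comp" shows "(\<lambda>k. nrm (f k)) \<longlonglongrightarrow> hnorm ip f"
proof -
  have "Cauchy (\<lambda>k. nrm (f k))"
    unfolding Cauchy_def
  proof (intro allI impI)
    fix e :: real assume "e > 0"
    then obtain N where N: "\<forall>m\<ge>N. \<forall>n\<ge>N. nrm (f m - f n) < e" using Comp_cauchy[OF f] by blast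
    have "dist (nrm (f m)) (nrm (f n)) < e" if "m \<ge> N" "n \<ge> N" for m n
      using nrm_triangle_diff[OF Comp_in[OF f] Comp_in[OF f], of m n] N that
      by (auto simp: dist_real_def intro: le_less_trans)
    then show "\<exists>N. \<forall>m\<ge>N. \<forall>n\<ge>N. dist (nrm (f m)) (nrm (f n)) < e" by blast
  qed
  then show ?thesis unfolding hnorm_def
    using Cauchy_convergent_iff convergent_LIMSEQ_iff by blast
qed

lemma hnorm_nonneg: "f \<in> Comp \<Longrightarrow> 0 \<le> hnorm ip f"
  by (rule LIMSEQ_le_const[OF nrm_Comp_LIMSEQ]) (auto intro: nrm_nonneg Comp_in)

lemma nrm_Comp_bounded: assumes f: "f \<in> Comp" obtains B where "B > 0" "\<And>k. nrm (f k) \<le> B"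
proof -
  have "Bseq (\<lambda>k. nrm (f k))"
    using nrm_Comp_LIMSEQ[OF f] convergentI convergent_imp_Bseq by blast
  then obtain B where "B > 0" "\<And>k. norm (nrm (f k)) \<le> B" by (auto elim: BseqE)
  then show ?thesis using that[of B] by (simp add: abs_le_iff)
qed

lemma ip_Comp_LIMSEQ:
  assumes f: "f \<in> Comp" and g: "g \<in> Comp"
  shows "(\<lambda>k. ip (f k) (g k)) \<longlonglongrightarrow> hinner ip f g"
proof -
  obtain A where A: "A > 0" "\<And>k. nrm (f k) \<le> A" using nrm_Comp_bounded[OF f] by blast
  obtain B where B: "B > 0" "\<And>k. nrm (g k) \<le> B" using nrm_Comp_bounded[OF g] by blast
  note [simp] = Comp_in[OF f] Comp_in[OF g]
  have "Cauchy (\<lambda>k. ip (f k) (g k))"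
    unfolding Cauchy_def
  proof (intro allI impI)
    fix e :: real assume "e > 0"
    obtain N1 where N1: "\<forall>m\<ge>N1. \<forall>n\<ge>N1. nrm (f m - f n) < e / (2 * B)"
      using Comp_cauchy[OF f, of "e / (2 * B)"] \<open>e > 0\<close> B by auto
    obtain N2 where N2: "\<forall>m\<ge>N2. \<forall>n\<ge>N2. nrm (g m - g n) < e / (2 * A)"
      using Comp_cauchy[OF g, of "e / (2 * A)"] \<open>e > 0\<close> A by auto
    have "dist (ip (f m) (g m)) (ip (f n) (g n)) < e" if "m \<ge> max N1 N2" "n \<ge> max N1 N2" for m n
    proof -
      have "ip (f m) (g m) - ip (f n) (g n) = ip (f m - f n) (g m) + ip (f n) (g m - g n)"
        by (simp add: ip_diff ip_diff_left)
      then have "cmod (ip (f m) (g m) - ip (f n) (g n))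
          \<le> cmod (ip (f m - f n) (g m)) + cmod (ip (f n) (g m - g n))"
        by (simp add: norm_triangle_ineq)
      also have "\<dots> \<le> nrm (f m - f n) * nrm (g m) + nrm (f n) * nrm (g m - g n)"
        by (intro add_mono Cauchy_Schwarz K_diff) auto
      also have "\<dots> \<le> nrm (f m - f n) * B + A * nrm (g m - g n)"
        by (intro add_mono mult_left_mono mult_right_mono A B nrm_nonneg K_diff) auto
      also have "\<dots> < e / (2 * B) * B + A * (e / (2 * A))"
        using N1 N2 that A B
        by (intro add_strict_mono mult_strict_right_mono mult_strict_left_mono) auto
      also have "\<dots> = e" using A B by simp
      finally show ?thesis by (simp add: dist_norm)
    qed
    then show "\<exists>N. \<forall>m\<ge>N. \<forall>n\<ge>N. dist (ip (f m) (g m)) (ip (f n) (g n)) < e" by blast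
  qed
  then show ?thesis unfolding hinner_def
    using Cauchy_convergent_iff convergent_LIMSEQ_iff by blast
qed

lemma hinner_Cauchy_Schwarz:
  assumes f: "f \<in> Comp" and g: "g \<in> Comp"
  shows "cmod (hinner ip f g) \<le> hnorm ip f * hnorm ip g"
proof (rule LIMSEQ_le[OF tendsto_norm[OF ip_Comp_LIMSEQ[OF f g]]
        tendsto_mult[OF nrm_Comp_LIMSEQ[OF f] nrm_Comp_LIMSEQ[OF g]]])
  show "\<exists>N. \<forall>n\<ge>N. cmod (ip (f n) (g n)) \<le> nrm (f n) * nrm (g n)"
    by (simp add: Cauchy_Schwarz Comp_in[OF f] Comp_in[OF g])
qed

lemma hnorm_const: "hnorm ip (\<lambda>_. x) = nrm x"
  by (simp add: hnorm_def)

lemma hinner_const_right: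
  assumes f: "f \<in> Comp" and x: "x \<in> K"
  shows "(\<lambda>k. ip (f k) x) \<longlonglongrightarrow> hinner ip f (\<lambda>_. x)"
  using ip_Comp_LIMSEQ[OF f Comp_const[OF x]] .

lemma hinner_diff_left:
  assumes f: "f \<in> Comp" and g: "g \<in> Comp" and h: "h \<in> Comp"
  shows "hinner ip (\<lambda>k. f k - g k) h = hinner ip f h - hinner ip g h"
proof (rule LIMSEQ_unique[OF ip_Comp_LIMSEQ[OF Comp_diff[OF f g] h]])
  show "(\<lambda>k. ip (f k - g k) (h k)) \<longlonglongrightarrow> hinner ip f h - hinner ip g h"
    using tendsto_diff[OF ip_Comp_LIMSEQ[OF f h] ip_Comp_LIMSEQ[OF g h]]
    by (simp add: ip_diff_left Comp_in[OF f] Comp_in[OF g] Comp_in[OF h])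
qed

lemma hnorm_sq: "f \<in> Comp \<Longrightarrow> (\<lambda>k. (nrm (f k))\<^sup>2) \<longlonglongrightarrow> (hnorm ip f)\<^sup>2"
  by (intro tendsto_power nrm_Comp_LIMSEQ)

text \<open>Riesz representation without completeness: a minimizing sequence of the convex functional
  \<open>\<parallel>x\<parallel>\<^sup>2 - 2 Re \<phi>(x)\<close> is Cauchy by the parallelogram law, and the first-order condition at an
  almost-minimizer says that it almost represents \<open>\<phi>\<close>.\<close>

theorem Riesz:
  assumes \<phi>_add: "\<And>x y. x \<in> K \<Longrightarrow> y \<in> K \<Longrightarrow> \<phi> (x + y) = \<phi> x + \<phi> y"
    and \<phi>_sc: "\<And>c x. x \<in> K \<Longrightarrow> \<phi> (sc c x) = c * \<phi> x"
    and \<phi>_bound: "\<And>x. x \<in> K \<Longrightarrow> cmod (\<phi> x) \<le> c * nrm x"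
    and c: "0 \<le> c"
  obtains g where "g \<in> Comp" "\<And>x. x \<in> K \<Longrightarrow> (\<lambda>k. ip (g k) x) \<longlonglongrightarrow> \<phi> x" "hnorm ip g \<le> c"
proof -
  define J where "J x = (nrm x)\<^sup>2 - 2 * Re (\<phi> x)" for x
  have J_bound: "- c\<^sup>2 \<le> J x" if "x \<in> K" for x
  proof -
    have "Re (\<phi> x) \<le> c * nrm x" using \<phi>_bound[OF that] complex_Re_le_cmod order_trans by blast
    moreover have "0 \<le> (nrm x - c)\<^sup>2" by simp
    ultimately show ?thesis by (simp add: J_def power2_diff algebra_simps)
  qed
  define m where "m = Inf (J ` K)"
  have bdd: "bdd_below (J ` K)" using J_bound by (rule bdd_belowI2)
  have m_le: "m \<le> J x" if "x \<in> K" for x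
    unfolding m_def using bdd that by (simp add: cInf_lower)
  have "\<exists>x\<in>K. J x < m + 1 / real (Suc k)" for k
  proof -
    have "Inf (J ` K) < m + 1 / real (Suc k)" unfolding m_def by simp
    then show ?thesis using cInf_less_iff[of "J ` K"] bdd K_zero by fastforce
  qed
  then obtain g where gK: "\<And>k. g k \<in> K" and gJ: "\<And>k. J (g k) < m + 1 / real (Suc k)"
    by metis
  have cauchy_bound: "(nrm (g k - g l))\<^sup>2 \<le> 2 / real (Suc k) + 2 / real (Suc l)" for k l
  proof -
    have "J (sc (1/2) (g k + g l)) = (nrm (g k + g l))\<^sup>2 / 4 - Re (\<phi> (g k)) - Re (\<phi> (g l))"
      using gK K_add
      by (simp add: J_def nrm_sc \<phi>_sc \<phi>_add norm_divide power2_eq_square field_simps)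
    then have "(nrm (g k + g l))\<^sup>2 / 4 - Re (\<phi> (g k)) - Re (\<phi> (g l)) \<ge> m"
      using m_le[of "sc (1/2) (g k + g l)"] gK K_add K_sc by simp
    then show ?thesis
      using parallelogram[OF gK gK, of k l] gJ[of k] gJ[of l] by (simp add: J_def)
  qed
  have Comp: "g \<in> Comp"
  proof -
    have "\<exists>N. \<forall>k\<ge>N. \<forall>l\<ge>N. nrm (g k - g l) < e" if "e > 0" for e
    proof -
      obtain N where N: "4 / e\<^sup>2 < real (Suc N)"
        using reals_Archimedean2 by (metis less_trans lessI of_nat_less_iff)
      have "nrm (g k - g l) < e" if "k \<ge> N" "l \<ge> N" for k l
      proof -
        have "2 / real (Suc k) + 2 / real (Suc l) \<le> 2 / real (Suc N) + 2 / real (Suc N)"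
          using that by (intro add_mono divide_left_mono) auto
        also have "\<dots> = 4 / real (Suc N)" by simp
        also have "\<dots> < e\<^sup>2"
          using N \<open>e > 0\<close> by (simp add: pos_divide_less_eq mult.commute del: of_nat_Suc)
        finally have "(nrm (g k - g l))\<^sup>2 < e\<^sup>2" using cauchy_bound[of k l] by linarith
        then show ?thesis using \<open>e > 0\<close> by (meson less_imp_le power2_less_imp_less)
      qed
      then show ?thesis by blast
    qed
    then show ?thesis using gK by (auto simp: hcompletion_def)
  qed
  have first_order: "(cmod (ip (g k) v - \<phi> v))\<^sup>2 \<le> (1 + (nrm v)\<^sup>2) / real (Suc k)"
    if v: "v \<in> K" for k v
  proof -
    define d where "d = ip (g k) v - \<phi> v"
    define s where "s = 1 / (1 + (nrm v)\<^sup>2)"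
    have p: "1 + (nrm v)\<^sup>2 > 0" by (simp add: add_pos_nonneg)
    then have s: "s > 0" "s * (nrm v)\<^sup>2 \<le> 1" by (simp_all add: s_def)
    define z where "z = - complex_of_real s * cnj d"
    have zv: "sc z v \<in> K" using K_sc v by blast
    have "J (g k + sc z v) = J (g k) + (cmod z)\<^sup>2 * (nrm v)\<^sup>2 + 2 * Re (z * d)"
      using nrm_add_sq[OF gK zv, of k] v gK zv
      by (simp add: J_def nrm_sc ip_sc \<phi>_add \<phi>_sc d_def power_mult_distrib algebra_simps)
    also have "z * d = - complex_of_real (s * (cmod d)\<^sup>2)"
      using complex_norm_square[of d] by (simp add: z_def mult.commute)
    also have "(cmod z)\<^sup>2 = s\<^sup>2 * (cmod d)\<^sup>2" by (simp add: z_def norm_mult power_mult_distrib)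
    finally have "m \<le> J (g k) + s\<^sup>2 * (cmod d)\<^sup>2 * (nrm v)\<^sup>2 - 2 * (s * (cmod d)\<^sup>2)"
      using m_le[of "g k + sc z v"] K_add gK zv by simp
    moreover have "s\<^sup>2 * (cmod d)\<^sup>2 * (nrm v)\<^sup>2 \<le> s * (cmod d)\<^sup>2"
      using mult_right_mono[OF s(2), of "s * (cmod d)\<^sup>2"] s(1)
      by (simp add: power2_eq_square mult_ac)
    ultimately have "s * (cmod d)\<^sup>2 \<le> 1 / real (Suc k)" using gJ[of k] by linarith
    then show ?thesis using p by (simp add: s_def d_def field_simps)
  qed
  have lim: "(\<lambda>k. ip (g k) x) \<longlonglongrightarrow> \<phi> x" if x: "x \<in> K" for x
  proof -
    have "(\<lambda>k. (1 + (nrm x)\<^sup>2) / real (Suc k)) \<longlonglongrightarrow> 0"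
      using LIMSEQ_Suc[OF lim_const_over_n] by blast
    then have "(\<lambda>k. (cmod (ip (g k) x - \<phi> x))\<^sup>2) \<longlonglongrightarrow> 0"
      by (rule Lim_null_comparison[rotated]) (use first_order[OF x] in auto)
    from tendsto_real_sqrt[OF this] have "(\<lambda>k. ip (g k) x - \<phi> x) \<longlonglongrightarrow> 0"
      by (simp add: tendsto_norm_zero_iff)
    then show ?thesis using LIM_zero_iff by blast
  qed
  have "hnorm ip g \<le> c"
  proof -
    obtain B where B: "B > 0" "\<And>k. nrm (g k) \<le> B" using nrm_Comp_bounded[OF Comp] by blast
    have "(nrm (g k))\<^sup>2 \<le> c * nrm (g k) + sqrt ((1 + B\<^sup>2) / real (Suc k))" for k
    proof -
      have "(cmod (ip (g k) (g k) - \<phi> (g k)))\<^sup>2 \<le> (1 + (nrm (g k))\<^sup>2) / real (Suc k)"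
        using first_order[OF gK] .
      also have "\<dots> \<le> (1 + B\<^sup>2) / real (Suc k)"
        using B(2)[of k] nrm_nonneg[OF gK, of k] by (intro divide_right_mono add_left_mono power_mono) auto
      finally have *: "cmod (ip (g k) (g k) - \<phi> (g k)) \<le> sqrt ((1 + B\<^sup>2) / real (Suc k))"
        by (rule real_le_rsqrt)
      have "(nrm (g k))\<^sup>2 = cmod (ip (g k) (g k))"
        by (simp add: ip_self_real[OF gK] norm_power)
      also have "\<dots> \<le> cmod (\<phi> (g k)) + cmod (ip (g k) (g k) - \<phi> (g k))"
        by (metis norm_triangle_sub)
      finally show ?thesis using \<phi>_bound[OF gK, of k] * by linarith
    qed
    moreover have "(\<lambda>k. c * nrm (g k) + sqrt ((1 + B\<^sup>2) / real (Suc k))) \<longlonglongrightarrow> c * hnorm ip g + sqrt 0"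
      by (intro tendsto_intros nrm_Comp_LIMSEQ[OF Comp] LIMSEQ_Suc[OF lim_const_over_n])
    ultimately have "(hnorm ip g)\<^sup>2 \<le> c * hnorm ip g"
      using LIMSEQ_le[OF hnorm_sq[OF Comp]] by force
    then show ?thesis
      using c hnorm_nonneg[OF Comp] by (cases "hnorm ip g = 0") (auto simp: power2_eq_square)
  qed
  then show thesis using that Comp lim by blast
qed

end

section \<open>Operators, adjoints and commutants\<close>

interpretation hilb: semi_inner "UNIV :: 'h::complex_hilbert set" scaleC cinner
proof
  fix x y z :: 'h and c :: complex
  show "(-1) *\<^sub>C x = - x"
    using scaleR_scaleC[of "-1" x] by simp
  show "0 \<le> Re (cinner x x)"
    using norm_eq_sqrt_cinner[of x] norm_ge_zero[of x] by simp
  show "cinner x y = cnj (cinner y x)" by (rule cinner_commute)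
qed (simp_all add: cinner_add_right cinner_scaleC_right)

lemma hilb_nrm [simp]: "semi_norm cinner = (norm :: 'h::complex_hilbert \<Rightarrow> real)"
  by (rule ext) (simp add: semi_norm_def norm_eq_sqrt_cinner)

lemmas cinner_simps =
  hilb.ip_add[OF UNIV_I UNIV_I UNIV_I] hilb.ip_add_left[OF UNIV_I UNIV_I UNIV_I]
  hilb.ip_diff[OF UNIV_I UNIV_I UNIV_I] hilb.ip_diff_left[OF UNIV_I UNIV_I UNIV_I]
  hilb.ip_minus[OF UNIV_I UNIV_I] hilb.ip_minus_left[OF UNIV_I UNIV_I]
  hilb.ip_sc[OF UNIV_I UNIV_I] hilb.ip_sc_left[OF UNIV_I UNIV_I]
  hilb.ip_zero[OF UNIV_I] hilb.ip_zero_left[OF UNIV_I]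

lemma norm_scaleC: "norm (c *\<^sub>C x) = cmod c * norm (x :: 'h::complex_hilbert)"
  using hilb.nrm_sc[of x c] by simp

lemma cinner_Cauchy_Schwarz: "cmod (cinner x y) \<le> norm x * norm (y :: 'h::complex_hilbert)"
  using hilb.Cauchy_Schwarz[of x y] by simp

lemma cinner_self: "cinner x x = complex_of_real ((norm (x :: 'h::complex_hilbert))\<^sup>2)"
  using hilb.ip_self_real[of x] by simp

lemma scaleC_zero_right [simp]: "c *\<^sub>C (0 :: 'h::complex_hilbert) = 0"
  using norm_scaleC[of c "0 :: 'h"] by simp

lemma scaleC_zero_left [simp]: "0 *\<^sub>C (x :: 'h::complex_hilbert) = 0"
  using norm_scaleC[of 0 x] by simp

lemma scaleC_one [simp]: "1 *\<^sub>C (x :: 'h::complex_hilbert) = x"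
  using scaleR_scaleC[of 1 x] by simp

lemma bounded_linear_scaleC: "bounded_linear (\<lambda>x :: 'h::complex_hilbert. c *\<^sub>C x)"
proof (rule bounded_linear_intro[where K = "cmod c"])
  fix r and x :: 'h
  show "c *\<^sub>C (r *\<^sub>R x) = r *\<^sub>R (c *\<^sub>C x)"
    by (simp add: scaleR_scaleC scaleC_scaleC mult.commute)
qed (simp_all add: scaleC_add_right norm_scaleC mult.commute)

lemma cinner_ext:
  assumes "\<And>y. cinner y x = cinner y (x' :: 'h::complex_hilbert)" shows "x = x'"
proof -
  have "cinner (x - x') (x - x') = 0" using assms by (simp add: cinner_simps)
  then show ?thesis by (simp add: cinner_self del: of_real_power)
qed

lemma bounded_bilinear_cinner: "bounded_bilinear (cinner :: 'h::complex_hilbert \<Rightarrow> 'h \<Rightarrow> complex)"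
proof
  show "\<exists>K. \<forall>a b :: 'h. norm (cinner a b) \<le> norm a * norm b * K"
    using cinner_Cauchy_Schwarz by (metis mult.right_neutral)
qed (simp_all add: cinner_simps scaleR_scaleC scaleR_conv_of_real)

lemmas tendsto_cinner = bounded_bilinear.tendsto[OF bounded_bilinear_cinner]

lemma Comp_hilb_iff: "(f :: nat \<Rightarrow> 'h::complex_hilbert) \<in> hcompletion cinner UNIV \<longleftrightarrow> Cauchy f"
  by (simp add: hcompletion_def Cauchy_def dist_norm)

theorem Riesz_hilbert:
  fixes \<phi> :: "'h::complex_hilbert \<Rightarrow> complex"
  assumes "\<And>x y. \<phi> (x + y) = \<phi> x + \<phi> y" and "\<And>c x. \<phi> (c *\<^sub>C x) = c * \<phi> x"
    and "\<And>x. cmod (\<phi> x) \<le> c * norm x" and "0 \<le> c"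
  obtains z where "\<And>x. cinner z x = \<phi> x" "norm z \<le> c"
proof -
  obtain g where g: "g \<in> hcompletion cinner (UNIV :: 'h set)"
    "\<And>x. (\<lambda>k. cinner (g k) x) \<longlonglongrightarrow> \<phi> x" "hnorm cinner g \<le> c"
    using hilb.Riesz[of \<phi> c] assms by auto
  obtain z where z: "g \<longlonglongrightarrow> z"
    using g(1) Cauchy_convergent_iff convergent_def by (auto simp: Comp_hilb_iff)
  have rep: "cinner z x = \<phi> x" for x
    by (rule LIMSEQ_unique[OF tendsto_cinner[OF z tendsto_const] g(2)])
  have "(\<lambda>k. norm (g k)) \<longlonglongrightarrow> hnorm cinner g"
    using hilb.nrm_Comp_LIMSEQ[OF g(1)] by simp
  then have "norm z = hnorm cinner g"
    using LIMSEQ_unique tendsto_norm[OF z] by blast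
  then show thesis using that[OF rep] g(3) by simp
qed

lemma op_scaleC_apply [simp]: "blinfun_apply (op_scaleC c T) x = c *\<^sub>C blinfun_apply T x"
proof -
  have "bounded_linear (\<lambda>x. c *\<^sub>C blinfun_apply T x)"
    by (rule bounded_linear_compose[OF bounded_linear_scaleC blinfun.bounded_linear_right])
  then show ?thesis by (simp add: op_scaleC_def bounded_linear_Blinfun_apply)
qed

lemma bounded_ops_apply: "T \<in> bounded_ops \<Longrightarrow> blinfun_apply T (c *\<^sub>C x) = c *\<^sub>C blinfun_apply T x"
  by (simp add: bounded_ops_def)

lemma adj_exists:
  fixes T :: "'h::complex_hilbert oper"
  assumes T: "T \<in> bounded_ops"
  shows "\<exists>T'. \<forall>x y. cinner (blinfun_apply T' x) y = cinner x (blinfun_apply T y)"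
proof -
  have "\<exists>z. (\<forall>y. cinner z y = cinner x (blinfun_apply T y)) \<and> norm z \<le> norm x * norm T" for x
  proof -
    obtain z where "\<And>y. cinner z y = cinner x (blinfun_apply T y)" "norm z \<le> norm x * norm T"
    proof (rule Riesz_hilbert[of "\<lambda>y. cinner x (blinfun_apply T y)" "norm x * norm T"])
      fix y
      show "cmod (cinner x (blinfun_apply T y)) \<le> norm x * norm T * norm y"
        using cinner_Cauchy_Schwarz[of x "blinfun_apply T y"]
          mult_left_mono[OF norm_blinfun[of T y] norm_ge_zero[of x]]
        by (simp add: mult.assoc)
    qed (auto simp: blinfun.add_right cinner_simps bounded_ops_apply[OF T])
    then show ?thesis by blast
  qed
  then obtain F where F: "\<And>x y. cinner (F x) y = cinner x (blinfun_apply T y)"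
    and FN: "\<And>x. norm (F x) \<le> norm x * norm T" by metis
  have F': "cinner y (F x) = cinner (blinfun_apply T y) x" for x y
    using F[of x y] cinner_commute by metis
  have "bounded_linear F"
  proof (rule bounded_linear_intro[where K = "norm T"])
    show "F (x + y) = F x + F y" for x y by (rule cinner_ext) (simp add: F' cinner_simps)
    show "F (r *\<^sub>R x) = r *\<^sub>R F x" for r x
      by (rule cinner_ext) (simp add: F' cinner_simps scaleR_scaleC)
  qed (rule FN)
  then show ?thesis using F by (metis bounded_linear_Blinfun_apply)
qed

lemma adj_cinner_left:
  fixes T :: "'h::complex_hilbert oper"
  assumes "T \<in> bounded_ops"
  shows "cinner (blinfun_apply (adj T) x) y = cinner x (blinfun_apply T y)"
proof -
  have "\<exists>!T' :: 'h oper. \<forall>x y. cinner (blinfun_apply T' x) y = cinner x (blinfun_apply T y)"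
  proof (rule ex_ex1I[OF adj_exists[OF assms]])
    fix A B :: "'h oper"
    assume A: "\<forall>x y. cinner (blinfun_apply A x) y = cinner x (blinfun_apply T y)"
      and B: "\<forall>x y. cinner (blinfun_apply B x) y = cinner x (blinfun_apply T y)"
    show "A = B"
    proof (rule blinfun_eqI)
      fix x
      show "blinfun_apply A x = blinfun_apply B x"
        by (rule cinner_ext) (metis A B cinner_commute)
    qed
  qed
  from theI'[OF this] show ?thesis unfolding adj_def by blast
qed

lemma adj_cinner_right:
  assumes "T \<in> bounded_ops"
  shows "cinner x (blinfun_apply (adj T) y) = cinner (blinfun_apply T x) y"
  using adj_cinner_left[OF assms, of y x] cinner_commute by metis

lemma adj_unique:
  fixes T A :: "'h::complex_hilbert oper"
  assumes "T \<in> bounded_ops" "\<And>x y. cinner x (blinfun_apply A y) = cinner (blinfun_apply T x) y"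
  shows "adj T = A"
  by (intro blinfun_eqI cinner_ext) (simp add: assms adj_cinner_right)

lemma bounded_ops_adj: assumes "T \<in> bounded_ops" shows "adj T \<in> bounded_ops"
proof -
  have "blinfun_apply (adj T) (c *\<^sub>C x) = c *\<^sub>C blinfun_apply (adj T) x" for c x
    by (rule cinner_ext) (simp add: adj_cinner_right[OF assms] cinner_simps)
  then show ?thesis by (simp add: bounded_ops_def)
qed

lemma bounded_ops_id: "id_blinfun \<in> bounded_ops"
  and bounded_ops_zero: "0 \<in> bounded_ops"
  and bounded_ops_comp: "S \<in> bounded_ops \<Longrightarrow> T \<in> bounded_ops \<Longrightarrow> S o\<^sub>L T \<in> bounded_ops"
  and bounded_ops_add: "S \<in> bounded_ops \<Longrightarrow> T \<in> bounded_ops \<Longrightarrow> S + T \<in> bounded_ops"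
  and bounded_ops_sc: "T \<in> bounded_ops \<Longrightarrow> op_scaleC c T \<in> bounded_ops"
  by (auto simp: bounded_ops_def blinfun.add_left scaleC_add_right scaleC_scaleC mult.commute)

lemma adj_adj: "T \<in> bounded_ops \<Longrightarrow> adj (adj T) = T"
  by (rule adj_unique) (simp_all add: bounded_ops_adj adj_cinner_left)

lemma adj_comp: "S \<in> bounded_ops \<Longrightarrow> T \<in> bounded_ops \<Longrightarrow> adj (S o\<^sub>L T) = adj T o\<^sub>L adj S"
  by (rule adj_unique) (simp_all add: bounded_ops_comp adj_cinner_right)

lemma adj_add: "S \<in> bounded_ops \<Longrightarrow> T \<in> bounded_ops \<Longrightarrow> adj (S + T) = adj S + adj T"
  by (rule adj_unique)
    (simp_all add: bounded_ops_add blinfun.add_left cinner_simps adj_cinner_right)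

lemma adj_sc: "T \<in> bounded_ops \<Longrightarrow> adj (op_scaleC c T) = op_scaleC (cnj c) (adj T)"
  by (rule adj_unique) (simp_all add: bounded_ops_sc cinner_simps adj_cinner_right)

lemma adj_id: "adj id_blinfun = (id_blinfun :: 'h::complex_hilbert oper)"
  by (rule adj_unique) (simp_all add: bounded_ops_id)

lemma adj_zero: "adj 0 = (0 :: 'h::complex_hilbert oper)"
  by (rule adj_unique) (simp_all add: bounded_ops_zero cinner_simps)

lemma op_scaleC_add_right: "op_scaleC c (S + T) = op_scaleC c S + op_scaleC c T"
  by (rule blinfun_eqI) (simp add: blinfun.add_left scaleC_add_right)

lemma op_scaleC_add_left: "op_scaleC (c + d) T = op_scaleC c T + op_scaleC d T"
  by (rule blinfun_eqI) (simp add: blinfun.add_left scaleC_add_left)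

lemma op_scaleC_op_scaleC: "op_scaleC c (op_scaleC d T) = op_scaleC (c * d) T"
  by (rule blinfun_eqI) (simp add: scaleC_scaleC)

lemma op_scaleC_zero_left [simp]: "op_scaleC 0 T = 0"
  by (rule blinfun_eqI) simp

lemma op_scaleC_zero_right [simp]: "op_scaleC c 0 = 0"
  by (rule blinfun_eqI) simp

lemma op_scaleC_one [simp]: "op_scaleC 1 T = T"
  by (rule blinfun_eqI) simp

lemma op_scaleC_of_real: "op_scaleC (complex_of_real r) T = r *\<^sub>R T"
  by (rule blinfun_eqI) (simp add: scaleR_scaleC blinfun.scaleR_left)

lemma op_scaleC_minus_one: "op_scaleC (-1) T = - T"
  using op_scaleC_of_real[of "-1" T] by simp

lemma op_scaleC_comp_left: "op_scaleC c S o\<^sub>L T = op_scaleC c (S o\<^sub>L T)"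
  by (rule blinfun_eqI) simp

lemma op_scaleC_comp_right: "S \<in> bounded_ops \<Longrightarrow> S o\<^sub>L op_scaleC c T = op_scaleC c (S o\<^sub>L T)"
  by (rule blinfun_eqI) (simp add: bounded_ops_apply)

lemma comp_add_left: "(S + T) o\<^sub>L U = (S o\<^sub>L U) + (T o\<^sub>L (U :: 'h::real_normed_vector \<Rightarrow>\<^sub>L 'h))"
  by (rule blinfun_eqI) (simp add: blinfun.add_left)

lemma comp_add_right: "U o\<^sub>L (S + T) = (U o\<^sub>L S) + (U o\<^sub>L (T :: 'h::real_normed_vector \<Rightarrow>\<^sub>L 'h))"
  by (rule blinfun_eqI) (simp add: blinfun.add_left blinfun.add_right)

lemma comp_assoc_blinfun:
  "(S o\<^sub>L T) o\<^sub>L U = S o\<^sub>L (T o\<^sub>L (U :: 'h::real_normed_vector \<Rightarrow>\<^sub>L 'h))"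
  by (rule blinfun_eqI) simp

lemma comp_id_left [simp]: "id_blinfun o\<^sub>L T = T"
  by (rule blinfun_eqI) simp

lemma comp_id_right [simp]: "T o\<^sub>L id_blinfun = T"
  by (rule blinfun_eqI) simp

lemma comp_zero_left [simp]: "0 o\<^sub>L T = 0"
  by (rule blinfun_eqI) simp

lemma comp_zero_right [simp]: "T o\<^sub>L 0 = 0"
  by (rule blinfun_eqI) simp

lemma commutant_bounded_ops: "commutant Z \<subseteq> bounded_ops"
  by (auto simp: commutant_def)

lemma commutant_antimono: "Y \<subseteq> Z \<Longrightarrow> commutant Z \<subseteq> commutant Y"
  by (auto simp: commutant_def)

lemma subset_bicommutant: "Z \<subseteq> bounded_ops \<Longrightarrow> Z \<subseteq> commutant (commutant Z)"
  by (auto simp: commutant_def)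

lemma commutant_id: "id_blinfun \<in> commutant Z"
  by (simp add: commutant_def bounded_ops_id)

lemma commutant_zero: "0 \<in> commutant Z"
  by (simp add: commutant_def bounded_ops_zero)

lemma commutant_add: "S \<in> commutant Z \<Longrightarrow> T \<in> commutant Z \<Longrightarrow> S + T \<in> commutant Z"
  by (simp add: commutant_def bounded_ops_add comp_add_left comp_add_right)

lemma commutant_sc: "Z \<subseteq> bounded_ops \<Longrightarrow> T \<in> commutant Z \<Longrightarrow> op_scaleC c T \<in> commutant Z"
  by (auto simp: commutant_def bounded_ops_sc op_scaleC_comp_left op_scaleC_comp_right)

lemma commutant_comp: "S \<in> commutant Z \<Longrightarrow> T \<in> commutant Z \<Longrightarrow> S o\<^sub>L T \<in> commutant Z"
proof -
  assume S: "S \<in> commutant Z" and T: "T \<in> commutant Z"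
  have "(S o\<^sub>L T) o\<^sub>L z = z o\<^sub>L (S o\<^sub>L T)" if "z \<in> Z" for z
  proof -
    have "(S o\<^sub>L T) o\<^sub>L z = S o\<^sub>L (z o\<^sub>L T)"
      using T that by (simp add: commutant_def comp_assoc_blinfun)
    also have "\<dots> = (z o\<^sub>L S) o\<^sub>L T"
      using S that by (simp add: commutant_def flip: comp_assoc_blinfun)
    finally show ?thesis by (simp add: comp_assoc_blinfun)
  qed
  then show ?thesis using S T by (simp add: commutant_def bounded_ops_comp)
qed

lemma commutant_adj:
  assumes "Z \<subseteq> bounded_ops" "adj ` Z \<subseteq> Z" "T \<in> commutant Z"
  shows "adj T \<in> commutant Z"
proof -
  have T: "T \<in> bounded_ops" using assms by (simp add: commutant_def)
  have "adj T o\<^sub>L z = z o\<^sub>L adj T" if z: "z \<in> Z" for z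
  proof -
    have zB: "z \<in> bounded_ops" "adj z \<in> bounded_ops" using assms z bounded_ops_adj by auto
    have "T o\<^sub>L adj z = adj z o\<^sub>L T" using assms z by (auto simp: commutant_def)
    then have "adj (T o\<^sub>L adj z) = adj (adj z o\<^sub>L T)" by simp
    then show ?thesis using T zB by (simp add: adj_comp adj_adj)
  qed
  then show ?thesis using T by (simp add: commutant_def bounded_ops_adj)
qed


section \<open>Tracial states\<close>

locale tracial_space =
  fixes M :: "'h::complex_hilbert oper set" and \<tau> :: "'h oper \<Rightarrow> complex"
  assumes tracial: "tracial_W_star_probability_space M \<tau>"
begin

lemma vN: "von_neumann_algebra M"
  using tracial by (simp add: tracial_W_star_probability_space_def)

lemma M_bounded: "a \<in> M \<Longrightarrow> a \<in> bounded_ops"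
  using vN by (auto simp: von_neumann_algebra_def)

lemma M_bicommutant: "commutant (commutant M) = M"
  using vN by (simp add: von_neumann_algebra_def)

lemma M_adj: "a \<in> M \<Longrightarrow> adj a \<in> M"
  using vN by (auto simp: von_neumann_algebra_def)

lemma M_id: "id_blinfun \<in> M"
  using commutant_id M_bicommutant by metis

lemma M_zero: "0 \<in> M"
  using commutant_zero M_bicommutant by metis

lemma M_add: "a \<in> M \<Longrightarrow> b \<in> M \<Longrightarrow> a + b \<in> M"
  using commutant_add M_bicommutant by metis

lemma M_comp: "a \<in> M \<Longrightarrow> b \<in> M \<Longrightarrow> a o\<^sub>L b \<in> M"
  using commutant_comp M_bicommutant by metis

lemma M_sc: "a \<in> M \<Longrightarrow> op_scaleC c a \<in> M"
  using commutant_sc[OF commutant_bounded_ops] M_bicommutant by metis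

lemma M_scaleR: "a \<in> M \<Longrightarrow> r *\<^sub>R a \<in> M"
  using M_sc[of a "complex_of_real r"] by (simp add: op_scaleC_of_real)

lemma M_minus: "a \<in> M \<Longrightarrow> - a \<in> M"
  using M_sc[of a "-1"] by (simp add: op_scaleC_minus_one)

lemma M_diff: "a \<in> M \<Longrightarrow> b \<in> M \<Longrightarrow> a - b \<in> M"
  using M_add[of a "- b"] M_minus by simp

lemma M_sum: "(\<And>i. i \<in> I \<Longrightarrow> f i \<in> M) \<Longrightarrow> (\<Sum>i\<in>I. f i) \<in> M"
  by (induction I rule: infinite_finite_induct) (auto simp: M_zero M_add)

lemmas M_closed = M_adj M_id M_zero M_add M_comp M_sc M_scaleR M_minus M_diff

lemma tau_add: "a \<in> M \<Longrightarrow> b \<in> M \<Longrightarrow> \<tau> (a + b) = \<tau> a + \<tau> b"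
  and tau_sc: "a \<in> M \<Longrightarrow> \<tau> (op_scaleC c a) = c * \<tau> a"
  and tau_pos: "a \<in> M \<Longrightarrow> \<tau> (adj a o\<^sub>L a) \<in> \<real>\<^sub>\<ge>\<^sub>0"
  and tau_id: "\<tau> id_blinfun = 1"
  and tau_comm: "a \<in> M \<Longrightarrow> b \<in> M \<Longrightarrow> \<tau> (a o\<^sub>L b) = \<tau> (b o\<^sub>L a)"
  and tau_normal: "normal_functional M \<tau>"
  using tracial by (simp_all add: tracial_W_star_probability_space_def)

lemma tau_zero: "\<tau> 0 = 0"
  using tau_add[OF M_zero M_zero] by simp

lemma tau_scaleR: "a \<in> M \<Longrightarrow> \<tau> (r *\<^sub>R a) = r * \<tau> a"
  using tau_sc[of a "complex_of_real r"] by (simp add: op_scaleC_of_real)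

lemma tau_sum: "(\<And>i. i \<in> I \<Longrightarrow> f i \<in> M) \<Longrightarrow> \<tau> (\<Sum>i\<in>I. f i) = (\<Sum>i\<in>I. \<tau> (f i))"
  by (induction I rule: infinite_finite_induct) (auto simp: tau_zero tau_add M_sum)

text \<open>A positive functional is hermitian: \<open>\<tau>(b\<^sup>* b)\<close> is real for \<open>b = 1 + c a\<close> with \<open>c = 1\<close> and
  \<open>c = \<i>\<close>.\<close>

lemma tau_adj: assumes a: "a \<in> M" shows "\<tau> (adj a) = cnj (\<tau> a)"
proof -
  have *: "Im (c * \<tau> a + cnj c * \<tau> (adj a)) = 0" for c
  proof -
    define b where "b = id_blinfun + op_scaleC c a"
    have aB: "a \<in> bounded_ops" using a M_bounded by blast
    have bM: "b \<in> M" unfolding b_def using a by (simp add: M_closed)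
    have "adj b = id_blinfun + op_scaleC (cnj c) (adj a)"
      unfolding b_def using aB by (simp add: adj_add adj_id adj_sc bounded_ops_id bounded_ops_sc)
    then have "adj b o\<^sub>L b = id_blinfun + op_scaleC c a + op_scaleC (cnj c) (adj a)
        + op_scaleC (cnj c * c) (adj a o\<^sub>L a)"
      by (simp add: b_def comp_add_left comp_add_right op_scaleC_comp_left op_scaleC_comp_right
          bounded_ops_adj aB op_scaleC_op_scaleC algebra_simps mult.commute)
    then have "\<tau> (adj b o\<^sub>L b) = 1 + c * \<tau> a + cnj c * \<tau> (adj a) + (cnj c * c) * \<tau> (adj a o\<^sub>L a)"
      using a by (simp add: tau_add tau_sc tau_id M_closed)
    moreover have "Im (\<tau> (adj b o\<^sub>L b)) = 0" using tau_pos[OF bM] by (auto simp: complex_nonneg_Reals_iff)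
    moreover have "Im (\<tau> (adj a o\<^sub>L a)) = 0"
      using tau_pos[OF a] by (auto simp: complex_nonneg_Reals_iff)
    ultimately show ?thesis by simp
  qed
  show ?thesis using *[of 1] *[of \<i>] by (simp add: complex_eq_iff)
qed

sublocale m: semi_inner M op_scaleC "inner2 \<tau>"
proof
  fix x y z c
  assume x: "x \<in> M"
  show "op_scaleC (-1) x = - x" by (rule op_scaleC_minus_one)
  show "0 \<le> Re (inner2 \<tau> x x)"
    using tau_pos[OF x] by (auto simp: inner2_def complex_nonneg_Reals_iff)
  assume y: "y \<in> M"
  show "inner2 \<tau> x (op_scaleC c y) = c * inner2 \<tau> x y"
    using x y by (simp add: inner2_def op_scaleC_comp_right tau_sc M_bounded M_closed)
  have "adj (adj y o\<^sub>L x) = adj x o\<^sub>L y"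
    using x y M_bounded by (simp add: adj_comp adj_adj bounded_ops_adj)
  then show "inner2 \<tau> x y = cnj (inner2 \<tau> y x)"
    using tau_adj[of "adj y o\<^sub>L x"] x y by (simp add: inner2_def M_closed)
  assume z: "z \<in> M"
  show "inner2 \<tau> x (y + z) = inner2 \<tau> x y + inner2 \<tau> x z"
    using x y z by (simp add: inner2_def comp_add_right tau_add M_closed)
qed (simp_all add: M_closed)

end

section \<open>Linear extension on finitely supported functions\<close>

definition pm_scale :: "complex \<Rightarrow> ('k \<Rightarrow>\<^sub>0 complex) \<Rightarrow> ('k \<Rightarrow>\<^sub>0 complex)" where
  "pm_scale c p = Poly_Mapping.map ((*) c) p"

lemma lookup_pm_scale [simp]: "Poly_Mapping.lookup (pm_scale c p) k = c * Poly_Mapping.lookup p k"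
  by (simp add: pm_scale_def map.rep_eq when_def)

lemma pm_scale_add: "pm_scale c (p + q) = pm_scale c p + pm_scale c q"
  by (rule poly_mapping_eqI) (simp add: lookup_add algebra_simps)

lemma pm_scale_zero [simp]: "pm_scale c 0 = 0"
  by (rule poly_mapping_eqI) simp

lemma pm_scale_single [simp]: "pm_scale c (Poly_Mapping.single k d) = Poly_Mapping.single k (c * d)"
  by (rule poly_mapping_eqI) (simp add: lookup_single when_def)

lemma pm_scale_sum: "pm_scale c (\<Sum>i\<in>I. f i) = (\<Sum>i\<in>I. pm_scale c (f i))"
  by (induction I rule: infinite_finite_induct) (auto simp: pm_scale_add)

lemma pm_scale_minus_one: "pm_scale (-1) p = - p"
  by (rule poly_mapping_eqI) simp

text \<open>Evaluation and both kinds of differentiation have this shape; additivity of \<open>F\<close> in the coefficient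
  is what makes them linear.\<close>

definition pm_sum :: "('k \<Rightarrow> complex \<Rightarrow> 'v::comm_monoid_add) \<Rightarrow> ('k \<Rightarrow>\<^sub>0 complex) \<Rightarrow> 'v" where
  "pm_sum F p = (\<Sum>k\<in>Poly_Mapping.keys p. F k (Poly_Mapping.lookup p k))"

lemma pm_sum_superset:
  assumes "\<And>k. F k 0 = 0" "finite A" "Poly_Mapping.keys p \<subseteq> A"
  shows "pm_sum F p = (\<Sum>k\<in>A. F k (Poly_Mapping.lookup p k))"
  unfolding pm_sum_def
  by (rule sum.mono_neutral_left) (use assms in \<open>auto simp: in_keys_iff\<close>)

lemma pm_sum_zero [simp]: "pm_sum F 0 = 0"
  by (simp add: pm_sum_def)

lemma pm_sum_single: "F k 0 = 0 \<Longrightarrow> pm_sum F (Poly_Mapping.single k c) = F k c"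
  by (simp add: pm_sum_def)

lemma pm_sum_add:
  assumes "\<And>k c d. F k (c + d) = F k c + F k d" "\<And>k. F k 0 = 0"
  shows "pm_sum F (p + q) = pm_sum F p + pm_sum F q"
proof -
  let ?A = "Poly_Mapping.keys p \<union> Poly_Mapping.keys q"
  have "pm_sum F (p + q) = (\<Sum>k\<in>?A. F k (Poly_Mapping.lookup (p + q) k))"
    by (rule pm_sum_superset) (auto simp: assms Poly_Mapping.keys_add)
  also have "\<dots> = (\<Sum>k\<in>?A. F k (Poly_Mapping.lookup p k)) + (\<Sum>k\<in>?A. F k (Poly_Mapping.lookup q k))"
    by (simp add: lookup_add assms sum.distrib)
  also have "(\<Sum>k\<in>?A. F k (Poly_Mapping.lookup p k)) = pm_sum F p"
    by (rule pm_sum_superset[symmetric]) (auto simp: assms)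
  also have "(\<Sum>k\<in>?A. F k (Poly_Mapping.lookup q k)) = pm_sum F q"
    by (rule pm_sum_superset[symmetric]) (auto simp: assms)
  finally show ?thesis .
qed

lemma pm_sum_scale:
  assumes "\<And>k d. F k (c * d) = g (F k d)" "\<And>k. F k 0 = 0"
    "g 0 = 0" "\<And>x y. g (x + y) = g x + g y"
  shows "pm_sum F (pm_scale c p) = g (pm_sum F p)"
proof -
  have "pm_sum F (pm_scale c p) = (\<Sum>k\<in>Poly_Mapping.keys p. F k (c * Poly_Mapping.lookup p k))"
    using pm_sum_superset[of F "Poly_Mapping.keys p" "pm_scale c p"] assms(2)
    by (simp add: in_keys_iff subset_iff)
  also have "\<dots> = (\<Sum>k\<in>Poly_Mapping.keys p. g (F k (Poly_Mapping.lookup p k)))"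
    by (simp add: assms)
  also have "\<dots> = g (pm_sum F p)"
    unfolding pm_sum_def using sum_comp_morphism[of g, OF assms(3,4)] by (simp add: o_def)
  finally show ?thesis .
qed

lemma pm_induct [case_names zero single add]:
  fixes p :: "'k \<Rightarrow>\<^sub>0 complex"
  assumes P0: "P 0" and P1: "\<And>k c. P (Poly_Mapping.single k c)"
    and P2: "\<And>p q. P p \<Longrightarrow> P q \<Longrightarrow> P (p + q)"
  shows "P p"
proof -
  have sum_P: "P (\<Sum>k\<in>A. Poly_Mapping.single k (Poly_Mapping.lookup p k))" if "finite A" for A
    using that by (induction A rule: finite_induct) (simp_all add: P0 P1 P2)
  have "p = (\<Sum>k\<in>Poly_Mapping.keys p. Poly_Mapping.single k (Poly_Mapping.lookup p k))"
    by (rule poly_mapping_eqI)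
      (simp add: lookup_sum lookup_single when_def sum.delta in_keys_iff)
  then show ?thesis using sum_P[of "Poly_Mapping.keys p"] by simp
qed


section \<open>Evaluation and differentiation of noncommutative polynomials\<close>

lemma poly_eval_pm_sum: "poly_eval X = pm_sum (\<lambda>w c. op_scaleC c (word_eval X w))"
  by (rule ext) (simp add: poly_eval_def pm_sum_def)

lemma poly_eval_add: "poly_eval X (p + q) = poly_eval X p + poly_eval X q"
  unfolding poly_eval_pm_sum by (rule pm_sum_add) (simp_all add: op_scaleC_add_left)

lemma poly_eval_scale: "poly_eval X (pm_scale c p) = op_scaleC c (poly_eval X p)"
  unfolding poly_eval_pm_sum
  by (rule pm_sum_scale) (simp_all add: op_scaleC_op_scaleC op_scaleC_add_right)

lemma poly_eval_single: "poly_eval X (Poly_Mapping.single w c) = op_scaleC c (word_eval X w)"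
  unfolding poly_eval_pm_sum by (rule pm_sum_single) simp

lemma poly_eval_zero [simp]: "poly_eval X 0 = 0"
  by (simp add: poly_eval_pm_sum)

lemma poly_eval_minus: "poly_eval X (- p) = - poly_eval X p"
  using poly_eval_scale[of X "-1" p] by (simp add: pm_scale_minus_one op_scaleC_minus_one)

lemma poly_eval_diff: "poly_eval X (p - q) = poly_eval X p - poly_eval X q"
  using poly_eval_add[of X p "- q"] by (simp add: poly_eval_minus)

lemma poly_eval_sum: "poly_eval X (\<Sum>i\<in>I. f i) = (\<Sum>i\<in>I. poly_eval X (f i))"
  by (induction I rule: infinite_finite_induct) (auto simp: poly_eval_add)

lemma op_prod_Nil [simp]: "op_prod [] = id_blinfun"
  and op_prod_Cons [simp]: "op_prod (T # Ts) = T o\<^sub>L op_prod Ts"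
  by (simp_all add: op_prod_def)

lemma op_prod_append: "op_prod (Ss @ Ts) = op_prod Ss o\<^sub>L op_prod Ts"
  by (induction Ss) (simp_all add: comp_assoc_blinfun)

lemma word_eval_Nil [simp]: "word_eval X [] = id_blinfun"
  and word_eval_Cons [simp]: "word_eval X (i # w) = X i o\<^sub>L word_eval X w"
  by (simp_all add: word_eval_def)

lemma word_eval_append: "word_eval X (v @ w) = word_eval X v o\<^sub>L word_eval X w"
  by (simp add: word_eval_def op_prod_append)

lemma free_diff_pm_sum:
  "free_diff j = pm_sum (\<lambda>w c. \<Sum>k | k < length w \<and> w ! k = j.
      Poly_Mapping.single (take k w, drop (Suc k) w) c)"
  by (rule ext) (simp add: free_diff_def pm_sum_def)

lemma free_diff_add: "free_diff j (p + q) = free_diff j p + free_diff j q"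
  unfolding free_diff_pm_sum by (rule pm_sum_add) (simp_all add: single_add sum.distrib)

lemma free_diff_scale: "free_diff j (pm_scale c p) = pm_scale c (free_diff j p)"
  unfolding free_diff_pm_sum
  by (rule pm_sum_scale) (simp_all add: pm_scale_add pm_scale_sum)

lemma free_diff_single: "free_diff j (Poly_Mapping.single w c)
    = (\<Sum>k | k < length w \<and> w ! k = j. Poly_Mapping.single (take k w, drop (Suc k) w) c)"
  unfolding free_diff_pm_sum by (rule pm_sum_single) simp

lemma free_diff_zero [simp]: "free_diff j 0 = 0"
  by (simp add: free_diff_pm_sum)

lemma cyclic_diff_pm_sum:
  "cyclic_diff j = pm_sum (\<lambda>w c. \<Sum>k | k < length w \<and> w ! k = j.
      Poly_Mapping.single (drop (Suc k) w @ take k w) c)"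
  by (rule ext) (simp add: cyclic_diff_def pm_sum_def)

lemma cyclic_diff_add: "cyclic_diff j (p + q) = cyclic_diff j p + cyclic_diff j q"
  unfolding cyclic_diff_pm_sum by (rule pm_sum_add) (simp_all add: single_add sum.distrib)

lemma cyclic_diff_zero [simp]: "cyclic_diff j 0 = 0"
  by (simp add: cyclic_diff_pm_sum)

lemma cyclic_diff_sum: "cyclic_diff j (\<Sum>i\<in>I. f i) = (\<Sum>i\<in>I. cyclic_diff j (f i))"
  by (induction I rule: infinite_finite_induct) (auto simp: cyclic_diff_add)

lemma cyclic_diff_quadratic:
  "cyclic_diff m (Poly_Mapping.single [i, j] c)
     = (if i = m then Poly_Mapping.single [j] c else 0) + (if j = m then Poly_Mapping.single [i] c else 0)"
proof -
  have "{k. k < length [i, j] \<and> [i, j] ! k = m}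
      = (if i = m then {0} else {}) \<union> (if j = m then {Suc 0} else {})"
    by (auto simp: less_Suc_eq numeral_2_eq_2 nth_Cons' split: if_splits)
  then show ?thesis
    unfolding cyclic_diff_pm_sum by (subst pm_sum_single) auto
qed

lemma bipoly_eval_pm_sum:
  "bipoly_eval X = pm_sum (\<lambda>(v, w). Poly_Mapping.single (word_eval X v, word_eval X w))"
  by (rule ext) (simp add: bipoly_eval_def pm_sum_def case_prod_unfold)

lemma bipoly_eval_add: "bipoly_eval X (p + q) = bipoly_eval X p + bipoly_eval X q"
  unfolding bipoly_eval_pm_sum by (rule pm_sum_add) (auto simp: single_add)

lemma bipoly_eval_scale: "bipoly_eval X (pm_scale c p) = pm_scale c (bipoly_eval X p)"
  unfolding bipoly_eval_pm_sum by (rule pm_sum_scale) (auto simp: pm_scale_add)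

lemma bipoly_eval_single: "bipoly_eval X (Poly_Mapping.single (v, w) c)
    = Poly_Mapping.single (word_eval X v, word_eval X w) c"
  unfolding bipoly_eval_pm_sum by (subst pm_sum_single) auto

lemma bipoly_eval_zero [simp]: "bipoly_eval X 0 = 0"
  by (simp add: bipoly_eval_pm_sum)

lemma bipoly_eval_sum: "bipoly_eval X (\<Sum>i\<in>I. f i) = (\<Sum>i\<in>I. bipoly_eval X (f i))"
  by (induction I rule: infinite_finite_induct) (auto simp: bipoly_eval_add)


section \<open>The inner product of the algebraic tensor product\<close>

text \<open>Cholesky factorization, by elimination of one index at a time: the Schur complement of the
  eliminated diagonal entry is again positive semidefinite. Division by a zero pivot is harmless,
  since its row vanishes and \<open>x / 0 = 0\<close>.\<close>

lemma psd_factorization: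
  fixes g :: "'i \<Rightarrow> 'i \<Rightarrow> complex"
  assumes "finite I"
    and "\<And>x y. x \<in> I \<Longrightarrow> y \<in> I \<Longrightarrow> g x y = cnj (g y x)"
    and "\<And>z. 0 \<le> Re (\<Sum>x\<in>I. \<Sum>y\<in>I. cnj (z x) * z y * g x y)"
  shows "\<exists>v :: 'i \<Rightarrow> 'i \<Rightarrow> complex. \<forall>x\<in>I. \<forall>y\<in>I. g x y = (\<Sum>r\<in>I. cnj (v r x) * v r y)"
  using assms
proof (induction I arbitrary: g rule: finite_induct)
  case empty
  then show ?case by simp
next
  case (insert i I)
  note herm = insert.prems(1) and pos = insert.prems(2)
  define q where "q z = (\<Sum>x\<in>I. \<Sum>y\<in>I. cnj (z x) * z y * g x y)" for z
  define s where "s z = (\<Sum>y\<in>I. g i y * z y)" for z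
  have s_cnj: "(\<Sum>x\<in>I. cnj (z x) * g x i) = cnj (s z)" for z
  proof -
    have "cnj (g i y) = g y i" if "y \<in> I" for y
      using herm[of y i] that by simp
    then show ?thesis by (simp add: s_def mult.commute)
  qed
  have expand: "(\<Sum>x\<in>insert i I. \<Sum>y\<in>insert i I. cnj (z x) * z y * g x y)
      = cnj (z i) * z i * g i i + cnj (z i) * s z + z i * cnj (s z) + q z" for z
  proof -
    have "(\<Sum>x\<in>insert i I. \<Sum>y\<in>insert i I. cnj (z x) * z y * g x y)
        = cnj (z i) * z i * g i i + (\<Sum>y\<in>I. cnj (z i) * z y * g i y)
          + ((\<Sum>x\<in>I. cnj (z x) * z i * g x i) + q z)"
      using insert.hyps by (simp add: sum.distrib q_def)
    also have "(\<Sum>y\<in>I. cnj (z i) * z y * g i y) = cnj (z i) * s z"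
      by (simp add: s_def sum_distrib_left mult_ac)
    also have "(\<Sum>x\<in>I. cnj (z x) * z i * g x i) = z i * cnj (s z)"
      by (simp add: s_cnj[symmetric] sum_distrib_left mult_ac)
    finally show ?thesis by simp
  qed
  obtain p where p: "g i i = complex_of_real p"
    using herm[of i i] by (metis Reals_cases Reals_cnj_iff insertI1)
  have p0: "0 \<le> p"
  proof -
    have "s (\<lambda>x. if x = i then 1 else 0) = 0" "q (\<lambda>x. if x = i then 1 else 0) = 0"
      using insert.hyps by (auto simp: s_def q_def intro!: sum.neutral)
    then show ?thesis
      using pos[of "\<lambda>x. if x = i then 1 else 0"] by (simp add: expand p)
  qed
  have zero_row: "g i y = 0" if "p = 0" "y \<in> I" for y
  proof (rule ccontr)
    assume ne: "g i y \<noteq> 0"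
    define t where "t = - complex_of_real ((cmod (g y y) + 1) / (cmod (g i y))\<^sup>2) * g i y"
    define z where "z x = (if x = i then t else if x = y then 1 else 0)" for x
    have yi: "y \<noteq> i" using that insert.hyps by auto
    have sz: "s z = g i y"
    proof -
      have "s z = (\<Sum>x\<in>I. if x = y then g i y else 0)"
        unfolding s_def using insert.hyps by (intro sum.cong) (auto simp: z_def)
      then show ?thesis using insert.hyps that by simp
    qed
    have qz: "q z = g y y"
    proof -
      have "q z = (\<Sum>x\<in>I. \<Sum>y'\<in>I. if x = y \<and> y' = y then g y y else 0)"
        unfolding q_def using insert.hyps by (intro sum.cong) (auto simp: z_def)
      also have "\<dots> = (\<Sum>x\<in>I. if x = y then g y y else 0)"
        using insert.hyps that by (intro sum.cong) (auto simp: sum.delta)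
      finally show ?thesis using insert.hyps that by (simp add: sum.delta)
    qed
    have "cnj t * g i y = - complex_of_real (cmod (g y y) + 1)"
    proof -
      have "cnj (g i y) * g i y = complex_of_real ((cmod (g i y))\<^sup>2)"
        by (simp only: complex_norm_square mult.commute)
      then have "cnj t * g i y
          = - complex_of_real ((cmod (g y y) + 1) / (cmod (g i y))\<^sup>2 * (cmod (g i y))\<^sup>2)"
        by (simp add: t_def mult.assoc)
      then show ?thesis using ne by simp
    qed
    then have "Re (cnj t * g i y) = - (cmod (g y y) + 1)" by simp
    moreover have "Re (t * cnj (g i y)) = Re (cnj t * g i y)" by simp
    moreover have "Re (g y y) \<le> cmod (g y y)" by (rule complex_Re_le_cmod)
    ultimately have "Re (cnj t * g i y + t * cnj (g i y) + g y y) < 0"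
      using norm_ge_zero[of "g y y"] by (simp del: norm_ge_zero)
    moreover have "0 \<le> Re (cnj t * g i y + t * cnj (g i y) + g y y)"
    proof -
      have "z i = t" by (simp add: z_def)
      then show ?thesis using pos[of z] unfolding expand sz qz by (simp add: p that)
    qed
    ultimately show False by simp
  qed
  define g' where "g' x y = g x y - g x i * g i y / complex_of_real p" for x y
  have "\<exists>v :: 'i \<Rightarrow> 'i \<Rightarrow> complex. \<forall>x\<in>I. \<forall>y\<in>I. g' x y = (\<Sum>r\<in>I. cnj (v r x) * v r y)"
  proof (rule insert.IH)
    show "g' x y = cnj (g' y x)" if "x \<in> I" "y \<in> I" for x y
      using herm[of x y] herm[of x i] herm[of i y] that by (simp add: g'_def mult.commute)
    fix z
    define z' where "z' x = (if x = i then - s z / complex_of_real p else z x)" for x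
    have eq: "s z' = s z" "q z' = q z"
      using insert.hyps by (auto simp: s_def q_def z'_def intro!: sum.cong)
    have "(\<Sum>x\<in>I. \<Sum>y\<in>I. cnj (z x) * z y * g' x y) = q z - cnj (s z) * s z / complex_of_real p"
    proof -
      have "cnj (s z) * s z = (\<Sum>x\<in>I. \<Sum>y\<in>I. (cnj (z x) * g x i) * (g i y * z y))"
        by (simp add: s_cnj[symmetric] sum_product) (simp add: s_def sum_product)
      then show ?thesis
        by (simp add: g'_def q_def sum_subtractf sum_divide_distrib algebra_simps)
    qed
    also have "\<dots> = cnj (z' i) * z' i * g i i + cnj (z' i) * s z' + z' i * cnj (s z') + q z'"
      unfolding eq by (cases "p = 0") (simp_all add: z'_def p field_simps)
    finally show "0 \<le> Re (\<Sum>x\<in>I. \<Sum>y\<in>I. cnj (z x) * z y * g' x y)"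
      using pos[of z'] by (simp add: expand)
  qed
  then obtain v :: "'i \<Rightarrow> 'i \<Rightarrow> complex"
    where v: "\<And>x y. x \<in> I \<Longrightarrow> y \<in> I \<Longrightarrow> g' x y = (\<Sum>r\<in>I. cnj (v r x) * v r y)" by blast
  define w where "w r x = (if r = i then (if x = i then complex_of_real (sqrt p) else g i x / complex_of_real (sqrt p))
      else (if x = i then 0 else v r x))" for r x
  have sqrt_p: "complex_of_real (sqrt p) * complex_of_real (sqrt p) = complex_of_real p"
    using p0 by (simp flip: of_real_mult)
  have "g x y = (\<Sum>r\<in>insert i I. cnj (w r x) * w r y)" if x: "x \<in> insert i I" and y: "y \<in> insert i I" for x y
  proof -
    have sum_eq: "(\<Sum>r\<in>insert i I. cnj (w r x) * w r y)
        = cnj (w i x) * w i y + (\<Sum>r\<in>I. cnj (w r x) * w r y)" using insert.hyps by simp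
    have I_eq: "(\<Sum>r\<in>I. cnj (w r x) * w r y) = (if x = i \<or> y = i then 0 else g' x y)"
    proof (cases "x = i \<or> y = i")
      case True
      then show ?thesis using insert.hyps by (auto simp: w_def intro!: sum.neutral)
    next
      case False
      then have "g' x y = (\<Sum>r\<in>I. cnj (v r x) * v r y)" using v x y by blast
      also have "\<dots> = (\<Sum>r\<in>I. cnj (w r x) * w r y)"
        using False insert.hyps by (intro sum.cong) (auto simp: w_def)
      finally show ?thesis using False by simp
    qed
    have wi: "w i i = complex_of_real (sqrt p)"
        "\<And>u. u \<noteq> i \<Longrightarrow> w i u = g i u / complex_of_real (sqrt p)"
      by (simp_all add: w_def)
    have gx: "g x i = cnj (g i x)" using herm[of x i] x by simp
    show ?thesis
    proof (cases "x = i"; cases "y = i")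
      assume "x = i" "y = i"
      then show ?thesis unfolding sum_eq I_eq by (simp add: wi p sqrt_p)
    next
      assume "x = i" "y \<noteq> i"
      then show ?thesis unfolding sum_eq I_eq using zero_row[of y] y by (cases "p = 0") (auto simp: wi)
    next
      assume "x \<noteq> i" "y = i"
      then show ?thesis unfolding sum_eq I_eq using zero_row[of x] x gx by (cases "p = 0") (auto simp: wi)
    next
      assume xy: "x \<noteq> i" "y \<noteq> i"
      then have "cnj (w i x) * w i y = g x i * g i y / complex_of_real p"
        by (simp add: wi gx sqrt_p)
      then show ?thesis unfolding sum_eq I_eq using xy by (simp add: g'_def)
    qed
  qed
  then show ?case by blast
qed

context tracial_space
begin

lemma ti_pm_sum:
  "tensor_inner \<tau> u v = pm_sum (\<lambda>x c. pm_sum (\<lambda>y d. cnj c * d * (\<tau> (adj (fst x) o\<^sub>L fst y) * \<tau> (snd y o\<^sub>L adj (snd x)))) v) u"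
  by (simp add: tensor_inner_def pm_sum_def case_prod_unfold)

lemma ti_add_right: "tensor_inner \<tau> u (v + w) = tensor_inner \<tau> u v + tensor_inner \<tau> u w"
  unfolding ti_pm_sum
  by (subst pm_sum_add) (simp_all add: algebra_simps, simp add: pm_sum_def sum.distrib)

lemma ti_scale_right: "tensor_inner \<tau> u (pm_scale c v) = c * tensor_inner \<tau> u v"
proof -
  have "pm_sum (\<lambda>y d. cnj a * d * (\<tau> (adj (fst x) o\<^sub>L fst y) * \<tau> (snd y o\<^sub>L adj (snd x)))) (pm_scale c v)
      = c * pm_sum (\<lambda>y d. cnj a * d * (\<tau> (adj (fst x) o\<^sub>L fst y) * \<tau> (snd y o\<^sub>L adj (snd x)))) v" for a x
    by (rule pm_sum_scale) (simp_all add: algebra_simps)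
  then show ?thesis unfolding ti_pm_sum by (simp add: pm_sum_def sum_distrib_left)
qed

lemma ti_single: "tensor_inner \<tau> (Poly_Mapping.single (a, b) c) (Poly_Mapping.single (a', b') c')
    = cnj c * c' * (\<tau> (adj a o\<^sub>L a') * \<tau> (b' o\<^sub>L adj b))"
  by (cases "c = 0"; cases "c' = 0") (simp_all add: tensor_inner_def)

lemma T_single: "a \<in> M \<Longrightarrow> b \<in> M \<Longrightarrow> Poly_Mapping.single (a, b) c \<in> alg_tensor_op M"
  by (simp add: alg_tensor_op_def)

lemma T_add: "u \<in> alg_tensor_op M \<Longrightarrow> v \<in> alg_tensor_op M \<Longrightarrow> u + v \<in> alg_tensor_op M"
  using Poly_Mapping.keys_add[of u v] by (auto simp: alg_tensor_op_def)

lemma T_zero: "0 \<in> alg_tensor_op M"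
  by (simp add: alg_tensor_op_def)

lemma tensor_one_T: "tensor_one \<in> alg_tensor_op M"
  by (simp add: tensor_one_def T_single M_id)

text \<open>Positivity of \<open>\<tau> \<otimes> \<tau>\<^sup>o\<^sup>p\<close> is the Schur product theorem for the Gram matrices of the two legs:
  a factorization of the first matrix writes the product as a sum of values \<open>\<tau>(B\<^sub>r B\<^sub>r\<^sup>*)\<close>.\<close>

lemma ti_pos: assumes u: "u \<in> alg_tensor_op M" shows "0 \<le> Re (tensor_inner \<tau> u u)"
proof -
  define I where "I = Poly_Mapping.keys u"
  define c where "c = Poly_Mapping.lookup u"
  have fin: "finite I" by (simp add: I_def)
  have IM: "fst x \<in> M" "snd x \<in> M" if "x \<in> I" for x
    using u that by (auto simp: I_def alg_tensor_op_def)
  define g where "g x y = \<tau> (adj (fst x) o\<^sub>L fst y)" for x y :: "'h oper \<times> 'h oper"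
  have herm: "g x y = cnj (g y x)" if "x \<in> I" "y \<in> I" for x y
    using m.ip_herm[of "fst x" "fst y"] IM that by (simp add: g_def inner2_def)
  have lin: "inner2 \<tau> (\<Sum>x\<in>I. op_scaleC (z x) (f x)) (\<Sum>y\<in>I. op_scaleC (z y) (f y))
      = (\<Sum>x\<in>I. \<Sum>y\<in>I. cnj (z x) * z y * inner2 \<tau> (f x) (f y))"
    if f: "\<And>x. x \<in> I \<Longrightarrow> f x \<in> M" for z and f :: "'h oper \<times> 'h oper \<Rightarrow> 'h oper"
  proof -
    have "inner2 \<tau> (\<Sum>x\<in>I. op_scaleC (z x) (f x)) (\<Sum>y\<in>I. op_scaleC (z y) (f y))
        = (\<Sum>x\<in>I. inner2 \<tau> (op_scaleC (z x) (f x)) (\<Sum>y\<in>I. op_scaleC (z y) (f y)))"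
      by (intro m.ip_sum_left M_sum M_sc f)
    also have "\<dots> = (\<Sum>x\<in>I. \<Sum>y\<in>I. inner2 \<tau> (op_scaleC (z x) (f x)) (op_scaleC (z y) (f y)))"
      by (intro sum.cong refl m.ip_sum M_sc f)
    also have "\<dots> = (\<Sum>x\<in>I. \<Sum>y\<in>I. cnj (z x) * z y * inner2 \<tau> (f x) (f y))"
      by (intro sum.cong refl) (simp add: f m.ip_sc m.ip_sc_left M_sc)
    finally show ?thesis .
  qed
  have "0 \<le> Re (\<Sum>x\<in>I. \<Sum>y\<in>I. cnj (z x) * z y * g x y)" for z
  proof -
    have "0 \<le> Re (inner2 \<tau> (\<Sum>x\<in>I. op_scaleC (z x) (fst x)) (\<Sum>y\<in>I. op_scaleC (z y) (fst y)))"
      using IM by (intro m.ip_pos M_sum) (auto simp: M_closed)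
    then show ?thesis using lin[of fst z] IM by (simp add: g_def inner2_def)
  qed
  then obtain v :: "('h oper \<times> 'h oper) \<Rightarrow> ('h oper \<times> 'h oper) \<Rightarrow> complex"
    where v: "\<And>x y. x \<in> I \<Longrightarrow> y \<in> I \<Longrightarrow> g x y = (\<Sum>r\<in>I. cnj (v r x) * v r y)"
    using psd_factorization[of I g] fin herm by blast
  define B where "B r = (\<Sum>x\<in>I. op_scaleC (cnj (c x * v r x)) (adj (snd x)))" for r
  have snd_adj: "inner2 \<tau> (adj (snd y)) (adj (snd x)) = \<tau> (snd y o\<^sub>L adj (snd x))" if "y \<in> I" for x y
    using IM that by (simp add: inner2_def adj_adj M_bounded)
  have "tensor_inner \<tau> u u = (\<Sum>x\<in>I. \<Sum>y\<in>I. cnj (c x) * c y * (g x y * \<tau> (snd y o\<^sub>L adj (snd x))))"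
    by (simp add: tensor_inner_def I_def c_def g_def case_prod_unfold)
  also have "\<dots> = (\<Sum>x\<in>I. \<Sum>y\<in>I. \<Sum>r\<in>I. cnj (c x * v r x) * (c y * v r y) * \<tau> (snd y o\<^sub>L adj (snd x)))"
    by (intro sum.cong refl) (simp add: v sum_distrib_left sum_distrib_right mult_ac)
  also have "\<dots> = (\<Sum>r\<in>I. \<Sum>y\<in>I. \<Sum>x\<in>I. cnj (c x * v r x) * (c y * v r y) * \<tau> (snd y o\<^sub>L adj (snd x)))"
    by (subst sum.swap, subst (2) sum.swap, subst sum.swap) (rule refl)
  also have "\<dots> = (\<Sum>r\<in>I. inner2 \<tau> (B r) (B r))"
    unfolding B_def using IM
    by (intro sum.cong refl) (subst lin, simp_all add: M_closed snd_adj mult_ac)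
  finally have "tensor_inner \<tau> u u = (\<Sum>r\<in>I. inner2 \<tau> (B r) (B r))" .
  moreover have "B r \<in> M" for r unfolding B_def using IM by (intro M_sum) (auto simp: M_closed)
  ultimately show ?thesis by (simp add: sum_nonneg m.ip_pos)
qed

lemma tensor_semi_inner: "semi_inner (alg_tensor_op M) pm_scale (tensor_inner \<tau>)"
proof
  fix x y z :: "'h tensor" and c
  show "0 \<in> alg_tensor_op M" by (rule T_zero)
  show "pm_scale (-1) x = - x" by (rule pm_scale_minus_one)
  assume x: "x \<in> alg_tensor_op M"
  show "0 \<le> Re (tensor_inner \<tau> x x)" using x by (rule ti_pos)
  show "pm_scale c x \<in> alg_tensor_op M"
    using x unfolding alg_tensor_op_def by (auto simp: in_keys_iff)
  assume y: "y \<in> alg_tensor_op M"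
  show "x + y \<in> alg_tensor_op M" using x y by (rule T_add)
  show "tensor_inner \<tau> x (y + z) = tensor_inner \<tau> x y + tensor_inner \<tau> x z" by (rule ti_add_right)
  show "tensor_inner \<tau> x (pm_scale c y) = c * tensor_inner \<tau> x y" by (rule ti_scale_right)
  have "tensor_inner \<tau> y x = (\<Sum>j\<in>Poly_Mapping.keys y. \<Sum>i\<in>Poly_Mapping.keys x. cnj (Poly_Mapping.lookup y j)
      * Poly_Mapping.lookup x i * (\<tau> (adj (fst j) o\<^sub>L fst i) * \<tau> (snd i o\<^sub>L adj (snd j))))"
    by (simp add: tensor_inner_def case_prod_unfold)
  also have "cnj \<dots> = (\<Sum>j\<in>Poly_Mapping.keys y. \<Sum>i\<in>Poly_Mapping.keys x. cnj (Poly_Mapping.lookup x i)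
      * Poly_Mapping.lookup y j * (\<tau> (adj (fst i) o\<^sub>L fst j) * \<tau> (snd j o\<^sub>L adj (snd i))))"
  proof -
    have "cnj (\<tau> (adj (fst j) o\<^sub>L fst i)) = \<tau> (adj (fst i) o\<^sub>L fst j)"
         "cnj (\<tau> (snd i o\<^sub>L adj (snd j))) = \<tau> (snd j o\<^sub>L adj (snd i))"
      if "i \<in> Poly_Mapping.keys x" "j \<in> Poly_Mapping.keys y" for i j
    proof -
      have M: "fst i \<in> M" "fst j \<in> M" "snd i \<in> M" "snd j \<in> M"
        using x y that by (auto simp: alg_tensor_op_def)
      show "cnj (\<tau> (adj (fst j) o\<^sub>L fst i)) = \<tau> (adj (fst i) o\<^sub>L fst j)"
        using m.ip_herm[of "fst i" "fst j"] M by (simp add: inner2_def)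
      show "cnj (\<tau> (snd i o\<^sub>L adj (snd j))) = \<tau> (snd j o\<^sub>L adj (snd i))"
        using m.ip_herm[of "adj (snd j)" "adj (snd i)"] M by (simp add: inner2_def M_closed adj_adj M_bounded)
    qed
    then show ?thesis by (simp add: mult_ac)
  qed
  also have "\<dots> = tensor_inner \<tau> x y"
    by (subst sum.swap) (simp add: tensor_inner_def case_prod_unfold)
  finally show "tensor_inner \<tau> x y = cnj (tensor_inner \<tau> y x)" by simp
qed

sublocale t: semi_inner "alg_tensor_op M" pm_scale "tensor_inner \<tau>"
  by (rule tensor_semi_inner)

lemma L2_tensor_Comp: "L2_tensor \<tau> M = t.Comp"
  by (simp add: L2_tensor_def)

lemma word_eval_M: "(\<And>i. X i \<in> M) \<Longrightarrow> word_eval X w \<in> M"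
  by (induction w) (auto simp: M_closed)

lemma poly_eval_M: "(\<And>i. X i \<in> M) \<Longrightarrow> poly_eval X p \<in> M"
  unfolding poly_eval_def by (intro M_sum M_sc word_eval_M)

lemma bipoly_eval_T: "(\<And>i. X i \<in> M) \<Longrightarrow> bipoly_eval X q \<in> alg_tensor_op M"
proof (induction q rule: pm_induct)
  case (single k c)
  then show ?case by (cases k) (simp add: bipoly_eval_single T_single word_eval_M)
qed (simp_all add: T_zero T_add bipoly_eval_add)

end

lemma (in semi_inner) pullback:
  fixes e :: "'w::ab_group_add \<Rightarrow> 'v"
  assumes "\<And>x. e x \<in> K" "\<And>x y. e (x + y) = e x + e y" "\<And>c x. e (sc' c x) = sc c (e x)"
    and "\<And>x. sc' (-1) x = - x"
  shows "semi_inner UNIV sc' (\<lambda>x y. ip (e x) (e y))"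
proof
  show "ip (e x) (e y) = cnj (ip (e y) (e x))" for x y by (rule ip_herm) (rule assms)+
qed (simp_all add: assms ip_add ip_sc ip_pos)

section \<open>Density of polynomials in a generated von Neumann algebra\<close>

context semi_inner
begin

lemma Comp_sc: assumes f: "f \<in> Comp" shows "(\<lambda>k. sc c (f k)) \<in> Comp"
proof -
  have K: "f k \<in> K" for k using f by (rule Comp_in)
  have "sc c (f m) - sc c (f n) \<in> K" for m n by (intro K_diff K_sc K)
  have nd: "nrm (sc c (f m) - sc c (f n)) = cmod c * nrm (f m - f n)" for m n
  proof -
    have "ip (sc c (f m) - sc c (f n)) (sc c (f m) - sc c (f n)) = c * cnj c * ip (f m - f n) (f m - f n)"
      by (simp add: ip_diff ip_diff_left ip_sc ip_sc_left K K_sc K_diff algebra_simps)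
    also have "\<dots> = complex_of_real ((cmod c * nrm (f m - f n))\<^sup>2)"
      using complex_norm_square[of c] ip_self_real[OF K_diff[OF K K], of m n]
      by (simp add: power_mult_distrib)
    finally have "(nrm (sc c (f m) - sc c (f n)))\<^sup>2 = (cmod c * nrm (f m - f n))\<^sup>2"
      by (simp add: nrm_sq K K_sc K_diff del: of_real_power)
    then show ?thesis using nrm_nonneg K K_sc K_diff by (simp add: power2_eq_iff_nonneg)
  qed
  have "\<exists>N. \<forall>m\<ge>N. \<forall>n\<ge>N. nrm (sc c (f m) - sc c (f n)) < e" if "e > 0" for e
  proof -
    have p: "e / (cmod c + 1) > 0" using \<open>e > 0\<close> by (simp add: add_nonneg_pos)
    obtain N where N: "\<forall>m\<ge>N. \<forall>n\<ge>N. nrm (f m - f n) < e / (cmod c + 1)"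
      using Comp_cauchy[OF f p] by blast
    have "cmod c * nrm (f m - f n) < e" if "m \<ge> N" "n \<ge> N" for m n
    proof -
      have "cmod c * nrm (f m - f n) \<le> (cmod c + 1) * nrm (f m - f n)"
        using nrm_nonneg[OF K_diff[OF K K], of m n] by (simp add: distrib_right)
      also have "\<dots> < (cmod c + 1) * (e / (cmod c + 1))"
        using N that by (intro mult_strict_left_mono) (auto simp: add_nonneg_pos)
      also have "\<dots> = e" using norm_ge_zero[of c] by (simp add: field_simps add_nonneg_eq_0_iff)
      finally show ?thesis .
    qed
    then show ?thesis unfolding nd by blast
  qed
  then show ?thesis unfolding hcompletion_def using K K_sc by simp
qed

lemma hinner_herm: "f \<in> Comp \<Longrightarrow> g \<in> Comp \<Longrightarrow> hinner ip f g = cnj (hinner ip g f)"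
proof -
  assume f: "f \<in> Comp" and g: "g \<in> Comp"
  have "(\<lambda>k. cnj (ip (g k) (f k))) \<longlonglongrightarrow> cnj (hinner ip g f)"
    by (intro tendsto_cnj ip_Comp_LIMSEQ f g)
  moreover have "cnj (ip (g k) (f k)) = ip (f k) (g k)" for k
    using ip_herm[OF Comp_in[OF f] Comp_in[OF g], of k k] by simp
  ultimately show ?thesis using LIMSEQ_unique[OF ip_Comp_LIMSEQ[OF f g]] by simp
qed

lemma hinner_iterated:
  assumes f: "f \<in> Comp" and g: "g \<in> Comp"
  shows "(\<lambda>m. hinner ip f (\<lambda>_. g m)) \<longlonglongrightarrow> hinner ip f g"
proof (rule LIMSEQ_I)
  fix e :: real assume e: "e > 0"
  have K: "f k \<in> K" "g k \<in> K" for k using Comp_in f g by blast+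
  obtain B where B: "B > 0" "\<And>k. nrm (f k) \<le> B" using nrm_Comp_bounded[OF f] by blast
  have "e / (2 * B) > 0" using e B by simp
  then obtain N where N: "\<forall>m\<ge>N. \<forall>n\<ge>N. nrm (g m - g n) < e / (2 * B)"
    using Comp_cauchy[OF g] by blast
  have "norm (hinner ip f (\<lambda>_. g m) - hinner ip f g) < e" if m: "m \<ge> N" for m
  proof -
    have "cmod (ip (f k) (g m) - ip (f k) (g k)) \<le> e / 2" if "k \<ge> N" for k
    proof -
      have "cmod (ip (f k) (g m) - ip (f k) (g k)) = cmod (ip (f k) (g m - g k))"
        by (simp add: ip_diff K)
      also have "\<dots> \<le> nrm (f k) * nrm (g m - g k)" by (intro Cauchy_Schwarz K_diff K)
      also have "\<dots> \<le> B * (e / (2 * B))"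
        using B N m that nrm_nonneg[OF K_diff[OF K(2) K(2)], of m k]
        by (intro mult_mono) (auto intro: less_imp_le)
      finally show ?thesis using B by simp
    qed
    then have "norm (hinner ip f (\<lambda>_. g m) - hinner ip f g) \<le> e / 2"
      using tendsto_norm[OF tendsto_diff[OF hinner_const_right[OF f K(2)[of m]] ip_Comp_LIMSEQ[OF f g]]]
      by (intro LIMSEQ_le_const2) auto
    then show ?thesis using e by simp
  qed
  then show "\<exists>no. \<forall>m\<ge>no. norm (hinner ip f (\<lambda>_. g m) - hinner ip f g) < e" by blast
qed

text \<open>The norm of a vector is recovered by testing it against itself, hence against nearby elements of
  \<open>W\<close>. Below, \<open>W\<close> consists of polynomials, the only vectors on which conjugate variables are known.\<close>

lemma hnorm_le_of_dense:
  assumes f: "f \<in> Comp" and W: "W \<subseteq> K" and c: "0 \<le> c"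
    and dense: "\<And>l e. e > 0 \<Longrightarrow> \<exists>w\<in>W. nrm (f l - w) < e"
    and bound: "\<And>w. w \<in> W \<Longrightarrow> cmod (hinner ip f (\<lambda>_. w)) \<le> c * nrm w"
  shows "hnorm ip f \<le> c"
proof -
  define H where "H = hnorm ip f"
  have H0: "0 \<le> H" unfolding H_def by (rule hnorm_nonneg[OF f])
  have K: "f k \<in> K" for k using f by (rule Comp_in)
  have *: "H\<^sup>2 \<le> c * H + e * (2 * c + 2 * H)" if e: "e > 0" for e
  proof -
    obtain N where N: "\<forall>m\<ge>N. \<forall>n\<ge>N. nrm (f m - f n) < e" using Comp_cauchy[OF f e] by blast
    obtain w where w: "w \<in> W" "nrm (f N - w) < e" using dense[OF e] by blast
    have wK: "w \<in> K" using w W by blast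
    have near: "nrm (f m - w) \<le> 2 * e" if "m \<ge> N" for m
    proof -
      have "nrm ((f m - f N) + (f N - w)) \<le> nrm (f m - f N) + nrm (f N - w)"
        by (intro nrm_triangle K_diff K wK)
      then show ?thesis using N that w(2) by (force intro: less_imp_le)
    qed
    have "(nrm (f m))\<^sup>2 \<le> cmod (ip (f m) w) + nrm (f m) * (2 * e)" if m: "m \<ge> N" for m
    proof -
      have "(nrm (f m))\<^sup>2 = cmod (ip (f m) (f m))" by (simp add: ip_self_real[OF K] norm_power)
      also have "ip (f m) (f m) = ip (f m) w + ip (f m) (f m - w)" by (simp add: ip_diff K wK)
      also have "cmod \<dots> \<le> cmod (ip (f m) w) + cmod (ip (f m) (f m - w))" by (rule norm_triangle_ineq)
      also have "cmod (ip (f m) (f m - w)) \<le> nrm (f m) * nrm (f m - w)"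
        by (intro Cauchy_Schwarz K_diff K wK)
      also have "\<dots> \<le> nrm (f m) * (2 * e)" by (intro mult_left_mono near m nrm_nonneg K)
      finally show ?thesis by simp
    qed
    then have "H\<^sup>2 \<le> cmod (hinner ip f (\<lambda>_. w)) + H * (2 * e)"
      unfolding H_def
      by (intro LIMSEQ_le[OF hnorm_sq[OF f] tendsto_add[OF tendsto_norm[OF hinner_const_right[OF f wK]]
              tendsto_mult[OF nrm_Comp_LIMSEQ[OF f] tendsto_const]]]) blast
    also have "cmod (hinner ip f (\<lambda>_. w)) \<le> c * nrm w" by (rule bound[OF w(1)])
    finally have 1: "H\<^sup>2 \<le> c * nrm w + H * (2 * e)" by simp
    have "nrm w \<le> H + 2 * e"
    proof -
      have "nrm w \<le> nrm (f m) + 2 * e" if "m \<ge> N" for m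
        using nrm_triangle_diff[OF K wK, of m] near[OF that] by linarith
      then show ?thesis unfolding H_def
        by (intro LIMSEQ_le_const[OF tendsto_add[OF nrm_Comp_LIMSEQ[OF f] tendsto_const]]) blast
    qed
    then have "c * nrm w \<le> c * (H + 2 * e)" using c by (rule mult_left_mono)
    then show ?thesis using 1 by (simp add: algebra_simps)
  qed
  have "H\<^sup>2 \<le> c * H"
  proof (rule field_le_epsilon)
    fix e' :: real assume e': "e' > 0"
    have p: "2 * c + 2 * H + 1 > 0" using c H0 by linarith
    have "e' / (2 * c + 2 * H + 1) * (2 * c + 2 * H) \<le> e'"
      using p e' c H0 by (simp add: pos_divide_le_eq algebra_simps)
    then show "H\<^sup>2 \<le> c * H + e'" using *[of "e' / (2 * c + 2 * H + 1)"] p e' by simp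
  qed
  then show ?thesis
    using H0 c unfolding H_def by (cases "hnorm ip f = 0") (auto simp: power2_eq_square)
qed

lemma Comp_null:
  assumes f: "f \<in> Comp" and null: "\<And>x. x \<in> K \<Longrightarrow> (\<lambda>k. ip (f k) x) \<longlonglongrightarrow> 0"
  shows "(\<lambda>k. nrm (f k)) \<longlonglongrightarrow> 0"
proof -
  have "hnorm ip f \<le> 0"
  proof (rule hnorm_le_of_dense[OF f, of K])
    fix l :: nat and e :: real assume "e > 0"
    then have "nrm (f l - f l) < e" by (simp add: nrm_zero)
    then show "\<exists>w\<in>K. nrm (f l - w) < e" using Comp_in[OF f] by blast
  next
    fix w assume w: "w \<in> K"
    have "hinner ip f (\<lambda>_. w) = 0" using LIMSEQ_unique[OF hinner_const_right[OF f w] null[OF w]] .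
    then show "cmod (hinner ip f (\<lambda>_. w)) \<le> 0 * nrm w" by simp
  qed simp_all
  then show ?thesis using nrm_Comp_LIMSEQ[OF f] hnorm_nonneg[OF f] by simp
qed

end

text \<open>The space \<open>\<ell>\<^sup>2(H)\<close>, on which normal functionals become vector functionals.\<close>

definition ell2 :: "(nat \<Rightarrow> 'h::complex_hilbert) set" where
  "ell2 = {f. summable (\<lambda>k. (norm (f k))\<^sup>2)}"

definition ell2_sc :: "complex \<Rightarrow> (nat \<Rightarrow> 'h::complex_hilbert) \<Rightarrow> nat \<Rightarrow> 'h" where
  "ell2_sc c f = (\<lambda>k. c *\<^sub>C f k)"

definition ell2_ip :: "(nat \<Rightarrow> 'h::complex_hilbert) \<Rightarrow> (nat \<Rightarrow> 'h) \<Rightarrow> complex" where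
  "ell2_ip f g = suminf (\<lambda>k. cinner (f k) (g k))"

lemma ell2_ip_summable:
  assumes "f \<in> ell2" "g \<in> ell2" shows "summable (\<lambda>k. cinner (f k) (g k))"
proof (rule summable_comparison_test)
  show "summable (\<lambda>k. (norm (f k))\<^sup>2 + (norm (g k))\<^sup>2)"
    using assms by (intro summable_add) (auto simp: ell2_def)
  have "norm (cinner (f k) (g k)) \<le> (norm (f k))\<^sup>2 + (norm (g k))\<^sup>2" for k
  proof -
    have "cmod (cinner (f k) (g k)) \<le> norm (f k) * norm (g k)" by (rule cinner_Cauchy_Schwarz)
    also have "\<dots> \<le> (norm (f k))\<^sup>2 + (norm (g k))\<^sup>2"
    proof -
      have "2 * (norm (f k) * norm (g k)) \<le> (norm (f k))\<^sup>2 + (norm (g k))\<^sup>2"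
        using sum_squares_bound[of "norm (f k)" "norm (g k)"] by (simp add: mult.assoc)
      moreover have "0 \<le> norm (f k) * norm (g k)" by simp
      ultimately show ?thesis by linarith
    qed
    finally show ?thesis .
  qed
  then show "\<exists>N. \<forall>n\<ge>N. norm (cinner (f n) (g n)) \<le> (norm (f n))\<^sup>2 + (norm (g n))\<^sup>2" by blast
qed

lemma ell2_add: assumes "f \<in> ell2" "g \<in> ell2" shows "f + g \<in> ell2"
  unfolding ell2_def
proof (rule CollectI, rule summable_comparison_test)
  show "summable (\<lambda>k. 2 * (norm (f k))\<^sup>2 + 2 * (norm (g k))\<^sup>2)"
    using assms by (intro summable_add summable_mult) (auto simp: ell2_def)
  have "(norm (f k + g k))\<^sup>2 \<le> 2 * (norm (f k))\<^sup>2 + 2 * (norm (g k))\<^sup>2" for k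
    using hilb.parallelogram[of "f k" "g k"] by simp (smt (verit) zero_le_power2)
  then show "\<exists>N. \<forall>n\<ge>N. norm ((norm ((f + g) n))\<^sup>2) \<le> 2 * (norm (f n))\<^sup>2 + 2 * (norm (g n))\<^sup>2"
    by (simp add: plus_fun_def)
qed

lemma ell2_image:
  fixes T :: "'h::complex_hilbert oper"
  assumes "f \<in> ell2" shows "(\<lambda>k. blinfun_apply T (f k)) \<in> ell2"
  unfolding ell2_def
proof (rule CollectI, rule summable_comparison_test)
  show "summable (\<lambda>k. (norm T)\<^sup>2 * (norm (f k))\<^sup>2)"
    using assms by (intro summable_mult) (auto simp: ell2_def)
  have "(norm (blinfun_apply T (f k)))\<^sup>2 \<le> (norm T)\<^sup>2 * (norm (f k))\<^sup>2" for k
    using power_mono[OF norm_blinfun[of T "f k"] norm_ge_zero, of 2] by (simp add: power_mult_distrib)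
  then show "\<exists>N. \<forall>n\<ge>N. norm ((norm (blinfun_apply T (f n)))\<^sup>2) \<le> (norm T)\<^sup>2 * (norm (f n))\<^sup>2" by simp
qed

interpretation l2: semi_inner "ell2 :: (nat \<Rightarrow> 'h::complex_hilbert) set" ell2_sc ell2_ip
proof
  fix f g h :: "nat \<Rightarrow> 'h" and c
  show "0 \<in> (ell2 :: (nat \<Rightarrow> 'h) set)" by (simp add: ell2_def)
  show "ell2_sc (-1) f = - f" by (rule ext) (simp add: ell2_sc_def hilb.sc_minus_one)
  assume f: "f \<in> ell2"
  show "ell2_sc c f \<in> ell2"
    using f unfolding ell2_def ell2_sc_def by (simp add: norm_scaleC power_mult_distrib summable_mult)
  have "ell2_ip f f = suminf (\<lambda>k. complex_of_real ((norm (f k))\<^sup>2))"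
    by (simp add: ell2_ip_def cinner_self)
  also have "\<dots> = complex_of_real (suminf (\<lambda>k. (norm (f k))\<^sup>2))"
    using f by (intro suminf_of_real[symmetric]) (simp add: ell2_def)
  finally show "0 \<le> Re (ell2_ip f f)"
    using f by (simp add: suminf_nonneg ell2_def)
  assume g: "g \<in> ell2"
  show "f + g \<in> ell2" using f g by (rule ell2_add)
  show "ell2_ip f (ell2_sc c g) = c * ell2_ip f g"
    using ell2_ip_summable[OF f g] by (simp add: ell2_ip_def ell2_sc_def cinner_simps suminf_mult)
  have "(\<lambda>k. cinner (g k) (f k)) sums ell2_ip g f"
    unfolding ell2_ip_def by (intro summable_sums ell2_ip_summable g f)
  then have "(\<lambda>k. cnj (cinner (g k) (f k))) sums cnj (ell2_ip g f)"
    by (rule sums_cnj[THEN iffD2])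
  then have "(\<lambda>k. cinner (f k) (g k)) sums cnj (ell2_ip g f)"
    using cinner_commute by (metis (no_types, lifting) sums_cong)
  then show "ell2_ip f g = cnj (ell2_ip g f)" by (simp add: ell2_ip_def sums_iff)
  assume h: "h \<in> ell2"
  show "ell2_ip f (g + h) = ell2_ip f g + ell2_ip f h"
    using ell2_ip_summable[OF f g] ell2_ip_summable[OF f h]
    by (simp add: ell2_ip_def cinner_simps suminf_add)
qed

lemma ell2_nrm_sq: assumes "f \<in> ell2" shows "(l2.nrm f)\<^sup>2 = suminf (\<lambda>k. (norm (f k))\<^sup>2)"
proof -
  have "ell2_ip f f = complex_of_real (suminf (\<lambda>k. (norm (f k))\<^sup>2))"
    using assms by (simp add: ell2_ip_def cinner_self suminf_of_real ell2_def del: of_real_power)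
  then show ?thesis by (simp add: l2.nrm_sq[OF assms])
qed

lemma ell2_norm_coord: assumes "f \<in> ell2" shows "norm (f k) \<le> l2.nrm f"
proof -
  have "(norm (f k))\<^sup>2 \<le> suminf (\<lambda>k. (norm (f k))\<^sup>2)"
    using assms sum_le_suminf[of "\<lambda>k. (norm (f k))\<^sup>2" "{k}"] by (simp add: ell2_def)
  then have "(norm (f k))\<^sup>2 \<le> (l2.nrm f)\<^sup>2" unfolding ell2_nrm_sq[OF assms] .
  then show ?thesis by (rule power2_le_imp_le[OF _ l2.nrm_nonneg[OF assms]])
qed

text \<open>Fatou's argument: the Cauchy estimate passes to the limit in every finite partial sum.\<close>

lemma ell2_coordwise_limit:
  assumes F: "F \<in> l2.Comp" and f: "f \<in> ell2" and lim: "\<And>k. (\<lambda>n. F n k) \<longlonglongrightarrow> f k"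
  shows "(\<lambda>n. l2.nrm (F n - f)) \<longlonglongrightarrow> 0"
proof (rule LIMSEQ_I)
  fix e :: real assume e: "e > 0"
  have FK: "F n \<in> ell2" for n using l2.Comp_in[OF F] .
  have "e / 2 > 0" using e by simp
  then obtain N where N: "\<forall>m\<ge>N. \<forall>n\<ge>N. l2.nrm (F m - F n) < e / 2"
    using l2.Comp_cauchy[OF F] by blast
  have "norm (l2.nrm (F n - f) - 0) < e" if n: "n \<ge> N" for n
  proof -
    have dK: "F n - f \<in> ell2" by (intro l2.K_diff FK f)
    have "(\<Sum>k<J. (norm (F n k - f k))\<^sup>2) \<le> (e / 2)\<^sup>2" for J
    proof (rule LIMSEQ_le_const2)
      show "(\<lambda>m. \<Sum>k<J. (norm (F n k - F m k))\<^sup>2) \<longlonglongrightarrow> (\<Sum>k<J. (norm (F n k - f k))\<^sup>2)"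
        by (intro tendsto_intros lim)
      have "(\<Sum>k<J. (norm (F n k - F m k))\<^sup>2) \<le> (e / 2)\<^sup>2" if m: "m \<ge> N" for m
      proof -
        have K: "F n - F m \<in> ell2" by (intro l2.K_diff FK)
        have "(\<Sum>k<J. (norm ((F n - F m) k))\<^sup>2) \<le> suminf (\<lambda>k. (norm ((F n - F m) k))\<^sup>2)"
          using K by (intro sum_le_suminf) (auto simp: ell2_def)
        also have "\<dots> = (l2.nrm (F n - F m))\<^sup>2" using ell2_nrm_sq[OF K] by simp
        also have "\<dots> \<le> (e / 2)\<^sup>2"
          using N n m l2.nrm_nonneg[OF K] by (intro power_mono) (auto intro: less_imp_le)
        finally show ?thesis by simp
      qed
      then show "\<exists>N. \<forall>m\<ge>N. (\<Sum>k<J. (norm (F n k - F m k))\<^sup>2) \<le> (e / 2)\<^sup>2" by blast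
    qed
    then have "suminf (\<lambda>k. (norm ((F n - f) k))\<^sup>2) \<le> (e / 2)\<^sup>2"
      using dK by (intro suminf_le_const) (auto simp: ell2_def)
    then have "(l2.nrm (F n - f))\<^sup>2 \<le> (e / 2)\<^sup>2" by (simp only: ell2_nrm_sq[OF dK])
    then have "l2.nrm (F n - f) \<le> e / 2" by (rule power2_le_imp_le) (use e in simp)
    then show ?thesis unfolding real_norm_def using e l2.nrm_nonneg[OF dK] by linarith
  qed
  then show "\<exists>no. \<forall>n\<ge>no. norm (l2.nrm (F n - f) - 0) < e" by blast
qed

lemma ell2_operator_bound:
  fixes T :: "'h::complex_hilbert oper"
  assumes f: "f \<in> ell2" shows "l2.nrm (\<lambda>k. blinfun_apply T (f k)) \<le> norm T * l2.nrm f"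
proof (rule power2_le_imp_le)
  have "(l2.nrm (\<lambda>k. blinfun_apply T (f k)))\<^sup>2 = suminf (\<lambda>k. (norm (blinfun_apply T (f k)))\<^sup>2)"
    by (rule ell2_nrm_sq[OF ell2_image[OF f]])
  also have "\<dots> \<le> suminf (\<lambda>k. (norm T)\<^sup>2 * (norm (f k))\<^sup>2)"
  proof (rule suminf_le)
    show "(norm (blinfun_apply T (f k)))\<^sup>2 \<le> (norm T)\<^sup>2 * (norm (f k))\<^sup>2" for k
      using power_mono[OF norm_blinfun[of T "f k"] norm_ge_zero, of 2]
      by (simp add: power_mult_distrib)
    show "summable (\<lambda>k. (norm (blinfun_apply T (f k)))\<^sup>2)"
      using ell2_image[OF f] by (simp add: ell2_def)
    show "summable (\<lambda>k. (norm T)\<^sup>2 * (norm (f k))\<^sup>2)"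
      using f by (intro summable_mult) (simp add: ell2_def)
  qed
  also have "\<dots> = (norm T)\<^sup>2 * suminf (\<lambda>k. (norm (f k))\<^sup>2)"
    using f by (intro suminf_mult) (simp add: ell2_def)
  finally show "(l2.nrm (\<lambda>k. blinfun_apply T (f k)))\<^sup>2 \<le> (norm T * l2.nrm f)\<^sup>2"
    by (simp only: power_mult_distrib ell2_nrm_sq[OF f])
  show "0 \<le> norm T * l2.nrm f" by (intro mult_nonneg_nonneg norm_ge_zero l2.nrm_nonneg f)
qed

lemma ell2_operator_Comp:
  fixes T :: "'h::complex_hilbert oper"
  assumes F: "F \<in> l2.Comp" shows "(\<lambda>m k. blinfun_apply T (F m k)) \<in> l2.Comp"
proof -
  have FK: "F m \<in> ell2" for m by (rule l2.Comp_in[OF F])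
  have p: "norm T + 1 > 0" by (rule add_nonneg_pos) simp_all
  have "\<exists>N. \<forall>m\<ge>N. \<forall>n\<ge>N. l2.nrm ((\<lambda>k. blinfun_apply T (F m k)) - (\<lambda>k. blinfun_apply T (F n k))) < e"
    if "e > 0" for e
  proof -
    have "e / (norm T + 1) > 0" using \<open>e > 0\<close> p by simp
    then obtain N where N: "\<forall>m\<ge>N. \<forall>n\<ge>N. l2.nrm (F m - F n) < e / (norm T + 1)"
      using l2.Comp_cauchy[OF F] by blast
    have "l2.nrm ((\<lambda>k. blinfun_apply T (F m k)) - (\<lambda>k. blinfun_apply T (F n k))) < e"
      if "m \<ge> N" "n \<ge> N" for m n
    proof -
      have d: "F m - F n \<in> ell2" by (intro l2.K_diff FK)
      have "(\<lambda>k. blinfun_apply T (F m k)) - (\<lambda>k. blinfun_apply T (F n k)) = (\<lambda>k. blinfun_apply T ((F m - F n) k))"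
        by (rule ext) (simp add: blinfun.diff_right)
      then have "l2.nrm ((\<lambda>k. blinfun_apply T (F m k)) - (\<lambda>k. blinfun_apply T (F n k)))
          \<le> norm T * l2.nrm (F m - F n)" using ell2_operator_bound[OF d, of T] by simp
      also have "\<dots> \<le> (norm T + 1) * l2.nrm (F m - F n)"
        using l2.nrm_nonneg[OF d] by (intro mult_right_mono) simp_all
      also have "\<dots> < (norm T + 1) * (e / (norm T + 1))"
        using N that by (intro mult_strict_left_mono p) simp
      also have "\<dots> = e" using p by simp
      finally show ?thesis .
    qed
    then show ?thesis by blast
  qed
  then show ?thesis unfolding hcompletion_def using ell2_image[OF FK] by simp
qed

definition left_mult :: "'n \<Rightarrow> 'n ncpoly \<Rightarrow> 'n ncpoly" where
  "left_mult i p = pm_sum (\<lambda>w c. Poly_Mapping.single (i # w) c) p"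

lemma poly_eval_left_mult:
  assumes "Y i \<in> bounded_ops" shows "poly_eval Y (left_mult i p) = Y i o\<^sub>L poly_eval Y p"
proof (induction p rule: pm_induct)
  case zero
  then show ?case by (simp add: left_mult_def)
next
  case (single w c)
  then show ?case
    using assms by (simp add: left_mult_def pm_sum_single poly_eval_single op_scaleC_comp_right)
next
  case (add p q)
  have "left_mult i (p + q) = left_mult i p + left_mult i q"
    unfolding left_mult_def by (rule pm_sum_add) (simp_all add: single_add)
  then show ?case using add by (simp add: poly_eval_add comp_add_right)
qed

text \<open>The double commutant theorem in the ultrastrong topology, for one square-summable family \<open>\<zeta>\<close>.
  The projection onto the closure of \<open>{p(Y) \<zeta>}\<close> in \<open>\<ell>\<^sup>2\<close> is replaced by its reproducing kernel: for
  \<open>x \<in> H\<close> and an index \<open>j\<close> the Riesz lemma gives the vector of the closure that represents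
  \<open>p \<mapsto> \<langle>x, p(Y) \<zeta>\<^sub>j\<rangle>\<close>, and its coordinates, as functions of \<open>x\<close>, are operators in the commutant
  of \<open>Y\<close>. Moving \<open>a\<close> past these operators shows that the projection of \<open>a \<zeta>\<close> is \<open>a \<zeta>\<close>.\<close>

theorem ultrastrong_density:
  fixes Y :: "'n \<Rightarrow> 'h::complex_hilbert oper"
  assumes Yb: "\<And>i. Y i \<in> bounded_ops" and Ya: "\<And>i. adj (Y i) = Y i"
    and a: "a \<in> commutant (commutant (range Y))" and z: "\<zeta> \<in> ell2" and eps: "0 < e"
  shows "\<exists>p. suminf (\<lambda>k. (norm (blinfun_apply (a - poly_eval Y p) (\<zeta> k)))\<^sup>2) < e"
proof -
  define emb where "emb p = (\<lambda>k. blinfun_apply (poly_eval Y p) (\<zeta> k))" for p :: "'n ncpoly"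
  have embK: "emb p \<in> ell2" for p unfolding emb_def by (rule ell2_image[OF z])
  have emb_add: "emb (p + q) = emb p + emb q" for p q
    by (rule ext) (simp add: emb_def poly_eval_add blinfun.add_left)
  have emb_sc: "emb (pm_scale c p) = ell2_sc c (emb p)" for c p
    by (rule ext) (simp add: emb_def poly_eval_scale ell2_sc_def)
  have emb_diff: "emb (p - q) = emb p - emb q" for p q
    by (rule ext) (simp add: emb_def poly_eval_diff blinfun.diff_left)
  have emb_left: "emb (left_mult i p) = (\<lambda>k. blinfun_apply (Y i) (emb p k))" for i p
    by (rule ext) (simp add: emb_def poly_eval_left_mult Yb)
  define ipV where "ipV = (\<lambda>p q. ell2_ip (emb p) (emb q))"
  have "semi_inner UNIV pm_scale ipV"
    unfolding ipV_def
    by (rule l2.pullback[of emb]) (simp_all add: embK emb_add emb_sc pm_scale_minus_one)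
  then interpret V: semi_inner UNIV pm_scale ipV .
  have nrmV: "V.nrm p = l2.nrm (emb p)" for p by (simp add: semi_norm_def ipV_def)
  have CompV: "g \<in> V.Comp \<longleftrightarrow> (\<lambda>m. emb (g m)) \<in> l2.Comp" for g
    using embK by (simp add: hcompletion_def nrmV emb_diff)
  have V_coord_cauchy: "convergent (\<lambda>m. emb (g m) k)" if g: "g \<in> V.Comp" for g k
  proof -
    have "Cauchy (\<lambda>m. emb (g m) k)"
      unfolding Cauchy_def
    proof (intro allI impI)
      fix e :: real assume "e > 0"
      then obtain N where N: "\<forall>m\<ge>N. \<forall>n\<ge>N. V.nrm (g m - g n) < e" using V.Comp_cauchy[OF g] by blast
      have "dist (emb (g m) k) (emb (g n) k) \<le> V.nrm (g m - g n)" for m n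
        using ell2_norm_coord[OF embK, of "g m - g n" k] by (simp add: nrmV emb_diff dist_norm)
      then show "\<exists>N. \<forall>m\<ge>N. \<forall>n\<ge>N. dist (emb (g m) k) (emb (g n) k) < e"
        using N le_less_trans by blast
    qed
    then show ?thesis by (simp add: Cauchy_convergent_iff)
  qed
  have "\<exists>g. g \<in> V.Comp \<and> (\<forall>p. (\<lambda>m. ipV (g m) p) \<longlonglongrightarrow> cinner x (emb p j)) \<and> hnorm ipV g \<le> norm x"
    for x :: 'h and j
  proof -
    have "cmod (cinner x (emb p j)) \<le> norm x * V.nrm p" for p
      using cinner_Cauchy_Schwarz[of x "emb p j"] ell2_norm_coord[OF embK, of p j]
        mult_left_mono[OF _ norm_ge_zero[of x]] order_trans unfolding nrmV by blast
    then obtain g where "g \<in> V.Comp" "\<And>p. (\<lambda>m. ipV (g m) p) \<longlonglongrightarrow> cinner x (emb p j)"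
      "hnorm ipV g \<le> norm x"
      using V.Riesz[of "\<lambda>p. cinner x (emb p j)" "norm x" thesis]
      by (simp add: emb_add emb_sc ell2_sc_def cinner_simps)
    then show ?thesis by blast
  qed
  then obtain g where gC: "\<And>x j. g x j \<in> V.Comp"
    and gL: "\<And>x j p. (\<lambda>m. ipV (g x j m) p) \<longlonglongrightarrow> cinner x (emb p j)"
    and gN: "\<And>x j. hnorm ipV (g x j) \<le> norm x" by metis
  define q where "q j k x = lim (\<lambda>m. emb (g x j m) k)" for j k x
  have qL: "(\<lambda>m. emb (g x j m) k) \<longlonglongrightarrow> q j k x" for j k x
    using V_coord_cauchy[OF gC, of x j k] unfolding q_def by (simp only: convergent_LIMSEQ_iff)
  have unique: "(\<lambda>m. emb (h m) k) \<longlonglongrightarrow> 0"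
    if h: "h \<in> V.Comp" and n: "\<And>p. (\<lambda>m. ipV (h m) p) \<longlonglongrightarrow> 0" for h k
  proof (rule Lim_null_comparison)
    show "(\<lambda>m. V.nrm (h m)) \<longlonglongrightarrow> 0" using V.Comp_null[OF h n] .
    show "\<forall>\<^sub>F m in sequentially. norm (emb (h m) k) \<le> V.nrm (h m)"
      using ell2_norm_coord[OF embK] by (simp add: nrmV)
  qed
  have q_add: "q j k (x + y) = q j k x + q j k y" for j k x y
  proof -
    have "(\<lambda>m. emb (g (x + y) j m - (g x j m + g y j m)) k) \<longlonglongrightarrow> 0"
    proof (rule unique)
      show "(\<lambda>m. g (x + y) j m - (g x j m + g y j m)) \<in> V.Comp" by (intro V.Comp_diff V.Comp_add gC)
      show "(\<lambda>m. ipV (g (x + y) j m - (g x j m + g y j m)) p) \<longlonglongrightarrow> 0" for p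
        using tendsto_diff[OF gL tendsto_add[OF gL gL], of "x + y" j p x j p y j p]
        by (simp add: V.ip_diff_left V.ip_add_left cinner_simps)
    qed
    moreover have "(\<lambda>m. emb (g (x + y) j m - (g x j m + g y j m)) k) \<longlonglongrightarrow> q j k (x + y) - (q j k x + q j k y)"
      using tendsto_diff[OF qL tendsto_add[OF qL qL]] by (simp add: emb_diff emb_add)
    ultimately have "q j k (x + y) - (q j k x + q j k y) = 0" by (rule LIMSEQ_unique[rotated])
    then show ?thesis by simp
  qed
  have q_sc: "q j k (c *\<^sub>C x) = c *\<^sub>C q j k x" for j k x c
  proof -
    have "(\<lambda>m. emb (g (c *\<^sub>C x) j m - pm_scale c (g x j m)) k) \<longlonglongrightarrow> 0"
    proof (rule unique)
      show "(\<lambda>m. g (c *\<^sub>C x) j m - pm_scale c (g x j m)) \<in> V.Comp" by (intro V.Comp_diff V.Comp_sc gC)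
      show "(\<lambda>m. ipV (g (c *\<^sub>C x) j m - pm_scale c (g x j m)) p) \<longlonglongrightarrow> 0" for p
        using tendsto_diff[OF gL tendsto_mult[OF tendsto_const[of "cnj c"] gL], of "c *\<^sub>C x" j p x j p]
        by (simp add: V.ip_diff_left V.ip_sc_left cinner_simps)
    qed
    moreover have "(\<lambda>m. emb (g (c *\<^sub>C x) j m - pm_scale c (g x j m)) k) \<longlonglongrightarrow> q j k (c *\<^sub>C x) - c *\<^sub>C q j k x"
      using tendsto_diff[OF qL bounded_linear.tendsto[OF bounded_linear_scaleC qL]]
      by (simp add: emb_diff emb_sc ell2_sc_def)
    ultimately have "q j k (c *\<^sub>C x) - c *\<^sub>C q j k x = 0" by (rule LIMSEQ_unique[rotated])
    then show ?thesis by simp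
  qed
  have q_bound: "norm (q j k x) \<le> norm x" for j k x
  proof -
    have "norm (q j k x) \<le> hnorm ipV (g x j)"
    proof (rule LIMSEQ_le[OF tendsto_norm[OF qL] V.nrm_Comp_LIMSEQ[OF gC]])
      show "\<exists>N. \<forall>n\<ge>N. norm (emb (g x j n) k) \<le> V.nrm (g x j n)"
        using ell2_norm_coord[OF embK] by (simp add: nrmV)
    qed
    then show ?thesis using gN[of x j] by simp
  qed
  define Q where "Q j k = Blinfun (q j k)" for j k
  have "bounded_linear (q j k)" for j k
    by (rule bounded_linear_intro[where K = 1]) (simp_all add: q_add q_sc q_bound scaleR_scaleC)
  then have Q: "blinfun_apply (Q j k) = q j k" for j k
    unfolding Q_def by (rule bounded_linear_Blinfun_apply)
  have q_Y: "q j k (blinfun_apply (Y i) x) = blinfun_apply (Y i) (q j k x)" for i j k x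
  proof -
    let ?Yg = "\<lambda>m. left_mult i (g x j m)"
    have YgC: "?Yg \<in> V.Comp"
      unfolding CompV emb_left by (rule ell2_operator_Comp) (use gC CompV in blast)
    have "(\<lambda>m. emb (g (blinfun_apply (Y i) x) j m - ?Yg m) k) \<longlonglongrightarrow> 0"
    proof (rule unique)
      show "(\<lambda>m. g (blinfun_apply (Y i) x) j m - ?Yg m) \<in> V.Comp" by (intro V.Comp_diff gC YgC)
      fix p
      have "ipV (?Yg m) p = ipV (g x j m) (left_mult i p)" for m
        unfolding ipV_def ell2_ip_def emb_left
        using adj_cinner_left[OF Yb] Ya by (metis (no_types, lifting))
      moreover have "cinner (blinfun_apply (Y i) x) (emb p j) = cinner x (emb (left_mult i p) j)"
        unfolding emb_left using adj_cinner_left[OF Yb] Ya by metis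
      ultimately show "(\<lambda>m. ipV (g (blinfun_apply (Y i) x) j m - ?Yg m) p) \<longlonglongrightarrow> 0"
        using tendsto_diff[OF gL gL, of "blinfun_apply (Y i) x" j p x j "left_mult i p"]
        by (simp add: V.ip_diff_left)
    qed
    moreover have "(\<lambda>m. emb (g (blinfun_apply (Y i) x) j m - ?Yg m) k)
        \<longlonglongrightarrow> q j k (blinfun_apply (Y i) x) - blinfun_apply (Y i) (q j k x)"
      using tendsto_diff[OF qL blinfun.tendsto[OF tendsto_const qL]] by (simp add: emb_diff emb_left)
    ultimately have "q j k (blinfun_apply (Y i) x) - blinfun_apply (Y i) (q j k x) = 0"
      by (rule LIMSEQ_unique[rotated])
    then show ?thesis by simp
  qed
  have Qcomm: "Q j k \<in> commutant (range Y)" for j k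
  proof -
    have "Q j k \<in> bounded_ops" by (simp add: bounded_ops_def Q q_sc)
    moreover have "Q j k o\<^sub>L Y i = Y i o\<^sub>L Q j k" for i
      by (rule blinfun_eqI) (simp add: Q q_Y)
    ultimately show ?thesis by (auto simp: commutant_def)
  qed
  have rYb: "range Y \<subseteq> bounded_ops" using Yb by blast
  have rYa: "adj ` range Y \<subseteq> range Y" using Ya by auto
  have aB: "a \<in> bounded_ops" using a commutant_bounded_ops by blast
  define a' where "a' = adj a"
  have a'C: "a' \<in> commutant (commutant (range Y))"
    unfolding a'_def using commutant_adj[OF rYb rYa]
    by (intro commutant_adj[OF commutant_bounded_ops _ a]) blast
  have a'_cinner: "cinner (blinfun_apply a' x) y = cinner x (blinfun_apply a y)" for x y
    unfolding a'_def by (rule adj_cinner_left[OF aB])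
  have a'q: "blinfun_apply a' (q j k x) = q j k (blinfun_apply a' x)" for j k x
  proof -
    have "a' o\<^sub>L Q j k = Q j k o\<^sub>L a'" using a'C Qcomm by (auto simp: commutant_def)
    from arg_cong[OF this, of "\<lambda>T. blinfun_apply T x"] show ?thesis by (simp add: Q)
  qed
  define az where "az = (\<lambda>k. blinfun_apply a (\<zeta> k))"
  have azK: "az \<in> ell2" unfolding az_def by (rule ell2_image[OF z])
  obtain h where h: "h \<in> V.Comp" and hL: "\<And>p. (\<lambda>m. ipV (h m) p) \<longlonglongrightarrow> ell2_ip az (emb p)"
  proof (rule V.Riesz[of "\<lambda>p. ell2_ip az (emb p)" "l2.nrm az"])
    show "cmod (ell2_ip az (emb p)) \<le> l2.nrm az * V.nrm p" for p
      unfolding nrmV by (rule l2.Cauchy_Schwarz[OF azK embK])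
  qed (use that in \<open>auto simp: emb_add emb_sc l2.ip_add l2.ip_sc azK embK l2.nrm_nonneg\<close>)
  have coord: "(\<lambda>n. emb (h n) j) \<longlonglongrightarrow> az j" for j
  proof -
    obtain H where H: "(\<lambda>n. emb (h n) j) \<longlonglongrightarrow> H"
      using V_coord_cauchy[OF h] by (auto simp: convergent_def)
    have "cinner x H = cinner x (az j)" for x
    proof -
      have "(\<lambda>n. hinner ipV (g x j) (\<lambda>_. h n)) \<longlonglongrightarrow> hinner ipV (g x j) h"
        by (rule V.hinner_iterated[OF gC h])
      moreover have "hinner ipV (g x j) (\<lambda>_. p) = cinner x (emb p j)" for p
        by (rule LIMSEQ_unique[OF V.hinner_const_right[OF gC UNIV_I] gL])
      ultimately have 1: "hinner ipV (g x j) h = cinner x H"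
        using LIMSEQ_unique[OF _ tendsto_cinner[OF tendsto_const H]] by simp
      have "(\<lambda>m. cnj (hinner ipV h (\<lambda>_. g x j m))) \<longlonglongrightarrow> cnj (hinner ipV h (g x j))"
        by (intro tendsto_cnj V.hinner_iterated h gC)
      moreover have "hinner ipV h (\<lambda>_. p) = ell2_ip az (emb p)" for p
        by (rule LIMSEQ_unique[OF V.hinner_const_right[OF h UNIV_I] hL])
      moreover have "cnj (ell2_ip az (emb p)) = ell2_ip (emb p) az" for p
        using l2.ip_herm[OF embK azK, of p] by simp
      ultimately have 2: "(\<lambda>m. ell2_ip (emb (g x j m)) az) \<longlonglongrightarrow> hinner ipV (g x j) h"
        using V.hinner_herm[OF gC h] by simp
      let ?x' = "blinfun_apply a' x"
      define D where "D m = (\<lambda>k. blinfun_apply a' (emb (g x j m) k)) - emb (g ?x' j m)" for m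
      have gC2: "(\<lambda>m. emb (g y j m)) \<in> l2.Comp" for y using gC CompV by blast
      have DC: "D \<in> l2.Comp"
        unfolding D_def by (rule l2.Comp_diff[OF ell2_operator_Comp[OF gC2] gC2])
      have "(\<lambda>m. l2.nrm (D m - 0)) \<longlonglongrightarrow> 0"
      proof (rule ell2_coordwise_limit[OF DC l2.K_zero])
        fix k
        have "(\<lambda>m. D m k) \<longlonglongrightarrow> blinfun_apply a' (q j k x) - q j k ?x'"
          unfolding D_def using tendsto_diff[OF blinfun.tendsto[OF tendsto_const qL] qL] by simp
        then show "(\<lambda>m. D m k) \<longlonglongrightarrow> 0 k" by (simp add: a'q)
      qed
      then have "(\<lambda>m. l2.nrm (D m) * l2.nrm \<zeta>) \<longlonglongrightarrow> 0" using tendsto_mult_left_zero by force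
      then have D0: "(\<lambda>m. ell2_ip (D m) \<zeta>) \<longlonglongrightarrow> 0"
        by (rule Lim_null_comparison[rotated])
          (simp add: l2.Cauchy_Schwarz[OF l2.Comp_in[OF DC] z])
      have emb1: "emb (Poly_Mapping.single [] 1) = \<zeta>"
        by (rule ext) (simp add: emb_def poly_eval_single)
      have "ell2_ip (emb (g x j m)) az = ell2_ip (D m) \<zeta> + ipV (g ?x' j m) (Poly_Mapping.single [] 1)" for m
      proof -
        have "ell2_ip (emb (g x j m)) az = ell2_ip (\<lambda>k. blinfun_apply a' (emb (g x j m) k)) \<zeta>"
          by (simp add: ell2_ip_def az_def a'_cinner)
        also have "(\<lambda>k. blinfun_apply a' (emb (g x j m) k)) = D m + emb (g ?x' j m)"
          by (simp add: D_def)
        also have "ell2_ip (D m + emb (g ?x' j m)) \<zeta> = ell2_ip (D m) \<zeta> + ell2_ip (emb (g ?x' j m)) \<zeta>"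
          by (rule l2.ip_add_left[OF l2.Comp_in[OF DC] embK z])
        finally show ?thesis by (simp add: ipV_def emb1)
      qed
      then have "(\<lambda>m. ell2_ip (emb (g x j m)) az) \<longlonglongrightarrow> 0 + cinner ?x' (\<zeta> j)"
        using tendsto_add[OF D0 gL[of ?x' j "Poly_Mapping.single [] 1"]] by (simp add: emb1)
      then have "hinner ipV (g x j) h = cinner ?x' (\<zeta> j)"
        using LIMSEQ_unique[OF 2] by simp
      then show ?thesis using 1 by (simp add: az_def a'_cinner)
    qed
    then have "H = az j" by (rule cinner_ext)
    then show ?thesis using H by simp
  qed
  have "(\<lambda>n. l2.nrm (emb (h n) - az)) \<longlonglongrightarrow> 0"
    by (rule ell2_coordwise_limit[OF CompV[THEN iffD1, OF h] azK coord])
  then have "(\<lambda>n. (l2.nrm (emb (h n) - az))\<^sup>2) \<longlonglongrightarrow> 0\<^sup>2" by (rule tendsto_power)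
  then have "\<forall>\<^sub>F n in sequentially. (l2.nrm (emb (h n) - az))\<^sup>2 < e"
    using eps by (intro order_tendstoD) simp_all
  then obtain n where n: "(l2.nrm (emb (h n) - az))\<^sup>2 < e" by (auto simp: eventually_sequentially)
  have K: "emb (h n) - az \<in> ell2" by (intro l2.K_diff embK azK)
  have "norm ((emb (h n) - az) k) = norm (blinfun_apply (a - poly_eval Y (h n)) (\<zeta> k))" for k
    by (simp add: emb_def az_def blinfun.diff_left norm_minus_commute)
  then have "(l2.nrm (emb (h n) - az))\<^sup>2 = suminf (\<lambda>k. (norm (blinfun_apply (a - poly_eval Y (h n)) (\<zeta> k)))\<^sup>2)"
    using ell2_nrm_sq[OF K] by simp
  then show ?thesis using n by auto
qed

context tracial_space
begin

lemma vn_generated_self_adjoint: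
  assumes "self_adjoint_tuple M Y"
  shows "vn_generated (range Y) = commutant (commutant (range Y))"
    "commutant (commutant (range Y)) \<subseteq> M" "range (poly_eval Y) \<subseteq> commutant (commutant (range Y))"
proof -
  have Y: "Y i \<in> M" "adj (Y i) = Y i" for i using assms by (auto simp: self_adjoint_tuple_def)
  have "range Y \<union> adj ` range Y = range Y" using Y(2) by auto
  then show "vn_generated (range Y) = commutant (commutant (range Y))"
    by (simp add: vn_generated_def)
  have "range Y \<subseteq> M" using Y by blast
  then show "commutant (commutant (range Y)) \<subseteq> M"
    using commutant_antimono M_bicommutant by metis
  let ?N = "commutant (commutant (range Y))"
  have "range Y \<subseteq> ?N" using Y M_bounded by (intro subset_bicommutant) blast
  then have w: "word_eval Y w \<in> ?N" for w
    by (induction w) (auto intro: commutant_id commutant_comp)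
  have "poly_eval Y p \<in> ?N" for p
    by (induction p rule: pm_induct)
      (auto simp: poly_eval_single poly_eval_add w commutant_zero
        intro: commutant_add commutant_sc[OF commutant_bounded_ops])
  then show "range (poly_eval Y) \<subseteq> ?N" by blast
qed

text \<open>Normality gives \<open>\<parallel>b\<parallel>\<^sub>2\<^sup>2 = \<Sum>\<^sub>k \<langle>b \<xi>\<^sub>k, b \<eta>\<^sub>k\<rangle>\<close>. Since \<open>Re \<langle>v, w\<rangle> \<le> \<parallel>v + w\<parallel>\<^sup>2\<close> by polarization, the single
  family \<open>\<xi>\<^sub>k + \<eta>\<^sub>k\<close> dominates the 2-norm.\<close>

theorem poly_eval_dense:
  fixes Y :: "'n \<Rightarrow> 'h oper"
  assumes Y: "self_adjoint_tuple M Y" and a: "a \<in> vn_generated (range Y)" and e: "0 < e"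
  shows "\<exists>p. m.nrm (a - poly_eval Y p) < e"
proof -
  have YM: "Y i \<in> M" "adj (Y i) = Y i" for i using Y by (auto simp: self_adjoint_tuple_def)
  have aN: "a \<in> commutant (commutant (range Y))" using a vn_generated_self_adjoint[OF Y] by simp
  then have aM: "a \<in> M" using vn_generated_self_adjoint[OF Y] by blast
  obtain \<xi> \<eta> :: "nat \<Rightarrow> 'h" where S: "\<xi> \<in> ell2" "\<eta> \<in> ell2"
    and T: "\<And>b. b \<in> M \<Longrightarrow> (\<lambda>k. cinner (\<xi> k) (blinfun_apply b (\<eta> k))) sums \<tau> b"
    using tau_normal unfolding normal_functional_def ell2_def by blast
  define \<zeta> where "\<zeta> = \<xi> + \<eta>"
  have z: "\<zeta> \<in> ell2" unfolding \<zeta>_def by (rule ell2_add[OF S])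
  obtain p where p: "suminf (\<lambda>k. (norm (blinfun_apply (a - poly_eval Y p) (\<zeta> k)))\<^sup>2) < e\<^sup>2"
    using ultrastrong_density[OF _ _ aN z, of "e\<^sup>2"] YM M_bounded e by (metis zero_less_power)
  define b where "b = a - poly_eval Y p"
  have bM: "b \<in> M" unfolding b_def using aM YM poly_eval_M by (intro M_diff) blast+
  have sq: "(\<lambda>k. cinner (blinfun_apply b (\<xi> k)) (blinfun_apply b (\<eta> k))) sums inner2 \<tau> b b"
    using T[of "adj b o\<^sub>L b"] bM by (simp add: inner2_def M_closed adj_cinner_right M_bounded)
  have "(m.nrm b)\<^sup>2 = Re (inner2 \<tau> b b)" by (rule m.nrm_sq[OF bM])
  also have "\<dots> = suminf (\<lambda>k. Re (cinner (blinfun_apply b (\<xi> k)) (blinfun_apply b (\<eta> k))))"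
    using sums_Re[OF sq] by (simp add: sums_iff)
  also have "\<dots> \<le> suminf (\<lambda>k. (norm (blinfun_apply b (\<zeta> k)))\<^sup>2)"
  proof (rule suminf_le)
    fix k
    let ?u = "blinfun_apply b (\<xi> k)" and ?v = "blinfun_apply b (\<eta> k)"
    have "(norm (?u + ?v))\<^sup>2 = (norm ?u)\<^sup>2 + (norm ?v)\<^sup>2 + 2 * Re (cinner ?u ?v)"
      using hilb.nrm_add_sq[of ?u ?v] by simp
    moreover have "(norm (?u - ?v))\<^sup>2 = (norm ?u)\<^sup>2 + (norm ?v)\<^sup>2 - 2 * Re (cinner ?u ?v)"
      using hilb.nrm_diff_sq[of ?u ?v] by simp
    moreover have "0 \<le> (norm (?u - ?v))\<^sup>2" "0 \<le> (norm (?u + ?v))\<^sup>2" by simp_all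
    ultimately have "Re (cinner ?u ?v) \<le> (norm (?u + ?v))\<^sup>2" by linarith
    then show "Re (cinner ?u ?v) \<le> (norm (blinfun_apply b (\<zeta> k)))\<^sup>2"
      by (simp add: \<zeta>_def blinfun.add_right)
  next
    show "summable (\<lambda>k. Re (cinner (blinfun_apply b (\<xi> k)) (blinfun_apply b (\<eta> k))))"
      using sums_Re[OF sq] by (rule sums_summable)
    show "summable (\<lambda>k. (norm (blinfun_apply b (\<zeta> k)))\<^sup>2)"
      using ell2_image[OF z] by (simp add: ell2_def)
  qed
  also have "\<dots> < e\<^sup>2" using p by (simp add: b_def)
  finally have "m.nrm b < e" using e by (intro power_less_imp_less_base[of _ 2 e]) simp_all
  then show ?thesis unfolding b_def by blast
qed

end

section \<open>Non-crossing pairings\<close>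

text \<open>Non-crossing pairings of an arbitrary set of positions, so that a pairing can be cut into
  pairings of the two sides of an arc without renumbering.\<close>

definition nc_pairings :: "nat set \<Rightarrow> nat set set set" where
  "nc_pairings A = {\<pi>. partition_on A \<pi> \<and> (\<forall>B\<in>\<pi>. card B = 2) \<and>
     \<not> (\<exists>B\<in>\<pi>. \<exists>B'\<in>\<pi>. B \<noteq> B' \<and>
          (\<exists>a b c d. a < b \<and> b < c \<and> c < d \<and> a \<in> B \<and> c \<in> B \<and> b \<in> B' \<and> d \<in> B'))}"

lemma NC2_eq: "NC2 k = nc_pairings {..<k}"
  by (simp add: NC2_def nc_pairings_def)

definition nc_sum :: "(nat \<Rightarrow> nat \<Rightarrow> 'a::comm_semiring_1) \<Rightarrow> nat set \<Rightarrow> 'a" where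
  "nc_sum c A = (\<Sum>\<pi>\<in>nc_pairings A. \<Prod>B\<in>\<pi>. c (Min B) (Max B))"

lemma nc_pairings_partition: "\<pi> \<in> nc_pairings A \<Longrightarrow> partition_on A \<pi>"
  by (simp add: nc_pairings_def)

lemma nc_pairings_card: "\<pi> \<in> nc_pairings A \<Longrightarrow> B \<in> \<pi> \<Longrightarrow> card B = 2"
  by (simp add: nc_pairings_def)

lemma nc_pairings_noncrossing:
  "\<pi> \<in> nc_pairings A \<Longrightarrow> B \<in> \<pi> \<Longrightarrow> B' \<in> \<pi> \<Longrightarrow> p \<in> B \<Longrightarrow> r \<in> B \<Longrightarrow> q \<in> B' \<Longrightarrow> s \<in> B'
    \<Longrightarrow> p < q \<Longrightarrow> q < r \<Longrightarrow> r < s \<Longrightarrow> B = B'"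
  unfolding nc_pairings_def by blast

lemma nc_pairingsI:
  assumes "partition_on A \<pi>" "\<And>B. B \<in> \<pi> \<Longrightarrow> card B = 2"
    and "\<And>B B' p q r s. B \<in> \<pi> \<Longrightarrow> B' \<in> \<pi> \<Longrightarrow> p \<in> B \<Longrightarrow> r \<in> B \<Longrightarrow> q \<in> B' \<Longrightarrow> s \<in> B'
      \<Longrightarrow> p < q \<Longrightarrow> q < r \<Longrightarrow> r < s \<Longrightarrow> B = B'"
  shows "\<pi> \<in> nc_pairings A"
  unfolding nc_pairings_def using assms by blast

lemma nc_pairings_subset: "\<pi> \<in> nc_pairings A \<Longrightarrow> B \<in> \<pi> \<Longrightarrow> B \<subseteq> A"
  using nc_pairings_partition by (auto simp: partition_on_def)

lemma finite_nc_pairings: assumes "finite A" shows "finite (nc_pairings A)"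
proof (rule finite_subset)
  show "nc_pairings A \<subseteq> Pow (Pow A)" using nc_pairings_subset by blast
qed (use assms in simp)

lemma nc_pairings_finite: "finite A \<Longrightarrow> \<pi> \<in> nc_pairings A \<Longrightarrow> finite \<pi>"
  using nc_pairings_subset by (metis PowI finite_Pow_iff finite_subset subsetI)

text \<open>Order isomorphisms preserve non-crossing pairings; they renumber the two sides of an arc.\<close>

lemma nc_pairings_image:
  assumes f: "strict_mono_on A f" and \<pi>: "\<pi> \<in> nc_pairings A"
  shows "(`) f ` \<pi> \<in> nc_pairings (f ` A)"
proof (rule nc_pairingsI)
  have inj: "inj_on f A" using f by (rule strict_mono_on_imp_inj_on)
  show "partition_on (f ` A) ((`) f ` \<pi>)"
  proof -
    have "{} \<notin> \<pi>" using nc_pairings_partition[OF \<pi>] by (simp add: partition_on_def)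
    then have "(`) f ` \<pi> - {{}} = (`) f ` \<pi>" by auto
    then show ?thesis
      using partition_on_inj_image[OF nc_pairings_partition[OF \<pi>] inj] by simp
  qed
  show "card B = 2" if B: "B \<in> (`) f ` \<pi>" for B
  proof -
    obtain B0 where B0: "B0 \<in> \<pi>" "B = f ` B0" using B by blast
    then have "card B = card B0"
      using nc_pairings_subset[OF \<pi>] inj by (simp add: card_image inj_on_subset)
    then show ?thesis using nc_pairings_card[OF \<pi> B0(1)] by simp
  qed
  fix B B' p q r s
  assume "B \<in> (`) f ` \<pi>" "B' \<in> (`) f ` \<pi>"
    and mem: "p \<in> B" "r \<in> B" "q \<in> B'" "s \<in> B'" and less: "p < q" "q < r" "r < s"
  then obtain B0 B0' where B0: "B0 \<in> \<pi>" "B = f ` B0" "B0' \<in> \<pi>" "B' = f ` B0'" by blast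
  obtain p0 q0 r0 s0 where
    z: "p0 \<in> B0" "r0 \<in> B0" "q0 \<in> B0'" "s0 \<in> B0'" "p = f p0" "q = f q0" "r = f r0" "s = f s0"
    using mem B0 by blast
  have zA: "p0 \<in> A" "q0 \<in> A" "r0 \<in> A" "s0 \<in> A"
    using z B0 nc_pairings_subset[OF \<pi>] by blast+
  have "p0 < q0" "q0 < r0" "r0 < s0"
    using less z zA strict_mono_on_less[OF f] by simp_all
  then show "B = B'" using nc_pairings_noncrossing[OF \<pi> B0(1,3) z(1-4)] B0 by simp
qed

lemma nc_sum_image:
  assumes f: "strict_mono f" and A: "finite A"
  shows "nc_sum c (f ` A) = nc_sum (\<lambda>x y. c (f x) (f y)) A"
proof -
  have inj: "inj f" using f by (rule strict_mono_imp_inj_on)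
  have fA: "strict_mono_on A f" using f by (auto simp: strict_mono_on_def strict_mono_def)
  have surj: "nc_pairings (f ` A) = (`) ((`) f) ` nc_pairings A"
  proof
    show "(`) ((`) f) ` nc_pairings A \<subseteq> nc_pairings (f ` A)"
      using nc_pairings_image[OF fA] by blast
    show "nc_pairings (f ` A) \<subseteq> (`) ((`) f) ` nc_pairings A"
    proof
      fix \<pi> assume \<pi>: "\<pi> \<in> nc_pairings (f ` A)"
      have "strict_mono_on (f ` A) (inv f)"
        using f inj by (auto simp: strict_mono_on_def strict_mono_less)
      from nc_pairings_image[OF this \<pi>] have "(`) (inv f) ` \<pi> \<in> nc_pairings A"
        using inj by (simp add: image_image)
      moreover have "(`) f ` ((`) (inv f) ` \<pi>) = \<pi>"
      proof -
        have "f ` (inv f ` B) = B" if "B \<in> \<pi>" for B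
          using nc_pairings_subset[OF \<pi> that] inj by (force simp: image_image)
        then show ?thesis by (simp add: image_image)
      qed
      ultimately show "\<pi> \<in> (`) ((`) f) ` nc_pairings A" by (metis imageI)
    qed
  qed
  have inj1: "inj ((`) f)" by (rule injI) (simp only: inj_image_eq_iff[OF inj])
  have inj2: "inj ((`) ((`) f))" by (rule injI) (simp only: inj_image_eq_iff[OF inj1])
  have "nc_sum c (f ` A) = (\<Sum>\<pi>\<in>nc_pairings A. \<Prod>B\<in>(`) f ` \<pi>. c (Min B) (Max B))"
    unfolding nc_sum_def surj by (simp add: sum.reindex[OF inj_on_subset[OF inj2 subset_UNIV]])
  also have "\<dots> = nc_sum (\<lambda>x y. c (f x) (f y)) A"
    unfolding nc_sum_def
  proof (rule sum.cong[OF refl])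
    fix \<pi> assume \<pi>: "\<pi> \<in> nc_pairings A"
    have "(\<Prod>B\<in>(`) f ` \<pi>. c (Min B) (Max B)) = (\<Prod>B\<in>\<pi>. c (Min (f ` B)) (Max (f ` B)))"
      by (simp add: prod.reindex[OF inj_on_subset[OF inj1 subset_UNIV]])
    also have "\<dots> = (\<Prod>B\<in>\<pi>. c (f (Min B)) (f (Max B)))"
    proof (rule prod.cong[OF refl])
      fix B assume "B \<in> \<pi>"
      then have "card B = 2" by (rule nc_pairings_card[OF \<pi>])
      then have "finite B" "B \<noteq> {}" by (auto intro: card_ge_0_finite)
      then show "c (Min (f ` B)) (Max (f ` B)) = c (f (Min B)) (f (Max B))"
        using mono_Min_commute[of f B] mono_Max_commute[of f B] strict_mono_mono[OF f] by simp
    qed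
    finally show "(\<Prod>B\<in>(`) f ` \<pi>. c (Min B) (Max B)) = (\<Prod>B\<in>\<pi>. c (f (Min B)) (f (Max B)))" .
  qed
  finally show ?thesis .
qed

text \<open>The arc \<open>{a, b}\<close> at the least position separates the remaining positions into those under
  the arc and those to the right of it; no other block can straddle \<open>b\<close>.\<close>

lemma nc_pairings_arc_join:
  assumes a: "\<And>x. x \<in> A \<Longrightarrow> a < x" and b: "b \<in> A"
    and \<sigma>: "\<sigma> \<in> nc_pairings (A \<inter> {..<b})" and \<rho>: "\<rho> \<in> nc_pairings (A \<inter> {b<..})"
  shows "insert {a, b} (\<sigma> \<union> \<rho>) \<in> nc_pairings (insert a A)"
proof (rule nc_pairingsI)
  have ab: "a < b" using a b by blast
  have U: "\<Union>\<sigma> = A \<inter> {..<b}" "\<Union>\<rho> = A \<inter> {b<..}"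
    and D: "disjoint \<sigma>" "disjoint \<rho>" and E: "{} \<notin> \<sigma>" "{} \<notin> \<rho>"
    using nc_pairings_partition[OF \<sigma>] nc_pairings_partition[OF \<rho>] by (auto simp: partition_on_def)
  have aA: "a \<notin> A" using a by blast
  show "partition_on (insert a A) (insert {a, b} (\<sigma> \<union> \<rho>))"
    unfolding partition_on_def
  proof (intro conjI)
    show "\<Union>(insert {a, b} (\<sigma> \<union> \<rho>)) = insert a A"
      using U b by auto
    have "disjoint (\<sigma> \<union> \<rho>)" using D U by (intro disjoint_union) auto
    moreover have "disjoint {{a, b}}" by (simp add: disjoint_def)
    moreover have "\<Union>{{a, b}} \<inter> \<Union>(\<sigma> \<union> \<rho>) = {}" using U aA by auto
    ultimately have "disjoint ({{a, b}} \<union> (\<sigma> \<union> \<rho>))" by (metis disjoint_union)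
    then show "disjoint (insert {a, b} (\<sigma> \<union> \<rho>))" by simp
    show "{} \<notin> insert {a, b} (\<sigma> \<union> \<rho>)" using E by auto
  qed
  show "card B = 2" if "B \<in> insert {a, b} (\<sigma> \<union> \<rho>)" for B
    using that ab nc_pairings_card[OF \<sigma>] nc_pairings_card[OF \<rho>] by (auto simp: card_insert_if)
  fix B B' p q r s
  assume B: "B \<in> insert {a, b} (\<sigma> \<union> \<rho>)" and B': "B' \<in> insert {a, b} (\<sigma> \<union> \<rho>)"
    and mem: "p \<in> B" "r \<in> B" "q \<in> B'" "s \<in> B'" and less: "p < q" "q < r" "r < s"
  have \<sigma>D: "x \<in> A \<and> x < b" if "Z \<in> \<sigma>" "x \<in> Z" for x Z using U that by blast
  have \<rho>D: "x \<in> A \<and> b < x" if "Z \<in> \<rho>" "x \<in> Z" for x Z using U that by blast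
  show "B = B'"
  proof (cases "B = {a, b}")
    case True
    then have "p = a" "r = b" using mem less ab by auto
    then show ?thesis
      using B' mem less True \<sigma>D[of B' s] \<rho>D[of B' q] by auto
  next
    case False
    then have "a < p" using B mem(1) a \<sigma>D[of B p] \<rho>D[of B p] by auto
    then have "B' \<noteq> {a, b}" using mem less False B \<sigma>D[of B r] \<rho>D[of B p] by force
    then consider "B \<in> \<sigma>" "B' \<in> \<sigma>" | "B \<in> \<rho>" "B' \<in> \<rho>" | "B \<in> \<sigma>" "B' \<in> \<rho>" | "B \<in> \<rho>" "B' \<in> \<sigma>"
      using B B' False by blast
    then show ?thesis
    proof cases
      case 1
      then show ?thesis using nc_pairings_noncrossing[OF \<sigma> _ _ mem less] by blast
    next
      case 2
      then show ?thesis using nc_pairings_noncrossing[OF \<rho> _ _ mem less] by blast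
    next
      case 3
      then show ?thesis using \<sigma>D[of B r] \<rho>D[of B' q] mem less by simp
    next
      case 4
      then show ?thesis using \<rho>D[of B p] \<sigma>D[of B' q] mem less by simp
    qed
  qed
qed

lemma nc_pairings_arc_cut:
  assumes a: "\<And>x. x \<in> A \<Longrightarrow> a < x" and \<pi>: "\<pi> \<in> nc_pairings (insert a A)"
  obtains b where "b \<in> A" "\<pi> \<inter> Pow (A \<inter> {..<b}) \<in> nc_pairings (A \<inter> {..<b})"
    "\<pi> \<inter> Pow (A \<inter> {b<..}) \<in> nc_pairings (A \<inter> {b<..})"
    "\<pi> = insert {a, b} (\<pi> \<inter> Pow (A \<inter> {..<b}) \<union> \<pi> \<inter> Pow (A \<inter> {b<..}))"
proof -
  have aA: "a \<notin> A" using a by blast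
  have U: "\<Union>\<pi> = insert a A" and D: "disjoint \<pi>" and E: "{} \<notin> \<pi>"
    using nc_pairings_partition[OF \<pi>] by (auto simp: partition_on_def)
  obtain B0 where B0: "B0 \<in> \<pi>" "a \<in> B0" using U by blast
  obtain x y where "B0 = {x, y}" "x \<noteq> y"
    using nc_pairings_card[OF \<pi> B0(1)] card_2_iff by metis
  then obtain b where b: "B0 = {a, b}" "b \<noteq> a" using B0 by auto
  then have bA: "b \<in> A" using U B0 by blast
  have ab: "a < b" using a bA by blast
  have split: "B \<subseteq> A \<inter> {..<b} \<or> B \<subseteq> A \<inter> {b<..}" if B: "B \<in> \<pi>" "B \<noteq> {a, b}" for B
  proof -
    have disj: "B \<inter> {a, b} = {}" using D B B0 b by (auto simp: disjoint_def)
    then have BA: "B \<subseteq> A" using U B by blast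
    obtain x y where xy: "B = {x, y}" "x < y"
      using nc_pairings_card[OF \<pi> B(1)] by (metis card_2_iff insert_commute linorder_neqE_nat)
    have "\<not> (x < b \<and> b < y)"
    proof
      assume "x < b \<and> b < y"
      then have "{a, b} = B"
        using nc_pairings_noncrossing[OF \<pi>, of "{a, b}" B a b x y] B B0 b xy a BA by auto
      then show False using B by simp
    qed
    then show ?thesis using xy disj BA by auto
  qed
  have part: "\<pi> \<inter> Pow (A \<inter> Q) \<in> nc_pairings (A \<inter> Q)"
    if Q: "b \<notin> Q" "\<And>B. B \<in> \<pi> \<Longrightarrow> B \<noteq> {a, b} \<Longrightarrow> B \<subseteq> A \<inter> Q \<or> B \<inter> (A \<inter> Q) = {}" for Q
  proof (rule nc_pairingsI)
    show "partition_on (A \<inter> Q) (\<pi> \<inter> Pow (A \<inter> Q))"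
      unfolding partition_on_def
    proof (intro conjI)
      show "\<Union>(\<pi> \<inter> Pow (A \<inter> Q)) = A \<inter> Q"
      proof
        show "A \<inter> Q \<subseteq> \<Union>(\<pi> \<inter> Pow (A \<inter> Q))"
        proof
          fix x assume x: "x \<in> A \<inter> Q"
          then obtain B where B: "B \<in> \<pi>" "x \<in> B" using U by blast
          then have "B \<noteq> {a, b}" using x Q(1) aA by auto
          then show "x \<in> \<Union>(\<pi> \<inter> Pow (A \<inter> Q))" using Q(2)[OF B(1)] B x by blast
        qed
      qed blast
      show "disjoint (\<pi> \<inter> Pow (A \<inter> Q))" using D by (rule pairwise_subset) blast
      show "{} \<notin> \<pi> \<inter> Pow (A \<inter> Q)" using E by blast
    qed
    show "card B = 2" if "B \<in> \<pi> \<inter> Pow (A \<inter> Q)" for B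
      using that nc_pairings_card[OF \<pi>] by blast
    show "B = B'" if "B \<in> \<pi> \<inter> Pow (A \<inter> Q)" "B' \<in> \<pi> \<inter> Pow (A \<inter> Q)" "p \<in> B" "r \<in> B" "q \<in> B'" "s \<in> B'"
      "p < q" "q < r" "r < s" for B B' p q r s
      using nc_pairings_noncrossing[OF \<pi> _ _ that(3-9)] that(1,2) by blast
  qed
  show thesis
  proof (rule that[OF bA])
    show "\<pi> \<inter> Pow (A \<inter> {..<b}) \<in> nc_pairings (A \<inter> {..<b})"
    proof (rule part)
      show "B \<subseteq> A \<inter> {..<b} \<or> B \<inter> (A \<inter> {..<b}) = {}" if "B \<in> \<pi>" "B \<noteq> {a, b}" for B
        using split[OF that] by fastforce
      show "b \<notin> {..<b}" by simp
    qed
    show "\<pi> \<inter> Pow (A \<inter> {b<..}) \<in> nc_pairings (A \<inter> {b<..})"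
    proof (rule part)
      show "B \<subseteq> A \<inter> {b<..} \<or> B \<inter> (A \<inter> {b<..}) = {}" if "B \<in> \<pi>" "B \<noteq> {a, b}" for B
        using split[OF that] by fastforce
      show "b \<notin> {b<..}" by simp
    qed
    show "\<pi> = insert {a, b} (\<pi> \<inter> Pow (A \<inter> {..<b}) \<union> \<pi> \<inter> Pow (A \<inter> {b<..}))"
      using split B0 b by blast
  qed
qed

text \<open>Since the joined pairing determines the arc and the pairings of both sides, the sum over all
  pairings factorizes along the position \<open>b\<close> that is paired with \<open>a\<close>.\<close>

theorem nc_sum_recursion:
  assumes a: "\<And>x. x \<in> A \<Longrightarrow> a < x" and A: "finite A"
  shows "nc_sum c (insert a A) = (\<Sum>b\<in>A. c a b * (nc_sum c (A \<inter> {..<b}) * nc_sum c (A \<inter> {b<..})))"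
proof -
  define join where "join = (\<lambda>(b, \<sigma>, \<rho>). insert {a, b} (\<sigma> \<union> \<rho> :: nat set set))"
  define I where "I = (SIGMA b:A. nc_pairings (A \<inter> {..<b}) \<times> nc_pairings (A \<inter> {b<..}))"
  have aA: "a \<notin> A" using a by blast
  have noA: "Z \<subseteq> A - {b}" if "b \<in> A" "\<sigma> \<in> nc_pairings (A \<inter> {..<b})" "\<rho> \<in> nc_pairings (A \<inter> {b<..})"
    "Z \<in> \<sigma> \<union> \<rho>" for b \<sigma> \<rho> Z
    using that nc_pairings_subset[of \<sigma>] nc_pairings_subset[of \<rho>] by blast
  have bij: "bij_betw join I (nc_pairings (insert a A))"
  proof (rule bij_betw_imageI)
    show "inj_on join I"
    proof (rule inj_onI)
      fix x x' assume x: "x \<in> I" "x' \<in> I" and eq: "join x = join x'"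
      obtain b \<sigma> \<rho> where X: "x = (b, \<sigma>, \<rho>)" by (cases x)
      obtain b' \<sigma>' \<rho>' where X': "x' = (b', \<sigma>', \<rho>')" by (cases x')
      have m: "b \<in> A" "\<sigma> \<in> nc_pairings (A \<inter> {..<b})" "\<rho> \<in> nc_pairings (A \<inter> {b<..})"
        and m': "b' \<in> A" "\<sigma>' \<in> nc_pairings (A \<inter> {..<b'})" "\<rho>' \<in> nc_pairings (A \<inter> {b'<..})"
        using x by (auto simp: I_def X X')
      have eq': "insert {a, b} (\<sigma> \<union> \<rho>) = insert {a, b'} (\<sigma>' \<union> \<rho>')"
        using eq by (simp add: join_def X X')
      have "{a, b} \<notin> \<sigma>' \<union> \<rho>'"
      proof
        assume "{a, b} \<in> \<sigma>' \<union> \<rho>'"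
        from noA[OF m' this] show False using aA by simp
      qed
      moreover have "{a, b} \<in> insert {a, b'} (\<sigma>' \<union> \<rho>')" unfolding eq'[symmetric] by simp
      ultimately have "{a, b} = {a, b'}" by simp
      then have b: "b' = b" by (auto simp: doubleton_eq_iff)
      have r: "\<sigma> = insert {a, b} (\<sigma> \<union> \<rho>) \<inter> Pow (A \<inter> {..<b})" "\<rho> = insert {a, b} (\<sigma> \<union> \<rho>) \<inter> Pow (A \<inter> {b<..})"
        if "\<sigma> \<in> nc_pairings (A \<inter> {..<b})" "\<rho> \<in> nc_pairings (A \<inter> {b<..})" for \<sigma> \<rho>
      proof -
        have E: "{} \<notin> \<sigma>" "{} \<notin> \<rho>"
          using nc_pairings_partition[OF that(1)] nc_pairings_partition[OF that(2)] by (auto simp: partition_on_def)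
        show "\<sigma> = insert {a, b} (\<sigma> \<union> \<rho>) \<inter> Pow (A \<inter> {..<b})"
        proof
          show "insert {a, b} (\<sigma> \<union> \<rho>) \<inter> Pow (A \<inter> {..<b}) \<subseteq> \<sigma>"
          proof
            fix Z assume Z: "Z \<in> insert {a, b} (\<sigma> \<union> \<rho>) \<inter> Pow (A \<inter> {..<b})"
            have "Z \<notin> \<rho>"
            proof
              assume "Z \<in> \<rho>"
              then have "Z \<subseteq> A \<inter> {b<..}" "Z \<noteq> {}" using nc_pairings_subset[OF that(2)] E by auto
              then show False using Z by force
            qed
            then show "Z \<in> \<sigma>" using Z aA by auto
          qed
        qed (use nc_pairings_subset[OF that(1)] in blast)
        show "\<rho> = insert {a, b} (\<sigma> \<union> \<rho>) \<inter> Pow (A \<inter> {b<..})"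
        proof
          show "insert {a, b} (\<sigma> \<union> \<rho>) \<inter> Pow (A \<inter> {b<..}) \<subseteq> \<rho>"
          proof
            fix Z assume Z: "Z \<in> insert {a, b} (\<sigma> \<union> \<rho>) \<inter> Pow (A \<inter> {b<..})"
            have "Z \<notin> \<sigma>"
            proof
              assume "Z \<in> \<sigma>"
              then have "Z \<subseteq> A \<inter> {..<b}" "Z \<noteq> {}" using nc_pairings_subset[OF that(1)] E by auto
              then show False using Z by force
            qed
            then show "Z \<in> \<rho>" using Z aA by auto
          qed
        qed (use nc_pairings_subset[OF that(2)] in blast)
      qed
      have eq'': "insert {a, b} (\<sigma> \<union> \<rho>) = insert {a, b} (\<sigma>' \<union> \<rho>')"
        using eq' unfolding b .
      have r': "\<sigma>' = insert {a, b} (\<sigma>' \<union> \<rho>') \<inter> Pow (A \<inter> {..<b})"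
          "\<rho>' = insert {a, b} (\<sigma>' \<union> \<rho>') \<inter> Pow (A \<inter> {b<..})"
        using m'(2,3) unfolding b by (rule r)+
      have "\<sigma> = \<sigma>'" by (rule trans[OF r(1)[OF m(2,3)]]) (simp only: eq'' r'(1)[symmetric])
      moreover have "\<rho> = \<rho>'" by (rule trans[OF r(2)[OF m(2,3)]]) (simp only: eq'' r'(2)[symmetric])
      ultimately have "\<sigma> = \<sigma>'" "\<rho> = \<rho>'" by blast+
      then show "x = x'" by (simp add: X X' b)
    qed
    show "join ` I = nc_pairings (insert a A)"
    proof
      show "join ` I \<subseteq> nc_pairings (insert a A)"
        using nc_pairings_arc_join[OF a] by (auto simp: join_def I_def)
      show "nc_pairings (insert a A) \<subseteq> join ` I"
      proof
        fix \<pi> assume "\<pi> \<in> nc_pairings (insert a A)"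
        from nc_pairings_arc_cut[OF a this] obtain b where b: "b \<in> A"
          "\<pi> \<inter> Pow (A \<inter> {..<b}) \<in> nc_pairings (A \<inter> {..<b})"
          "\<pi> \<inter> Pow (A \<inter> {b<..}) \<in> nc_pairings (A \<inter> {b<..})"
          "\<pi> = insert {a, b} (\<pi> \<inter> Pow (A \<inter> {..<b}) \<union> \<pi> \<inter> Pow (A \<inter> {b<..}))" by blast
        have "\<pi> = join (b, \<pi> \<inter> Pow (A \<inter> {..<b}), \<pi> \<inter> Pow (A \<inter> {b<..}))"
          using b(4) by (simp add: join_def)
        moreover have "(b, \<pi> \<inter> Pow (A \<inter> {..<b}), \<pi> \<inter> Pow (A \<inter> {b<..})) \<in> I"
          using b by (simp add: I_def)
        ultimately show "\<pi> \<in> join ` I" by (rule image_eqI)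
      qed
    qed
  qed
  have "nc_sum c (insert a A) = (\<Sum>x\<in>I. \<Prod>B\<in>join x. c (Min B) (Max B))"
    unfolding nc_sum_def using sum.reindex_bij_betw[OF bij, of "\<lambda>\<pi>. \<Prod>B\<in>\<pi>. c (Min B) (Max B)"] by simp
  also have "\<dots> = (\<Sum>b\<in>A. \<Sum>y\<in>nc_pairings (A \<inter> {..<b}) \<times> nc_pairings (A \<inter> {b<..}).
      \<Prod>B\<in>join (b, y). c (Min B) (Max B))"
    unfolding I_def using A by (subst sum.Sigma) (auto intro: finite_nc_pairings)
  also have "\<dots> = (\<Sum>b\<in>A. c a b * (nc_sum c (A \<inter> {..<b}) * nc_sum c (A \<inter> {b<..})))"
  proof (rule sum.cong[OF refl])
    fix b assume b: "b \<in> A"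
    have "(\<Prod>B\<in>join (b, y). c (Min B) (Max B))
        = c a b * ((\<Prod>B\<in>fst y. c (Min B) (Max B)) * (\<Prod>B\<in>snd y. c (Min B) (Max B)))"
      if y: "y \<in> nc_pairings (A \<inter> {..<b}) \<times> nc_pairings (A \<inter> {b<..})" for y
    proof -
      obtain \<sigma> \<rho> where Y: "y = (\<sigma>, \<rho>)" and m: "\<sigma> \<in> nc_pairings (A \<inter> {..<b})" "\<rho> \<in> nc_pairings (A \<inter> {b<..})"
        using y by auto
      have fin: "finite \<sigma>" "finite \<rho>" using m A nc_pairings_finite by blast+
      have n: "{a, b} \<notin> \<sigma> \<union> \<rho>"
      proof
        assume "{a, b} \<in> \<sigma> \<union> \<rho>"
        from noA[OF b m this] show False using aA by simp
      qed
      have "\<sigma> \<inter> \<rho> = {}"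
      proof -
        have "Z = {}" if "Z \<in> \<sigma>" "Z \<in> \<rho>" for Z
          using nc_pairings_subset[OF m(1) that(1)] nc_pairings_subset[OF m(2) that(2)] by force
        moreover have "{} \<notin> \<sigma>" using nc_pairings_partition[OF m(1)] by (simp add: partition_on_def)
        ultimately show ?thesis by blast
      qed
      moreover have "Min {a, b} = a" "Max {a, b} = b" using a[OF b] by auto
      ultimately show ?thesis
        using fin n by (simp add: join_def Y prod.union_disjoint)
    qed
    then have "(\<Sum>y\<in>nc_pairings (A \<inter> {..<b}) \<times> nc_pairings (A \<inter> {b<..}). \<Prod>B\<in>join (b, y). c (Min B) (Max B))
        = (\<Sum>y\<in>nc_pairings (A \<inter> {..<b}) \<times> nc_pairings (A \<inter> {b<..}).
            c a b * ((\<Prod>B\<in>fst y. c (Min B) (Max B)) * (\<Prod>B\<in>snd y. c (Min B) (Max B))))"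
      by (rule sum.cong[OF refl])
    also have "\<dots> = c a b * (nc_sum c (A \<inter> {..<b}) * nc_sum c (A \<inter> {b<..}))"
    proof -
      have "nc_sum c (A \<inter> {..<b}) * nc_sum c (A \<inter> {b<..})
          = (\<Sum>\<sigma>\<in>nc_pairings (A \<inter> {..<b}). \<Sum>\<rho>\<in>nc_pairings (A \<inter> {b<..}).
              (\<Prod>B\<in>\<sigma>. c (Min B) (Max B)) * (\<Prod>B\<in>\<rho>. c (Min B) (Max B)))"
        unfolding nc_sum_def by (rule sum_product)
      also have "\<dots> = (\<Sum>(\<sigma>, \<rho>)\<in>nc_pairings (A \<inter> {..<b}) \<times> nc_pairings (A \<inter> {b<..}).
              (\<Prod>B\<in>\<sigma>. c (Min B) (Max B)) * (\<Prod>B\<in>\<rho>. c (Min B) (Max B)))"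
        by (rule sum.cartesian_product)
      finally show ?thesis by (simp only: sum_distrib_left case_prod_unfold)
    qed
    finally show "(\<Sum>y\<in>nc_pairings (A \<inter> {..<b}) \<times> nc_pairings (A \<inter> {b<..}). \<Prod>B\<in>join (b, y). c (Min B) (Max B))
        = c a b * (nc_sum c (A \<inter> {..<b}) * nc_sum c (A \<inter> {b<..}))" .
  qed
  finally show ?thesis .
qed

definition nc_moment :: "('n \<Rightarrow> 'n \<Rightarrow> 'a::comm_semiring_1) \<Rightarrow> 'n list \<Rightarrow> 'a" where
  "nc_moment c w = nc_sum (\<lambda>a b. c (w ! a) (w ! b)) {..<length w}"

lemma nc_sum_cong:
  assumes "finite A" "\<And>x y. x \<in> A \<Longrightarrow> y \<in> A \<Longrightarrow> c x y = d x y"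
  shows "nc_sum c A = nc_sum d A"
  unfolding nc_sum_def
proof (intro sum.cong prod.cong refl)
  fix \<pi> B assume \<pi>: "\<pi> \<in> nc_pairings A" and B: "B \<in> \<pi>"
  have "card B = 2" using nc_pairings_card[OF \<pi> B] .
  then have "finite B" "B \<noteq> {}" by (auto intro: card_ge_0_finite)
  then have "Min B \<in> B" "Max B \<in> B" by simp_all
  then show "c (Min B) (Max B) = d (Min B) (Max B)"
    using assms(2) nc_pairings_subset[OF \<pi> B] by blast
qed

text \<open>The Schwinger--Dyson equation of a semicircular family, at the level of its moments: the letter
  paired with the first one cuts the word in two.\<close>

theorem nc_moment_Cons:
  "nc_moment c (i # w) = (\<Sum>k<length w. c i (w ! k) * (nc_moment c (take k w) * nc_moment c (drop (Suc k) w)))"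
proof -
  let ?c = "\<lambda>a b. c ((i # w) ! a) ((i # w) ! b)"
  define n where "n = length w"
  have "nc_moment c (i # w) = nc_sum ?c (insert 0 (Suc ` {..<n}))"
    by (simp add: nc_moment_def n_def lessThan_Suc_eq_insert_0)
  also have "\<dots> = (\<Sum>b\<in>Suc ` {..<n}. ?c 0 b * (nc_sum ?c (Suc ` {..<n} \<inter> {..<b}) * nc_sum ?c (Suc ` {..<n} \<inter> {b<..})))"
    by (rule nc_sum_recursion) auto
  also have "\<dots> = (\<Sum>k<n. c i (w ! k) * (nc_sum ?c (Suc ` {..<n} \<inter> {..<Suc k}) * nc_sum ?c (Suc ` {..<n} \<inter> {Suc k<..})))"
    by (subst sum.reindex) simp_all
  also have "\<dots> = (\<Sum>k<n. c i (w ! k) * (nc_moment c (take k w) * nc_moment c (drop (Suc k) w)))"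
  proof (rule sum.cong[OF refl])
    fix k assume "k \<in> {..<n}"
    then have k: "k < n" by simp
    have "Suc ` {..<n} \<inter> {..<Suc k} = Suc ` {..<k}" using k by auto
    then have "nc_sum ?c (Suc ` {..<n} \<inter> {..<Suc k}) = nc_sum (\<lambda>a b. c (w ! a) (w ! b)) {..<k}"
      using nc_sum_image[of Suc "{..<k}" ?c] by (simp add: strict_mono_def)
    also have "\<dots> = nc_moment c (take k w)"
      using k by (auto simp: nc_moment_def n_def min_def intro!: nc_sum_cong)
    finally have 1: "nc_sum ?c (Suc ` {..<n} \<inter> {..<Suc k}) = nc_moment c (take k w)" .
    have "Suc ` {..<n} \<inter> {Suc k<..} = (\<lambda>x. Suc (Suc (k + x))) ` {..<n - Suc k}"
    proof (intro equalityI subsetI)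
      fix x assume "x \<in> Suc ` {..<n} \<inter> {Suc k<..}"
      then have "x = Suc (Suc (k + (x - Suc (Suc k))))" "x - Suc (Suc k) < n - Suc k" by auto
      then show "x \<in> (\<lambda>x. Suc (Suc (k + x))) ` {..<n - Suc k}" by blast
    qed auto
    then have "nc_sum ?c (Suc ` {..<n} \<inter> {Suc k<..})
        = nc_sum (\<lambda>a b. c (w ! Suc (k + a)) (w ! Suc (k + b))) {..<n - Suc k}"
      using nc_sum_image[of "\<lambda>x. Suc (Suc (k + x))" "{..<n - Suc k}" ?c] by (simp add: strict_mono_def)
    also have "\<dots> = nc_moment c (drop (Suc k) w)"
      using k by (auto simp: nc_moment_def n_def intro!: nc_sum_cong)
    finally show "c i (w ! k) * (nc_sum ?c (Suc ` {..<n} \<inter> {..<Suc k}) * nc_sum ?c (Suc ` {..<n} \<inter> {Suc k<..}))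
        = c i (w ! k) * (nc_moment c (take k w) * nc_moment c (drop (Suc k) w))"
      using 1 by simp
  qed
  finally show ?thesis by (simp add: n_def)
qed

section \<open>Integration by parts along lists of operators\<close>

text \<open>A \<^emph>\<open>marked operator\<close> \<open>(T, D)\<close> is an operator together with the bilinear form
  \<open>(a, b) \<mapsto> \<langle>\<beta>, a (\<partial>T) b\<rangle>\<close>, where \<open>\<partial>\<close> is a derivation into a tensor square and \<open>\<beta>\<close> a functional on
  it. Differentiating formal expressions in this way needs no free algebra, and applies equally
  to variables, to linear combinations of variables and to whole blocks of a product.\<close>

type_synonym 'h marked = "'h oper \<times> ('h oper \<Rightarrow> 'h oper \<Rightarrow> complex)"

abbreviation oprod :: "'h::complex_hilbert marked list \<Rightarrow> 'h oper" where
  "oprod L \<equiv> op_prod (map fst L)"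

text \<open>The form that belongs to the product of a list; \<open>a\<close> and \<open>b\<close> collect the factors to the left and to
  the right of the factor that is differentiated.\<close>

fun leibniz :: "'h::complex_hilbert marked list \<Rightarrow> 'h oper \<Rightarrow> 'h oper \<Rightarrow> complex" where
  "leibniz [] a b = 0"
| "leibniz (p # L) a b = snd p a (oprod L o\<^sub>L b) + leibniz L (a o\<^sub>L fst p) b"

lemma leibniz_append:
  "leibniz (L @ L') a b = leibniz L a (oprod L' o\<^sub>L b) + leibniz L' (a o\<^sub>L oprod L) b"
  by (induction L arbitrary: a) (simp_all add: op_prod_append comp_assoc_blinfun)

lemma leibniz_sum: "leibniz L a b
    = (\<Sum>k<length L. snd (L ! k) (a o\<^sub>L oprod (take k L)) (oprod (drop (Suc k) L) o\<^sub>L b))"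
  by (induction L arbitrary: a)
    (simp_all add: sum.lessThan_Suc_shift comp_assoc_blinfun del: sum.lessThan_Suc)

definition mmult :: "'h::complex_hilbert marked \<Rightarrow> 'h marked \<Rightarrow> 'h marked" where
  "mmult p q = (fst p o\<^sub>L fst q, \<lambda>a b. snd p a (fst q o\<^sub>L b) + snd q (a o\<^sub>L fst p) b)"

definition madd :: "'h::complex_hilbert marked \<Rightarrow> 'h marked \<Rightarrow> 'h marked" where
  "madd p q = (fst p + fst q, \<lambda>a b. snd p a b + snd q a b)"

definition mscale :: "complex \<Rightarrow> 'h::complex_hilbert marked \<Rightarrow> 'h marked" where
  "mscale c p = (op_scaleC c (fst p), \<lambda>a b. c * snd p a b)"

definition mone :: "'h::complex_hilbert marked" where
  "mone = (id_blinfun, \<lambda>a b. 0)"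

text \<open>The algebra generated by marked operators. Its elements serve both as blocks of a word and as new
  variables.\<close>

inductive_set malg :: "'h::complex_hilbert marked set \<Rightarrow> 'h marked set" for G where
  malg_one: "mone \<in> malg G"
| malg_gen: "p \<in> G \<Longrightarrow> p \<in> malg G"
| malg_mult: "p \<in> malg G \<Longrightarrow> q \<in> malg G \<Longrightarrow> mmult p q \<in> malg G"
| malg_add: "p \<in> malg G \<Longrightarrow> q \<in> malg G \<Longrightarrow> madd p q \<in> malg G"
| malg_scale: "p \<in> malg G \<Longrightarrow> mscale c p \<in> malg G"

lemma malg_zero_form:
  assumes "p \<in> malg G" "\<And>p a b. p \<in> G \<Longrightarrow> snd p a b = 0"
  shows "snd p a b = 0"
  using assms(1)
  by (induction arbitrary: a b) (simp_all add: assms(2) mone_def mmult_def madd_def mscale_def)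

lemma not_successively_split:
  assumes "\<not> successively P xs"
  obtains ys x y zs where "xs = ys @ x # y # zs" "\<not> P x y"
proof -
  have "\<exists>ys x y zs. xs = ys @ x # y # zs \<and> \<not> P x y"
    using assms
  proof (induction P xs rule: successively.induct)
    case (3 P x y xs)
    show ?case
    proof (cases "P x y")
      case True
      then obtain ys u v zs where "y # xs = ys @ u # v # zs" "\<not> P u v" using 3 by auto
      then have "x # y # xs = (x # ys) @ u # v # zs \<and> \<not> P u v" by simp
      then show ?thesis by blast
    next
      case False
      then have "x # y # xs = [] @ x # y # xs \<and> \<not> P x y" by simp
      then show ?thesis by blast
    qed
  qed simp_all
  then show thesis using that by blast
qed

context tracial_space
begin

definition bilin :: "('h oper \<Rightarrow> 'h oper \<Rightarrow> complex) \<Rightarrow> bool" where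
  "bilin D \<longleftrightarrow> (\<forall>a\<in>M. \<forall>a'\<in>M. \<forall>b\<in>M. \<forall>c. D (a + a') b = D a b + D a' b \<and> D b (a + a') = D b a + D b a' \<and>
      D (op_scaleC c a) b = c * D a b \<and> D b (op_scaleC c a) = c * D b a)"

definition valid :: "'h marked \<Rightarrow> bool" where
  "valid p \<longleftrightarrow> fst p \<in> M \<and> bilin (snd p)"

lemma bilinD:
  assumes "bilin D" "a \<in> M" "b \<in> M"
  shows "a' \<in> M \<Longrightarrow> D (a + a') b = D a b + D a' b" "a' \<in> M \<Longrightarrow> D b (a + a') = D b a + D b a'"
    "D (op_scaleC c a) b = c * D a b" "D b (op_scaleC c a) = c * D b a"
  using assms unfolding bilin_def by blast+

lemma bilinI:
  assumes "\<And>a a' b. a \<in> M \<Longrightarrow> a' \<in> M \<Longrightarrow> b \<in> M \<Longrightarrow> D (a + a') b = D a b + D a' b"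
    "\<And>a a' b. a \<in> M \<Longrightarrow> a' \<in> M \<Longrightarrow> b \<in> M \<Longrightarrow> D b (a + a') = D b a + D b a'"
    "\<And>a b c. a \<in> M \<Longrightarrow> b \<in> M \<Longrightarrow> D (op_scaleC c a) b = c * D a b"
    "\<And>a b c. a \<in> M \<Longrightarrow> b \<in> M \<Longrightarrow> D b (op_scaleC c a) = c * D b a"
  shows "bilin D"
  unfolding bilin_def using assms by blast

lemma bilin_tau_tau: "bilin (\<lambda>a b. c * \<tau> a * \<tau> b)"
  by (rule bilinI) (simp_all add: tau_add tau_sc algebra_simps)

lemma bilin_zero: "bilin (\<lambda>a b. 0)"
  by (rule bilinI) simp_all

lemma oprod_M: "(\<And>p. p \<in> set L \<Longrightarrow> valid p) \<Longrightarrow> oprod L \<in> M"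
  by (induction L) (auto simp: M_closed valid_def)

lemma bilin_leibniz: "(\<And>p. p \<in> set L \<Longrightarrow> valid p) \<Longrightarrow> bilin (leibniz L)"
proof (induction L)
  case Nil
  then show ?case by (simp add: bilin_def)
next
  case (Cons p L)
  have p: "fst p \<in> M" "bilin (snd p)" and L: "bilin (leibniz L)" "oprod L \<in> M"
    using Cons by (auto simp: valid_def oprod_M)
  show ?case
  proof (rule bilinI)
    fix a a' b c assume M: "a \<in> M" "b \<in> M"
    show "leibniz (p # L) (op_scaleC c a) b = c * leibniz (p # L) a b"
      using p L M by (simp add: op_scaleC_comp_left bilinD M_closed algebra_simps)
    show "leibniz (p # L) b (op_scaleC c a) = c * leibniz (p # L) b a"
      using p L M by (simp add: op_scaleC_comp_right bilinD M_closed M_bounded algebra_simps)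
    assume M': "a' \<in> M"
    show "leibniz (p # L) (a + a') b = leibniz (p # L) a b + leibniz (p # L) a' b"
      using p L M M' by (simp add: comp_add_left bilinD M_closed)
    show "leibniz (p # L) b (a + a') = leibniz (p # L) b a + leibniz (p # L) b a'"
      using p L M M' by (simp add: comp_add_right bilinD M_closed)
  qed
qed

lemma valid_mult: "valid p \<Longrightarrow> valid q \<Longrightarrow> valid (mmult p q)"
proof -
  assume v: "valid p" "valid q"
  have "leibniz [p, q] = snd (mmult p q)" by (intro ext) (simp add: mmult_def)
  moreover have "bilin (leibniz [p, q])" by (rule bilin_leibniz) (use v in auto)
  ultimately show ?thesis using v by (simp add: valid_def mmult_def M_closed)
qed

lemma valid_add: "valid p \<Longrightarrow> valid q \<Longrightarrow> valid (madd p q)"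
  unfolding valid_def madd_def fst_conv snd_conv
  by (intro conjI bilinI) (simp_all add: M_closed bilinD algebra_simps)

lemma valid_scale: "valid p \<Longrightarrow> valid (mscale c p)"
  unfolding valid_def mscale_def fst_conv snd_conv
  by (intro conjI bilinI) (simp_all add: M_closed bilinD algebra_simps)

lemma valid_one: "valid mone"
  by (simp add: valid_def mone_def M_id bilin_zero)

lemma valid_malg: "p \<in> malg G \<Longrightarrow> (\<And>p. p \<in> G \<Longrightarrow> valid p) \<Longrightarrow> valid p"
  by (induction rule: malg.induct) (simp_all add: valid_one valid_mult valid_add valid_scale)

text \<open>The defect of the integration-by-parts identity
  \<open>\<tau>(\<theta> T\<^sub>1 \<cdots> T\<^sub>n) = \<Sum>\<^sub>k D\<^sub>k(T\<^sub>1 \<cdots> T\<^sub>k\<^sub>-\<^sub>1, T\<^sub>k\<^sub>+\<^sub>1 \<cdots> T\<^sub>n)\<close>. It is multilinear in the entries of the list and does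
  not change when neighbours are multiplied.\<close>

definition defect :: "'h oper \<Rightarrow> 'h marked list \<Rightarrow> complex" where
  "defect \<theta> L = \<tau> (\<theta> o\<^sub>L oprod L) - leibniz L id_blinfun id_blinfun"

lemma defect_mult: "defect \<theta> (L @ mmult p q # L') = defect \<theta> (L @ p # q # L')"
  by (simp add: defect_def leibniz_append mmult_def op_prod_append comp_assoc_blinfun)

lemma defect_one: "defect \<theta> (L @ mone # L') = defect \<theta> (L @ L')"
  by (simp add: defect_def leibniz_append mone_def op_prod_append)

lemma defect_add:
  assumes "\<theta> \<in> M" "\<And>p. p \<in> set L \<Longrightarrow> valid p" "\<And>p. p \<in> set L' \<Longrightarrow> valid p" "valid p" "valid q"
  shows "defect \<theta> (L @ madd p q # L') = defect \<theta> (L @ p # L') + defect \<theta> (L @ q # L')"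
proof -
  have M: "oprod L \<in> M" "oprod L' \<in> M" "fst p \<in> M" "fst q \<in> M"
    and B: "bilin (leibniz L)" "bilin (leibniz L')" "bilin (snd p)" "bilin (snd q)"
    using assms by (auto simp: oprod_M bilin_leibniz valid_def)
  show ?thesis
    using M B assms(1)
    by (simp add: defect_def leibniz_append madd_def op_prod_append comp_add_left comp_add_right
        tau_add M_closed bilinD algebra_simps)
qed

lemma defect_scale:
  assumes "\<theta> \<in> M" "\<And>p. p \<in> set L \<Longrightarrow> valid p" "\<And>p. p \<in> set L' \<Longrightarrow> valid p" "valid p"
  shows "defect \<theta> (L @ mscale c p # L') = c * defect \<theta> (L @ p # L')"
proof -
  have M: "oprod L \<in> M" "oprod L' \<in> M" "fst p \<in> M"
    and B: "bilin (leibniz L)" "bilin (leibniz L')" "bilin (snd p)"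
    using assms by (auto simp: oprod_M bilin_leibniz valid_def)
  show ?thesis
    using M B assms(1)
    by (simp add: defect_def leibniz_append mscale_def op_prod_append op_scaleC_comp_left
        op_scaleC_comp_right tau_sc M_closed M_bounded bilinD algebra_simps)
qed

text \<open>The identity passes from words in generators to words in elements of the generated algebra.
  This is the chain rule: the generators may be replaced by polynomials in them.\<close>

lemma defect_malg:
  assumes \<theta>: "\<theta> \<in> M" and G: "\<And>p. p \<in> G \<Longrightarrow> valid p"
    and zero: "\<And>L. set L \<subseteq> G \<Longrightarrow> defect \<theta> L = 0"
    and L: "set L \<subseteq> malg G"
  shows "defect \<theta> L = 0"
proof -
  \<comment> \<open>The prefix \<open>L1\<close> has been replaced already; what follows it is still a word in generators.\<close>
  define good where "good L1 \<longleftrightarrow> (\<forall>L. set L \<subseteq> G \<longrightarrow> defect \<theta> (L1 @ L) = 0)" for L1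
  have step: "good (L1 @ [p])" if "p \<in> malg G" "good L1" "\<forall>q\<in>set L1. valid q" for p L1
    using that
  proof (induction arbitrary: L1 rule: malg.induct)
    case malg_one
    then show ?case by (simp add: good_def defect_one)
  next
    case (malg_gen p)
    then show ?case by (simp add: good_def)
  next
    case (malg_mult p q)
    have "good (L1 @ [p])" using malg_mult by blast
    moreover have "\<forall>q\<in>set (L1 @ [p]). valid q" using malg_mult G valid_malg by auto
    ultimately have "good ((L1 @ [p]) @ [q])" using malg_mult.IH(2) by blast
    then show ?case by (simp add: good_def defect_mult)
  next
    case (malg_add p q)
    have "good (L1 @ [p])" "good (L1 @ [q])" using malg_add by blast+
    moreover have "valid p" "valid q" using malg_add G valid_malg by blast+
    ultimately have eq: "defect \<theta> (L1 @ madd p q # L) = defect \<theta> (L1 @ p # L) + defect \<theta> (L1 @ q # L)"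
      if "set L \<subseteq> G" for L
      using malg_add.prems(2) G that by (intro defect_add[OF \<theta>]) blast+
    show ?case
      using \<open>good (L1 @ [p])\<close> \<open>good (L1 @ [q])\<close> by (simp add: good_def eq)
  next
    case (malg_scale p c)
    have "good (L1 @ [p])" using malg_scale by blast
    moreover have "valid p" using malg_scale G valid_malg by blast
    ultimately have eq: "defect \<theta> (L1 @ mscale c p # L) = c * defect \<theta> (L1 @ p # L)"
      if "set L \<subseteq> G" for L
      using malg_scale.prems(2) G that by (intro defect_scale[OF \<theta>]) blast+
    show ?case using \<open>good (L1 @ [p])\<close> by (simp add: good_def eq)
  qed
  have "good L" using L
  proof (induction L rule: rev_induct)
    case Nil
    then show ?case using zero by (simp add: good_def)
  next
    case (snoc p L)
    then have "\<forall>q\<in>set L. valid q" using G valid_malg by auto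
    then show ?case using step snoc by simp
  qed
  then have "set [] \<subseteq> G \<longrightarrow> defect \<theta> (L @ []) = 0" unfolding good_def by blast
  then show ?thesis by simp
qed


section \<open>Freeness and integration by parts\<close>

definition subalg :: "'h oper set \<Rightarrow> bool" where
  "subalg A \<longleftrightarrow> A \<subseteq> M \<and> id_blinfun \<in> A \<and> (\<forall>a\<in>A. \<forall>b\<in>A. a + b \<in> A \<and> a o\<^sub>L b \<in> A) \<and>
     (\<forall>c. \<forall>a\<in>A. op_scaleC c a \<in> A)"

lemma subalgD:
  assumes "subalg A"
  shows "A \<subseteq> M" "a \<in> A \<Longrightarrow> a \<in> M" "id_blinfun \<in> A" "a \<in> A \<Longrightarrow> b \<in> A \<Longrightarrow> a + b \<in> A"
    "a \<in> A \<Longrightarrow> b \<in> A \<Longrightarrow> a o\<^sub>L b \<in> A" "a \<in> A \<Longrightarrow> op_scaleC c a \<in> A"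
  using assms by (auto simp: subalg_def)

definition alternating :: "'h oper set \<Rightarrow> 'h oper set \<Rightarrow> (bool \<times> 'h oper) list \<Rightarrow> bool" where
  "alternating A B fs \<longleftrightarrow> (\<forall>(s, a)\<in>set fs. a \<in> (if s then A else B) \<and> \<tau> a = 0) \<and>
     successively (\<lambda>f g. fst f \<noteq> fst g) fs"

definition free_algs :: "'h oper set \<Rightarrow> 'h oper set \<Rightarrow> bool" where
  "free_algs A B \<longleftrightarrow> (\<forall>fs. fs \<noteq> [] \<longrightarrow> alternating A B fs \<longrightarrow> \<tau> (op_prod (map snd fs)) = 0)"

lemma free_algs_sym: assumes "free_algs A B" shows "free_algs B A"
  unfolding free_algs_def
proof (intro allI impI)
  fix fs assume "fs \<noteq> []" and alt: "alternating B A fs"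
  let ?g = "map (map_prod Not id) fs"
  have "alternating A B ?g"
    using alt by (auto simp: alternating_def successively_map split: if_splits)
  moreover have "map snd ?g = map snd fs" by simp
  ultimately show "\<tau> (op_prod (map snd fs)) = 0"
    using assms \<open>fs \<noteq> []\<close> unfolding free_algs_def by (metis map_is_Nil_conv)
qed

lemma alternating_M: "subalg A \<Longrightarrow> subalg B \<Longrightarrow> alternating A B fs \<Longrightarrow> op_prod (map snd fs) \<in> M"
  by (induction fs)
    (auto simp: alternating_def M_id successively_Cons split: if_splits intro!: M_comp dest: subalgD(2))

text \<open>An alternating centred product that meets \<open>B\<close> stays null when it is multiplied by elements
  of \<open>A\<close>: by traciality the outer factors merge into a single one, which is centred and absorbed.\<close>

lemma alternating_null:
  assumes A: "subalg A" and B: "subalg B" and free: "free_algs A B"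
    and alt: "alternating A B fs" and meets: "\<exists>f\<in>set fs. \<not> fst f"
    and u: "u \<in> A" and v: "v \<in> A"
  shows "\<tau> (u o\<^sub>L (op_prod (map snd fs) o\<^sub>L v)) = 0"
proof -
  have absorb: "\<tau> (x o\<^sub>L op_prod (map snd gs)) = 0"
    if x: "x \<in> A" and gs: "alternating A B gs" "gs \<noteq> []" "\<not> fst (hd gs)" for x gs
  proof -
    define x0 where "x0 = x + op_scaleC (- \<tau> x) id_blinfun"
    have xM: "x \<in> M" using subalgD(2)[OF A x] .
    have x0: "x0 \<in> A" unfolding x0_def
      by (rule subalgD(4)[OF A x subalgD(6)[OF A subalgD(3)[OF A]]])
    have x0M: "x0 \<in> M" using subalgD(2)[OF A x0] .
    have gM: "op_prod (map snd gs) \<in> M" using alternating_M[OF A B gs(1)] .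
    have t0: "\<tau> x0 = 0" using xM by (simp add: x0_def tau_add tau_sc tau_id M_closed)
    have "x = x0 + op_scaleC (\<tau> x) id_blinfun"
      using op_scaleC_add_left[of "\<tau> x" "- \<tau> x" id_blinfun] by (simp add: x0_def add.assoc add.commute)
    then have "\<tau> (x o\<^sub>L op_prod (map snd gs))
        = \<tau> ((x0 o\<^sub>L op_prod (map snd gs)) + op_scaleC (\<tau> x) (op_prod (map snd gs)))"
      by (metis comp_add_left op_scaleC_comp_left comp_id_left)
    also have "\<dots> = \<tau> (x0 o\<^sub>L op_prod (map snd gs)) + \<tau> x * \<tau> (op_prod (map snd gs))"
      using x0M gM by (simp add: tau_add tau_sc M_closed)
    also have "\<tau> (op_prod (map snd gs)) = 0"
      using free gs unfolding free_algs_def by blast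
    also have "\<tau> (x0 o\<^sub>L op_prod (map snd gs)) = 0"
    proof -
      have "alternating A B ((True, x0) # gs)"
        using gs x0 t0 by (auto simp: alternating_def successively_Cons)
      then have "\<tau> (op_prod (map snd ((True, x0) # gs))) = 0"
        using free unfolding free_algs_def by blast
      then show ?thesis by simp
    qed
    finally show ?thesis by simp
  qed
  have pM: "op_prod (map snd fs) \<in> M" using alternating_M[OF A B alt] .
  have uvM: "u \<in> M" "v \<in> M" using subalgD(2)[OF A u] subalgD(2)[OF A v] .
  have "\<tau> (u o\<^sub>L (op_prod (map snd fs) o\<^sub>L v)) = \<tau> ((u o\<^sub>L op_prod (map snd fs)) o\<^sub>L v)"
    by (simp add: comp_assoc_blinfun)
  also have "\<dots> = \<tau> ((v o\<^sub>L u) o\<^sub>L op_prod (map snd fs))"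
    using tau_comm[of "u o\<^sub>L op_prod (map snd fs)" v] pM uvM by (simp add: comp_assoc_blinfun M_closed)
  also have "\<dots> = 0"
  proof -
    have vu: "v o\<^sub>L u \<in> A" by (rule subalgD(5)[OF A v u])
    obtain f gs where fs: "fs = f # gs" using meets by (cases fs) auto
    show ?thesis
    proof (cases "fst f")
      case False
      then show ?thesis using absorb[OF vu alt] fs by simp
    next
      case True
      have gs: "alternating A B gs" "gs \<noteq> []" "\<not> fst (hd gs)"
        using alt meets True fs by (auto simp: alternating_def successively_Cons)
      have "snd f \<in> A" using alt True fs by (cases f) (auto simp: alternating_def)
      then have "(v o\<^sub>L u) o\<^sub>L snd f \<in> A" by (rule subalgD(5)[OF A vu])
      from absorb[OF this gs] show ?thesis by (simp add: fs comp_assoc_blinfun)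
    qed
  qed
  finally show ?thesis .
qed

text \<open>Since \<open>\<tau>(u a v) = \<tau>(v u a)\<close>, being null means that the conditional expectation onto \<open>A\<close> vanishes. A
  null form sees its arguments only through that expectation.\<close>

definition null_wrt :: "'h oper set \<Rightarrow> 'h oper \<Rightarrow> bool" where
  "null_wrt A a \<longleftrightarrow> a \<in> M \<and> (\<forall>u\<in>A. \<forall>v\<in>A. \<tau> (u o\<^sub>L (a o\<^sub>L v)) = 0)"

definition null_form :: "'h oper set \<Rightarrow> ('h oper \<Rightarrow> 'h oper \<Rightarrow> complex) \<Rightarrow> bool" where
  "null_form A D \<longleftrightarrow> (\<forall>a\<in>M. \<forall>b\<in>M. null_wrt A a \<or> null_wrt A b \<longrightarrow> D a b = 0)"

lemma malg_null_form:
  assumes A: "subalg A" and p: "p \<in> malg G"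
    and G: "\<And>p. p \<in> G \<Longrightarrow> valid p \<and> fst p \<in> A \<and> null_form A (snd p)"
  shows "fst p \<in> A \<and> null_form A (snd p)"
  using p
proof (induction rule: malg.induct)
  case malg_one
  then show ?case using subalgD[OF A] by (simp add: mone_def null_form_def)
next
  case (malg_gen p)
  then show ?case using G by blast
next
  case (malg_mult p q)
  have pA: "fst p \<in> A" "fst q \<in> A" using malg_mult by blast+
  then have pM: "fst p \<in> M" "fst q \<in> M" using A subalgD by blast+
  have "null_form A (\<lambda>a b. snd p a (fst q o\<^sub>L b) + snd q (a o\<^sub>L fst p) b)"
    unfolding null_form_def
  proof (intro ballI impI)
    fix a b assume ab: "a \<in> M" "b \<in> M" and n: "null_wrt A a \<or> null_wrt A b"
    have "null_wrt A (fst q o\<^sub>L b)" if b: "null_wrt A b"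
      unfolding null_wrt_def
    proof (intro conjI ballI)
      fix u v assume uv: "u \<in> A" "v \<in> A"
      have "u o\<^sub>L ((fst q o\<^sub>L b) o\<^sub>L v) = (u o\<^sub>L fst q) o\<^sub>L (b o\<^sub>L v)"
        by (simp add: comp_assoc_blinfun)
      then show "\<tau> (u o\<^sub>L ((fst q o\<^sub>L b) o\<^sub>L v)) = 0"
        using b uv pA(2) subalgD(5)[OF A] by (simp add: null_wrt_def)
    qed (simp add: pM ab M_comp)
    moreover have "null_wrt A (a o\<^sub>L fst p)" if a: "null_wrt A a"
      unfolding null_wrt_def
    proof (intro conjI ballI)
      fix u v assume uv: "u \<in> A" "v \<in> A"
      have "u o\<^sub>L ((a o\<^sub>L fst p) o\<^sub>L v) = u o\<^sub>L (a o\<^sub>L (fst p o\<^sub>L v))"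
        by (simp add: comp_assoc_blinfun)
      then show "\<tau> (u o\<^sub>L ((a o\<^sub>L fst p) o\<^sub>L v)) = 0"
        using a uv pA(1) subalgD(5)[OF A] by (simp add: null_wrt_def)
    qed (simp add: pM ab M_comp)
    ultimately show "snd p a (fst q o\<^sub>L b) + snd q (a o\<^sub>L fst p) b = 0"
      using malg_mult.IH n ab pM unfolding null_form_def by (metis M_comp add_0)
  qed
  then show ?case using pA subalgD[OF A] by (simp add: mmult_def)
next
  case (malg_add p q)
  then show ?case using subalgD[OF A] by (auto simp: madd_def null_form_def)
next
  case (malg_scale p c)
  then show ?case using subalgD[OF A] by (auto simp: mscale_def null_form_def)
qed

text \<open>Centring argument: a multilinear expression that is compatible with multiplication of
  neighbours vanishes as soon as it vanishes on alternating lists of centred elements.\<close>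

lemma defect_alternating:
  assumes \<theta>: "\<theta> \<in> M" and GA: "\<And>p. p \<in> GA \<union> GB \<Longrightarrow> valid p"
    and zero: "\<And>L :: (bool \<times> 'h marked) list.
      (\<forall>(s, p)\<in>set L. p \<in> (if s then malg GA else malg GB) \<and> \<tau> (fst p) = 0) \<Longrightarrow>
      successively (\<lambda>f g. fst f \<noteq> fst g) L \<Longrightarrow> defect \<theta> (map snd L) = 0"
    and L: "\<forall>(s, p)\<in>set L. p \<in> (if s then malg GA else malg GB)"
  shows "defect \<theta> (map snd L) = 0"
  using L
  \<comment> \<open>Multiplying two centred neighbours can produce an entry that is not centred, so a loss of length
      has to count more than a centring.\<close>
proof (induction "2 * length L + length (filter (\<lambda>(s, p). \<tau> (fst p) \<noteq> 0) L)" arbitrary: L rule: less_induct)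
  case less
  let ?nc = "\<lambda>(s, p). \<tau> (fst p) \<noteq> (0::complex)"
  let ?P = "\<lambda>f g :: bool \<times> 'h marked. fst f \<noteq> fst g"
  have val: "valid p" if "(s, p) \<in> set L" for s p
    using less.prems that GA valid_malg[of p GA] valid_malg[of p GB] by (auto split: if_splits)
  show ?case
  proof (cases "successively ?P L")
    case False
    obtain L1 x y L2 where L: "L = L1 @ x # y # L2" and "\<not> ?P x y"
      by (rule not_successively_split[OF False])
    then have eq: "fst x = fst y" by simp
    define L' where "L' = L1 @ (fst x, mmult (snd x) (snd y)) # L2"
    have "defect \<theta> (map snd L') = 0"
    proof (rule less.hyps)
      show "2 * length L' + length (filter ?nc L') < 2 * length L + length (filter ?nc L)"
        by (auto simp: L'_def L case_prod_unfold)
      have "snd x \<in> (if fst x then malg GA else malg GB)" "snd y \<in> (if fst x then malg GA else malg GB)"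
        using less.prems eq by (auto simp: L case_prod_unfold)
      then have "mmult (snd x) (snd y) \<in> (if fst x then malg GA else malg GB)"
        by (auto intro: malg_mult split: if_splits)
      then show "\<forall>(s, p)\<in>set L'. p \<in> (if s then malg GA else malg GB)"
        using less.prems by (auto simp: L'_def L)
    qed
    then show ?thesis by (simp add: L'_def L defect_mult)
  next
    case True
    show ?thesis
    proof (cases "filter ?nc L = []")
      case True
      then have "\<forall>(s, p)\<in>set L. p \<in> (if s then malg GA else malg GB) \<and> \<tau> (fst p) = 0"
        using less.prems by (auto simp: filter_empty_conv)
      then show ?thesis using zero \<open>successively ?P L\<close> by blast
    next
      case False
      then obtain s p where sp: "(s, p) \<in> set L" "\<tau> (fst p) \<noteq> 0" by (auto simp: filter_empty_conv)
      then obtain L1 L2 where L: "L = L1 @ (s, p) # L2" by (meson split_list)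
      define p0 where "p0 = madd p (mscale (- \<tau> (fst p)) mone)"
      have vp: "valid p" using val sp by blast
      then have pM: "fst p \<in> M" by (simp add: valid_def)
      have vL: "valid q" if q: "q \<in> set (map snd L1) \<or> q \<in> set (map snd L2)" for q
      proof -
        obtain z where "z \<in> set L1 \<union> set L2" "q = snd z" using q by auto
        then have "(fst z, q) \<in> set L" by (auto simp: L)
        then show ?thesis by (rule val)
      qed
      have pA: "p \<in> (if s then malg GA else malg GB)" using less.prems sp by auto
      have "defect \<theta> (map snd (L1 @ (s, p0) # L2)) = 0"
      proof (rule less.hyps)
        have "\<tau> (fst p0) = 0"
          using pM by (simp add: p0_def madd_def mscale_def mone_def tau_add tau_sc tau_id M_closed)
        then show "2 * length (L1 @ (s, p0) # L2) + length (filter ?nc (L1 @ (s, p0) # L2))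
            < 2 * length L + length (filter ?nc L)"
          using sp by (simp add: L)
        have "p0 \<in> (if s then malg GA else malg GB)"
          using pA unfolding p0_def by (auto intro: malg_add malg_scale malg_one split: if_splits)
        then show "\<forall>(s, p)\<in>set (L1 @ (s, p0) # L2). p \<in> (if s then malg GA else malg GB)"
          using less.prems by (auto simp: L)
      qed
      moreover have "defect \<theta> (map snd (L1 @ L2)) = 0"
      proof (rule less.hyps)
        show "2 * length (L1 @ L2) + length (filter ?nc (L1 @ L2)) < 2 * length L + length (filter ?nc L)"
          by (simp add: L)
        show "\<forall>(s, p)\<in>set (L1 @ L2). p \<in> (if s then malg GA else malg GB)"
          using less.prems by (auto simp: L)
      qed
      moreover have "defect \<theta> (map snd (L1 @ (s, p0) # L2))
          = defect \<theta> (map snd L) + - \<tau> (fst p) * defect \<theta> (map snd (L1 @ L2))"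
      proof -
        let ?c = "mscale (- \<tau> (fst p)) mone"
        have vc: "valid ?c" by (intro valid_scale valid_one)
        have "defect \<theta> (map snd L1 @ madd p ?c # map snd L2)
            = defect \<theta> (map snd L1 @ p # map snd L2) + defect \<theta> (map snd L1 @ ?c # map snd L2)"
          using vL vp vc by (intro defect_add[OF \<theta>]) blast+
        also have "defect \<theta> (map snd L1 @ ?c # map snd L2)
            = - \<tau> (fst p) * defect \<theta> (map snd L1 @ mone # map snd L2)"
          using vL valid_one by (intro defect_scale[OF \<theta>]) blast+
        finally show ?thesis by (simp add: p0_def L defect_one)
      qed
      ultimately show ?thesis by simp
    qed
  qed
qed

text \<open>The main consequence of freeness. If integration by parts holds inside \<open>A\<close> for the derivation
  that differentiates the generators of \<open>A\<close>, then it holds for all words in the generators of \<open>A\<close> and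
  of a free algebra \<open>B\<close>, for the derivation that in addition kills \<open>B\<close>. On an alternating centred
  word other than a single element of \<open>A\<close> both sides vanish: the left one by freeness, and each term
  of the right one since a nonempty piece next to the differentiated factor is null.\<close>

theorem free_integration_by_parts:
  assumes A: "subalg A" and B: "subalg B" and free: "free_algs A B"
    and \<theta>: "\<theta> \<in> A" "\<tau> \<theta> = 0"
    and GA: "\<And>p. p \<in> GA \<Longrightarrow> valid p \<and> fst p \<in> A \<and> null_form A (snd p)"
    and GB: "\<And>p. p \<in> GB \<Longrightarrow> fst p \<in> B \<and> snd p = (\<lambda>a b. 0)"
    and zero: "\<And>L. set L \<subseteq> GA \<Longrightarrow> defect \<theta> L = 0"
    and L: "set L \<subseteq> malg (GA \<union> GB)"
  shows "defect \<theta> L = 0"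
proof -
  have \<theta>M: "\<theta> \<in> M" using subalgD(2)[OF A \<theta>(1)] .
  have valB: "valid p" if "p \<in> GB" for p
    using GB[OF that] subalgD[OF B] by (simp add: valid_def bilin_zero)
  have val: "valid p" if "p \<in> GA \<union> GB" for p using that GA valB by blast
  have memA: "fst p \<in> A \<and> null_form A (snd p)" if "p \<in> malg GA" for p
    using malg_null_form[OF A that GA] .
  have memB: "fst p \<in> B" if "p \<in> malg GB" for p
    using malg_null_form[OF B that, THEN conjunct1] GB valB by (simp add: null_form_def)
  have formB: "snd p a b = 0" if "p \<in> malg GB" for p a b
    using malg_zero_form[OF that] GB by simp
  have alt_zero: "defect \<theta> (map snd L) = 0"
    if mem: "\<forall>(s, p)\<in>set L. p \<in> (if s then malg GA else malg GB) \<and> \<tau> (fst p) = 0"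
      and succ: "successively (\<lambda>f g. fst f \<noteq> fst g) L"
    for L :: "(bool \<times> 'h marked) list"
  proof (cases "\<exists>f\<in>set L. \<not> fst f")
    case False
    have "set (map snd L) \<subseteq> malg GA"
    proof
      fix p assume "p \<in> set (map snd L)"
      then obtain z where "z \<in> set L" "p = snd z" by auto
      then show "p \<in> malg GA" using bspec[OF mem, of z] False by (simp add: case_prod_unfold)
    qed
    show ?thesis
      by (rule defect_malg[OF \<theta>M _ zero \<open>set (map snd L) \<subseteq> malg GA\<close>]) (simp_all add: GA)
  next
    case True
    have alt: "alternating A B (map (\<lambda>(s, p). (s, fst p)) L')" if "set L' \<subseteq> set L"
      "successively (\<lambda>f g. fst f \<noteq> fst g) L'" for L'
      unfolding alternating_def
    proof
      show "\<forall>(s, a)\<in>set (map (\<lambda>(s, p). (s, fst p)) L'). a \<in> (if s then A else B) \<and> \<tau> a = 0"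
      proof
        fix x assume "x \<in> set (map (\<lambda>(s, p). (s, fst p)) L')"
        then obtain s p where sp: "(s, p) \<in> set L'" "x = (s, fst p)" by auto
        then have "(s, p) \<in> set L" using that(1) by blast
        from bspec[OF mem this] have "p \<in> (if s then malg GA else malg GB)" "\<tau> (fst p) = 0"
          by simp_all
        then show "case x of (s, a) \<Rightarrow> a \<in> (if s then A else B) \<and> \<tau> a = 0"
          using memA[of p] memB[of p] sp(2) by (cases s) simp_all
      qed
      show "successively (\<lambda>f g. fst f \<noteq> fst g) (map (\<lambda>(s, p). (s, fst p)) L')"
        using that(2) by (simp add: successively_map case_prod_unfold)
    qed
    have snd_map: "map snd (map (\<lambda>(s, p). (s, fst p)) L') = map fst (map snd L')"
      for L' :: "(bool \<times> 'h marked) list" by (simp add: case_prod_unfold)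
    have null: "\<tau> (u o\<^sub>L (oprod (map snd L') o\<^sub>L v)) = 0"
      if "set L' \<subseteq> set L" "successively (\<lambda>f g. fst f \<noteq> fst g) L'" "\<exists>f\<in>set L'. \<not> fst f" "u \<in> A" "v \<in> A"
      for L' u v
      using alternating_null[OF A B free alt[OF that(1,2)] _ that(4,5)] that(3)
      unfolding snd_map by (simp add: case_prod_unfold)
    have pieceM: "oprod (map snd L') \<in> M" if sub: "set L' \<subseteq> set L" for L'
    proof (rule oprod_M)
      fix p assume "p \<in> set (map snd L')"
      then obtain z where "z \<in> set L" "p = snd z" using sub by auto
      then have "p \<in> malg GA \<or> p \<in> malg GB" using mem by (auto split: if_splits)
      then show "valid p" using valid_malg[of p GA] valid_malg[of p GB] val by blast
    qed
    have "leibniz (map snd L) id_blinfun id_blinfun = 0"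
      unfolding leibniz_sum
    proof (rule sum.neutral, rule ballI)
      fix k assume "k \<in> {..<length (map snd L)}"
      then have k: "k < length L" by simp
      define L1 where "L1 = take k L"
      define L2 where "L2 = drop (Suc k) L"
      define x where "x = L ! k"
      have xL: "x \<in> set L" unfolding x_def using nth_mem[OF k] .
      have L: "L = L1 @ x # L2" unfolding x_def using k by (simp add: L1_def L2_def id_take_nth_drop)
      have sub: "set L1 \<subseteq> set L" "set L2 \<subseteq> set L"
        by (simp_all add: L1_def L2_def set_take_subset set_drop_subset)
      have M12: "oprod (map snd L1) \<in> M" "oprod (map snd L2) \<in> M" using pieceM sub by blast+
      have "snd (snd x) (oprod (map snd L1)) (oprod (map snd L2)) = 0"
      proof (cases "fst x")
        case False
        then have "snd x \<in> malg GB" using mem xL by (cases x) auto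
        then show ?thesis by (rule formB)
      next
        case True
        then have "snd x \<in> malg GA" using mem xL by (cases x) auto
        then have nf: "null_form A (snd (snd x))" using memA by blast
        have s: "successively (\<lambda>f g. fst f \<noteq> fst g) (L1 @ x # L2)" using succ L by simp
        have s12: "successively (\<lambda>f g. fst f \<noteq> fst g) L1" "successively (\<lambda>f g. fst f \<noteq> fst g) L2"
            "L1 \<noteq> [] \<Longrightarrow> \<not> fst (last L1)" "L2 \<noteq> [] \<Longrightarrow> \<not> fst (hd L2)"
          using s True by (auto simp: successively_append_iff successively_Cons)
        have "L1 \<noteq> [] \<or> L2 \<noteq> []"
        proof (rule ccontr)
          assume "\<not> ?thesis"
          then have "set L = {x}" using arg_cong[OF L, of set] by simp
          then show False using \<open>\<exists>f\<in>set L. \<not> fst f\<close> True by auto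
        qed
        then have "null_wrt A (oprod (map snd L1)) \<or> null_wrt A (oprod (map snd L2))"
        proof
          assume "L1 \<noteq> []"
          then have "\<exists>f\<in>set L1. \<not> fst f" using s12(3) last_in_set by blast
          then have "null_wrt A (oprod (map snd L1))"
            unfolding null_wrt_def using M12(1) null[OF sub(1) s12(1)] by blast
          then show ?thesis ..
        next
          assume "L2 \<noteq> []"
          then have "\<exists>f\<in>set L2. \<not> fst f" using s12(4) hd_in_set by blast
          then have "null_wrt A (oprod (map snd L2))"
            unfolding null_wrt_def using M12(2) null[OF sub(2) s12(2)] by blast
          then show ?thesis ..
        qed
        then show ?thesis using nf M12 unfolding null_form_def by blast
      qed
      then show "snd (map snd L ! k) (id_blinfun o\<^sub>L oprod (take k (map snd L)))
          (oprod (drop (Suc k) (map snd L)) o\<^sub>L id_blinfun) = 0"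
        using k by (simp add: L1_def L2_def x_def take_map drop_map)
    qed
    moreover have "\<tau> (\<theta> o\<^sub>L oprod (map snd L)) = 0"
      using null[of L \<theta> id_blinfun] succ True \<theta> subalgD(3)[OF A] by simp
    ultimately show ?thesis by (simp add: defect_def)
  qed
  have gens: "defect \<theta> L = 0" if L: "set L \<subseteq> GA \<union> GB" for L
  proof -
    define L' where "L' = map (\<lambda>p. (p \<in> GA, p)) L"
    have "defect \<theta> (map snd L') = 0"
    proof (rule defect_alternating[OF \<theta>M val alt_zero])
      show "\<forall>(s, p)\<in>set L'. p \<in> (if s then malg GA else malg GB)"
        using L by (auto simp: L'_def intro: malg_gen)
    qed auto
    then show ?thesis by (simp add: L'_def o_def)
  qed
  show ?thesis by (rule defect_malg[OF \<theta>M val gens L])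
qed

end

section \<open>The functional calculus of a symmetric matrix\<close>

lemma inner_symmetric_matrix:
  fixes A :: "real^'n^'n::finite"
  assumes "transpose A = A" shows "x \<bullet> (A *v y) = (A *v x) \<bullet> y"
  using dot_lmul_matrix[of x A y] vector_transpose_matrix[of x A] assms by simp

text \<open>Outside the span of some eigenvectors there is another one: the maximum of the Rayleigh
  quotient over the orthogonal complement is attained at an eigenvector.\<close>

lemma symmetric_matrix_eigenvector:
  fixes A :: "real^'n^'n::finite"
  assumes sym: "transpose A = A"
    and B: "\<And>b. b \<in> B \<Longrightarrow> \<exists>\<mu>. A *v b = \<mu> *\<^sub>R b" and proper: "span B \<noteq> UNIV"
  obtains x \<mu> where "norm x = 1" "\<And>b. b \<in> B \<Longrightarrow> x \<bullet> b = 0" "A *v x = \<mu> *\<^sub>R x"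
proof -
  define V where "V = {x. \<forall>b\<in>B. x \<bullet> b = 0}"
  have subV: "subspace V" by (auto simp: V_def subspace_def inner_add_left)
  have "V = (\<Inter>b\<in>B. {x. x \<bullet> b = 0})" by (auto simp: V_def)
  moreover have "closed {x. x \<bullet> b = 0}" for b :: "real^'n"
    by (intro closed_Collect_eq continuous_intros)
  ultimately have closedV: "closed V" by (simp add: closed_INT)
  have AV: "A *v x \<in> V" if "x \<in> V" for x
  proof -
    have "(A *v x) \<bullet> b = 0" if b: "b \<in> B" for b
    proof -
      obtain \<mu> where "A *v b = \<mu> *\<^sub>R b" using B b by blast
      then show ?thesis
        using inner_symmetric_matrix[OF sym, of x b] \<open>x \<in> V\<close> b by (simp add: V_def)
    qed
    then show ?thesis by (simp add: V_def)
  qed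
  obtain a where a: "a \<noteq> 0" "\<forall>x\<in>span B. a \<bullet> x = 0"
    using span_not_UNIV_orthogonal[OF proper] by blast
  have aV: "a \<in> V" using a span_base by (auto simp: V_def)
  define K where "K = sphere 0 1 \<inter> V"
  have "compact K" unfolding K_def using closedV by (intro compact_Int_closed compact_sphere)
  moreover have "K \<noteq> {}"
  proof -
    have "a /\<^sub>R norm a \<in> K" using a aV subV by (auto simp: K_def subspace_scale)
    then show ?thesis by blast
  qed
  moreover have "continuous_on K (\<lambda>x. x \<bullet> (A *v x))"
    by (intro continuous_on_inner continuous_on_id linear_continuous_on matrix_vector_mul_bounded_linear)
  ultimately have "\<exists>x\<in>K. \<forall>y\<in>K. y \<bullet> (A *v y) \<le> x \<bullet> (A *v x)"
    by (rule continuous_attains_sup)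
  then obtain x where x: "x \<in> K" and max: "\<And>y. y \<in> K \<Longrightarrow> y \<bullet> (A *v y) \<le> x \<bullet> (A *v x)"
    by blast
  define l where "l = x \<bullet> (A *v x)"
  have xV: "x \<in> V" and nx: "norm x = 1" using x by (auto simp: K_def)
  have bound: "y \<bullet> (A *v y) \<le> l * (norm y)\<^sup>2" if y: "y \<in> V" for y
  proof (cases "y = 0")
    case False
    then have "y /\<^sub>R norm y \<in> K" using y subV by (auto simp: K_def subspace_scale)
    from max[OF this] have "(y \<bullet> (A *v y)) / (norm y)\<^sup>2 \<le> l"
      by (simp add: l_def matrix_vector_mult_scaleR divide_inverse power2_eq_square mult_ac)
    then show ?thesis using False by (simp add: divide_le_eq)
  qed simp
  define r where "r = A *v x - l *\<^sub>R x"
  have rV: "r \<in> V" unfolding r_def using AV xV subV by (intro subspace_diff subspace_scale)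
  have xx: "x \<bullet> x = 1" using nx by (simp add: dot_square_norm)
  have rx: "r \<bullet> x = 0"
  proof -
    have "r \<bullet> x = (A *v x) \<bullet> x - l * (x \<bullet> x)" by (simp add: r_def inner_diff_left)
    then show ?thesis by (simp add: xx l_def inner_commute[of x "A *v x"])
  qed
  have rA: "r \<bullet> (A *v x) = (norm r)\<^sup>2"
  proof -
    have "A *v x = r + l *\<^sub>R x" by (simp add: r_def)
    then show ?thesis using rx by (simp add: inner_add_right dot_square_norm)
  qed
  \<comment> \<open>First variation of the Rayleigh quotient in the direction of the residual \<open>r\<close>.\<close>
  define w where "w = l * (norm r)\<^sup>2 - r \<bullet> (A *v r)"
  have main: "2 * t * (norm r)\<^sup>2 \<le> t\<^sup>2 * w" for t :: real
  proof -
    have "x + t *\<^sub>R r \<in> V" using xV rV subV by (intro subspace_add subspace_scale)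
    from bound[OF this] have "(x + t *\<^sub>R r) \<bullet> (A *v (x + t *\<^sub>R r)) \<le> l * (norm (x + t *\<^sub>R r))\<^sup>2" .
    moreover have "(norm (x + t *\<^sub>R r))\<^sup>2 = 1 + t\<^sup>2 * (norm r)\<^sup>2"
    proof -
      have "(norm (x + t *\<^sub>R r))\<^sup>2 = (x + t *\<^sub>R r) \<bullet> (x + t *\<^sub>R r)" by (rule power2_norm_eq_inner)
      also have "\<dots> = x \<bullet> x + 2 * t * (r \<bullet> x) + t * t * (r \<bullet> r)"
        using inner_commute[of x r] by (simp add: inner_add_left inner_add_right algebra_simps)
      finally show ?thesis by (simp add: rx nx dot_square_norm power2_eq_square)
    qed
    moreover have "x \<bullet> (A *v r) = (norm r)\<^sup>2"
      using inner_symmetric_matrix[OF sym, of x r] rA by (simp add: inner_commute)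
    then have "(x + t *\<^sub>R r) \<bullet> (A *v (x + t *\<^sub>R r)) = l + 2 * t * (norm r)\<^sup>2 + t\<^sup>2 * (r \<bullet> (A *v r))"
      using rA by (simp add: matrix_vector_right_distrib matrix_vector_mult_scaleR inner_add_left
          inner_add_right l_def power2_eq_square algebra_simps)
    ultimately show ?thesis by (simp add: w_def algebra_simps)
  qed
  have "(norm r)\<^sup>2 \<le> 0"
  proof (rule ccontr)
    assume "\<not> ?thesis"
    then have pos: "(norm r)\<^sup>2 > 0" by simp
    define n where "n = (norm r)\<^sup>2"
    have "2 * n \<le> w" using main[of 1] by (simp add: n_def)
    then have w: "w > 0" using pos unfolding n_def by linarith
    have "2 * (n / w) * n \<le> (n / w)\<^sup>2 * w" using main[of "n / w"] by (simp add: n_def)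
    also have "(n / w)\<^sup>2 * w = n / w * n" using w by (simp add: power2_eq_square)
    finally have "n / w * n \<le> 0" by simp
    moreover have "n / w * n > 0" using w pos unfolding n_def by (intro mult_pos_pos divide_pos_pos)
    ultimately show False by linarith
  qed
  then have "A *v x = l *\<^sub>R x" by (simp add: r_def)
  moreover have "x \<bullet> b = 0" if "b \<in> B" for b using xV that by (simp add: V_def)
  ultimately show thesis using that[OF nx] by blast
qed

theorem symmetric_matrix_spectral:
  fixes A :: "real^'n^'n::finite"
  assumes sym: "transpose A = A"
  obtains u :: "'n \<Rightarrow> real^'n" and d :: "'n \<Rightarrow> real"
  where "\<And>a b. u a \<bullet> u b = (if a = b then 1 else 0)" "\<And>a. A *v u a = d a *\<^sub>R u a"
proof -
  have "\<exists>B :: (real^'n) set. finite B \<and> card B = k \<and> (\<forall>b\<in>B. norm b = 1 \<and> (\<exists>\<mu>. A *v b = \<mu> *\<^sub>R b))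
      \<and> pairwise orthogonal B" if "k \<le> CARD('n)" for k
    using that
  proof (induction k)
    case 0
    have "finite ({} :: (real^'n) set) \<and> card ({} :: (real^'n) set) = 0" by simp
    then show ?case by (intro exI[of _ "{}"]) simp
  next
    case (Suc k)
    then obtain B :: "(real^'n) set" where B: "finite B" "card B = k"
      "\<forall>b\<in>B. norm b = 1 \<and> (\<exists>\<mu>. A *v b = \<mu> *\<^sub>R b)" "pairwise orthogonal B" by auto
    have "span B \<noteq> UNIV"
    proof
      assume "span B = UNIV"
      then have "DIM(real^'n) \<le> card B" using B(1) by (metis dim_UNIV dim_le_card span_UNIV subset_UNIV dim_span)
      then show False using B(2) Suc.prems by simp
    qed
    then have "\<exists>x \<mu>. norm x = 1 \<and> (\<forall>b\<in>B. x \<bullet> b = 0) \<and> A *v x = \<mu> *\<^sub>R x"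
      by (rule symmetric_matrix_eigenvector[OF sym, rotated]) (use B(3) in blast)+
    then obtain x \<mu> where x: "norm x = 1" "\<And>b. b \<in> B \<Longrightarrow> x \<bullet> b = 0" "A *v x = \<mu> *\<^sub>R x"
      by blast
    have "x \<notin> B"
    proof
      assume "x \<in> B"
      then have "x \<bullet> x = 0" using x(2) by blast
      then show False using x(1) by simp
    qed
    then have "finite (insert x B) \<and> card (insert x B) = Suc k"
      using B by simp
    moreover have "pairwise orthogonal (insert x B)"
      using B(4) x(2) by (auto simp: pairwise_insert orthogonal_def inner_commute)
    ultimately show ?case using B(3) x by (intro exI[of _ "insert x B"]) auto
  qed
  from this[of "CARD('n)"] obtain B :: "(real^'n) set" where B: "finite B" "card B = CARD('n)"
    "\<forall>b\<in>B. norm b = 1 \<and> (\<exists>\<mu>. A *v b = \<mu> *\<^sub>R b)" "pairwise orthogonal B" by auto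
  obtain u :: "'n \<Rightarrow> real^'n" where u: "bij_betw u UNIV B"
    using finite_same_card_bij[of "UNIV :: 'n set" B] B by auto
  have uB: "u a \<in> B" for a using u by (auto simp: bij_betw_def)
  have "\<exists>d. \<forall>a. A *v u a = d a *\<^sub>R u a"
    using B(3) uB by (intro choice) blast
  then obtain d where d: "\<And>a. A *v u a = d a *\<^sub>R u a" by blast
  have "u a \<bullet> u b = (if a = b then 1 else 0)" for a b
  proof (cases "a = b")
    case True
    then show ?thesis using B(3) uB[of a] by (simp add: dot_square_norm)
  next
    case False
    then have "u a \<noteq> u b" using u by (auto simp: bij_betw_def inj_on_def)
    then show ?thesis using B(4) uB False by (auto simp: pairwise_def orthogonal_def)
  qed
  then show thesis using that d by blast
qed

lemma gram_quadratic:
  fixes u :: "real^'n::finite"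
  assumes "semi_inner K sc ip" "\<And>l. v l \<in> K"
  shows "0 \<le> (\<Sum>l\<in>UNIV. \<Sum>m\<in>UNIV. u $ l * u $ m * Re (ip (v l) (v m)))"
proof -
  interpret semi_inner K sc ip by fact
  define w where "w = (\<Sum>l\<in>UNIV. sc (complex_of_real (u $ l)) (v l))"
  have K: "v l \<in> K" "sc c (v l) \<in> K" for l c using assms(2) K_sc by blast+
  have wK: "w \<in> K" unfolding w_def by (intro K_sum K)
  have "ip w w = (\<Sum>l\<in>UNIV. ip (sc (complex_of_real (u $ l)) (v l)) w)"
    unfolding w_def by (rule ip_sum_left) (intro K_sum K)+
  also have "\<dots> = (\<Sum>l\<in>UNIV. \<Sum>m\<in>UNIV. ip (sc (complex_of_real (u $ l)) (v l)) (sc (complex_of_real (u $ m)) (v m)))"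
    unfolding w_def by (intro sum.cong refl ip_sum K)
  also have "\<dots> = (\<Sum>l\<in>UNIV. \<Sum>m\<in>UNIV. complex_of_real (u $ l) * complex_of_real (u $ m) * ip (v l) (v m))"
    by (simp add: ip_sc ip_sc_left K mult_ac)
  finally have "Re (ip w w) = (\<Sum>l\<in>UNIV. \<Sum>m\<in>UNIV. u $ l * u $ m * Re (ip (v l) (v m)))"
    by simp
  then show ?thesis using ip_pos[OF wK] by simp
qed

locale orthonormal_frame =
  fixes u :: "'n::finite \<Rightarrow> real^'n" and d :: "'n \<Rightarrow> real"
  assumes orth: "\<And>a b. u a \<bullet> u b = (if a = b then 1 else 0)"
begin

text \<open>\<open>fc f\<close> is \<open>f\<close> applied to the symmetric matrix with eigenvectors \<open>u\<close> and eigenvalues \<open>d\<close>.\<close>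

definition fc :: "(real \<Rightarrow> real) \<Rightarrow> real^'n^'n" where
  "fc f = (\<chi> i j. \<Sum>a\<in>UNIV. f (d a) * u a $ i * u a $ j)"

lemma fc_nth: "fc f $ i $ j = (\<Sum>a\<in>UNIV. f (d a) * u a $ i * u a $ j)"
  by (simp add: fc_def)

lemma orth_sum: "(\<Sum>k\<in>UNIV. u a $ k * u b $ k) = (if a = b then 1 else 0)"
  using orth[of a b] by (simp add: inner_vec_def)

lemma complete: "(\<Sum>a\<in>UNIV. u a $ i * u a $ j) = (if i = j then 1 else 0)"
proof -
  define U :: "real^'n^'n" where "U = (\<chi> a i. u a $ i)"
  have "U ** transpose U = mat 1"
    by (simp add: vec_eq_iff matrix_matrix_mult_def transpose_def mat_def U_def orth_sum)
  then have "transpose U ** U = mat 1" by (simp add: matrix_left_right_inverse)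
  then have "(transpose U ** U) $ i $ j = mat 1 $ i $ j" by simp
  then show ?thesis by (simp add: matrix_matrix_mult_def transpose_def mat_def U_def)
qed

lemma fc_cong: "(\<And>a. f (d a) = g (d a)) \<Longrightarrow> fc f = fc g"
  by (simp add: fc_def)

lemma fc_one: "fc (\<lambda>_. 1) = mat 1"
  by (simp add: vec_eq_iff fc_nth complete mat_def)

lemma fc_mult: "fc f ** fc g = fc (\<lambda>x. f x * g x)"
proof -
  have "(fc f ** fc g) $ i $ j = fc (\<lambda>x. f x * g x) $ i $ j" for i j
  proof -
    have "(fc f ** fc g) $ i $ j
        = (\<Sum>k\<in>UNIV. \<Sum>a\<in>UNIV. \<Sum>b\<in>UNIV. f (d a) * u a $ i * u a $ k * (g (d b) * u b $ k * u b $ j))"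
      by (simp add: matrix_matrix_mult_def fc_nth sum_product)
    also have "\<dots> = (\<Sum>a\<in>UNIV. \<Sum>b\<in>UNIV. \<Sum>k\<in>UNIV. f (d a) * u a $ i * u a $ k * (g (d b) * u b $ k * u b $ j))"
      by (subst sum.swap, rule sum.cong[OF refl], rule sum.swap)
    also have "\<dots> = (\<Sum>a\<in>UNIV. \<Sum>b\<in>UNIV. f (d a) * u a $ i * (g (d b) * u b $ j) * (\<Sum>k\<in>UNIV. u a $ k * u b $ k))"
      by (simp add: sum_distrib_left mult_ac)
    also have "\<dots> = fc (\<lambda>x. f x * g x) $ i $ j"
      by (simp add: orth_sum fc_nth if_distrib[of "\<lambda>x. _ * x"] mult_ac cong: if_cong)
    finally show ?thesis .
  qed
  then show ?thesis by (simp add: vec_eq_iff)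
qed

lemma fc_vector: "fc f *v x = (\<Sum>a\<in>UNIV. (f (d a) * (u a \<bullet> x)) *\<^sub>R u a)"
proof -
  have "(fc f *v x) $ i = (\<Sum>a\<in>UNIV. (f (d a) * (u a \<bullet> x)) *\<^sub>R u a) $ i" for i
  proof -
    have "(fc f *v x) $ i = (\<Sum>k\<in>UNIV. \<Sum>a\<in>UNIV. f (d a) * u a $ i * u a $ k * x $ k)"
      by (simp add: matrix_vector_mult_def fc_nth sum_distrib_right)
    also have "\<dots> = (\<Sum>a\<in>UNIV. \<Sum>k\<in>UNIV. f (d a) * u a $ i * u a $ k * x $ k)" by (rule sum.swap)
    also have "\<dots> = (\<Sum>a\<in>UNIV. f (d a) * (u a \<bullet> x) * u a $ i)"
      by (simp add: inner_vec_def sum_distrib_left sum_distrib_right mult_ac)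
    finally show ?thesis by simp
  qed
  then show ?thesis by (simp add: vec_eq_iff)
qed

lemma fc_coord: "u a \<bullet> (fc f *v x) = f (d a) * (u a \<bullet> x)"
  by (simp add: fc_vector inner_sum_right orth if_distrib[of "\<lambda>x. _ * x"] cong: if_cong)

lemma fc_eigenvector: "fc f *v u a = f (d a) *\<^sub>R u a"
  by (simp add: fc_vector orth if_distrib[of "\<lambda>x. _ * x"] if_distrib[of "\<lambda>x. x *\<^sub>R _"] cong: if_cong)

lemma expansion: "x = (\<Sum>a\<in>UNIV. (u a \<bullet> x) *\<^sub>R u a)"
  using fc_vector[of "\<lambda>_. 1" x] by (simp add: fc_one)

lemma matrix_eq_fc:
  assumes "\<And>a. A *v u a = f (d a) *\<^sub>R u a" shows "A = fc f"
proof (rule matrix_eq[THEN iffD2], rule allI)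
  fix x
  have "A *v x = A *v (\<Sum>a\<in>UNIV. (u a \<bullet> x) *\<^sub>R u a)" using expansion[of x] by simp
  also have "\<dots> = (\<Sum>a\<in>UNIV. A *v ((u a \<bullet> x) *\<^sub>R u a))"
    by (rule linear_sum[OF matrix_vector_mul_linear])
  also have "\<dots> = fc f *v x"
    by (simp add: fc_vector matrix_vector_mult_scaleR assms mult.commute)
  finally show "A *v x = fc f *v x" .
qed

lemma fc_scaleR: "c *\<^sub>R fc f = fc (\<lambda>x. c * f x)"
  by (simp add: vec_eq_iff fc_nth sum_distrib_left mult_ac)

lemma fc_diff: "fc f - fc g = fc (\<lambda>x. f x - g x)"
  by (simp add: vec_eq_iff fc_nth sum_subtractf algebra_simps)

lemma fc_add: "fc f + fc g = fc (\<lambda>x. f x + g x)"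
  by (simp add: vec_eq_iff fc_nth sum.distrib algebra_simps)

lemma fc_symmetric: "fc f $ i $ j = fc f $ j $ i"
  by (simp add: fc_nth mult_ac)

lemma fc_transpose: "transpose (fc f) = fc f"
  by (simp add: vec_eq_iff transpose_def fc_symmetric)

lemma fc_inner: "x \<bullet> (fc f *v x) = (\<Sum>a\<in>UNIV. f (d a) * (u a \<bullet> x)\<^sup>2)"
  by (simp add: fc_vector inner_sum_right power2_eq_square inner_commute mult_ac)

lemma fc_pos_semidefinite: "(\<And>a. 0 \<le> f (d a)) \<Longrightarrow> pos_semidefinite (fc f)"
  by (simp add: pos_semidefinite_def fc_transpose fc_inner sum_nonneg)

lemma mat_pow_fc: "mat_pow (fc f) k = fc (\<lambda>x. f x ^ k)"
  by (induction k) (simp_all add: fc_one fc_mult)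

lemma mat_exp_fc: "mat_exp (fc f) = fc (\<lambda>x. exp (f x))"
proof -
  define P :: "'n \<Rightarrow> real^'n^'n" where "P a = (\<chi> i j. u a $ i * u a $ j)" for a
  have fcP: "fc g = (\<Sum>a\<in>UNIV. g (d a) *\<^sub>R P a)" for g
    by (simp add: vec_eq_iff fc_nth P_def mult.assoc)
  have "(\<lambda>k. \<Sum>a\<in>UNIV. (f (d a) ^ k /\<^sub>R fact k) *\<^sub>R P a) sums (\<Sum>a\<in>UNIV. exp (f (d a)) *\<^sub>R P a)"
    by (intro sums_sum bounded_linear.sums[OF bounded_linear_scaleR_left] exp_converges)
  moreover have "(1 / fact k) *\<^sub>R mat_pow (fc f) k = (\<Sum>a\<in>UNIV. (f (d a) ^ k /\<^sub>R fact k) *\<^sub>R P a)" for k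
    unfolding mat_pow_fc
    by (simp add: fcP[of "\<lambda>x. f x ^ k"] scaleR_sum_right divide_inverse mult.commute)
  ultimately show ?thesis by (simp add: mat_exp_def fcP[of "\<lambda>x. exp (f x)"] sums_iff)
qed

lemma matrix_inv_fc: assumes "\<And>a. f (d a) \<noteq> 0" shows "matrix_inv (fc f) = fc (\<lambda>x. 1 / f x)"
proof -
  have "fc (\<lambda>x. f x * (1 / f x)) = fc (\<lambda>_. 1)" "fc (\<lambda>x. 1 / f x * f x) = fc (\<lambda>_. 1)"
    using assms by (intro fc_cong; simp)+
  then have 1: "fc f ** fc (\<lambda>x. 1 / f x) = mat 1" "fc (\<lambda>x. 1 / f x) ** fc f = mat 1"
    by (simp_all only: fc_mult fc_one)
  have "matrix_inv (fc f) ** fc f = mat 1"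
    unfolding matrix_inv_def
    by (rule someI2[where a = "fc (\<lambda>x. 1 / f x)"]) (use 1 in auto)
  then have "matrix_inv (fc f) ** (fc f ** fc (\<lambda>x. 1 / f x)) = fc (\<lambda>x. 1 / f x)"
    by (simp add: matrix_mul_assoc)
  then show ?thesis using 1 by simp
qed

text \<open>Uniqueness of the positive square root: an eigenvector \<open>w\<close> of another root, expanded in the
  frame, only meets eigenvectors whose eigenvalue has the right square.\<close>

lemma mat_sqrt_fc:
  assumes f: "\<And>a. 0 \<le> f (d a)" shows "mat_sqrt (fc f) = fc (\<lambda>x. sqrt (f x))"
  unfolding mat_sqrt_def
proof (rule the_equality)
  have "fc (\<lambda>x. sqrt (f x) * sqrt (f x)) = fc f" using f by (intro fc_cong) simp
  then show "pos_semidefinite (fc (\<lambda>x. sqrt (f x))) \<and> fc (\<lambda>x. sqrt (f x)) ** fc (\<lambda>x. sqrt (f x)) = fc f"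
    using f by (simp add: fc_pos_semidefinite fc_mult)
next
  fix B assume B: "pos_semidefinite B \<and> B ** B = fc f"
  obtain v :: "'n \<Rightarrow> real^'n" and m where v: "\<And>a b. v a \<bullet> v b = (if a = b then 1 else 0)"
    and m: "\<And>a. B *v v a = m a *\<^sub>R v a"
    using symmetric_matrix_spectral[of B] B unfolding pos_semidefinite_def by blast
  interpret v: orthonormal_frame v m using v by unfold_locales
  have "B = v.fc (\<lambda>x. x)" by (rule v.matrix_eq_fc) (simp add: m)
  also have "\<dots> = fc (\<lambda>x. sqrt (f x))"
  proof (rule v.matrix_eq_fc[symmetric])
    fix b
    have "0 \<le> v b \<bullet> (B *v v b)" using B by (simp add: pos_semidefinite_def)
    then have m0: "0 \<le> m b" by (simp add: m v)
    have "fc f *v v b = (m b)\<^sup>2 *\<^sub>R v b"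
      using B by (metis m matrix_vector_mul_assoc matrix_vector_mult_scaleR power2_eq_square scaleR_scaleR)
    then have eq: "f (d a) * (u a \<bullet> v b) = (m b)\<^sup>2 * (u a \<bullet> v b)" for a
      using fc_coord[of a f "v b"] by auto
    have sq: "sqrt (f (d a)) * (u a \<bullet> v b) = m b * (u a \<bullet> v b)" for a
      using eq[of a] m0 by (cases "u a \<bullet> v b = 0") (auto simp: real_sqrt_unique)
    have "fc (\<lambda>x. sqrt (f x)) *v v b = (\<Sum>a\<in>UNIV. (m b * (u a \<bullet> v b)) *\<^sub>R u a)"
      by (simp only: fc_vector sq)
    also have "\<dots> = m b *\<^sub>R (\<Sum>a\<in>UNIV. (u a \<bullet> v b) *\<^sub>R u a)" by (simp add: scaleR_sum_right)
    finally show "fc (\<lambda>x. sqrt (f x)) *v v b = m b *\<^sub>R v b" using expansion[of "v b"] by simp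
  qed
  finally show "B = fc (\<lambda>x. sqrt (f x))" .
qed

lemma eigenvalue_le_opnorm: "f (d a) \<le> mat_opnorm (fc f)"
proof -
  have "norm (u a) = 1" using orth[of a a] by (simp add: norm_eq_1)
  moreover have "norm (fc f *v u a) \<le> onorm ((*v) (fc f)) * norm (u a)"
    by (rule onorm) (rule matrix_vector_mul_bounded_linear)
  ultimately show ?thesis by (simp add: fc_eigenvector mat_opnorm_def)
qed

text \<open>For vectors \<open>v\<^sub>l\<close> of a semi-inner product space, \<open>\<Sum> (f(A))\<^sub>l\<^sub>m \<langle>v\<^sub>l, v\<^sub>m\<rangle>\<close> is at most the largest value of
  \<open>f\<close> on the spectrum times \<open>\<Sum> \<parallel>v\<^sub>l\<parallel>\<^sup>2\<close>, as rotating the vectors into the frame shows.\<close>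

lemma fc_gram_bound:
  assumes S: "semi_inner K sc ip" and v: "\<And>l. v l \<in> K" and f: "\<And>a. f (d a) \<le> c"
  shows "(\<Sum>l\<in>UNIV. \<Sum>m\<in>UNIV. fc f $ l $ m * Re (ip (v l) (v m))) \<le> c * (\<Sum>l\<in>UNIV. (semi_norm ip (v l))\<^sup>2)"
proof -
  interpret semi_inner K sc ip by fact
  define q where "q a = (\<Sum>l\<in>UNIV. \<Sum>m\<in>UNIV. u a $ l * u a $ m * Re (ip (v l) (v m)))" for a
  have expand: "(\<Sum>l\<in>UNIV. \<Sum>m\<in>UNIV. fc f $ l $ m * Re (ip (v l) (v m))) = (\<Sum>a\<in>UNIV. f (d a) * q a)" for f
  proof -
    have "(\<Sum>l\<in>UNIV. \<Sum>m\<in>UNIV. fc f $ l $ m * Re (ip (v l) (v m)))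
        = (\<Sum>l\<in>UNIV. \<Sum>m\<in>UNIV. \<Sum>a\<in>UNIV. f (d a) * (u a $ l * u a $ m * Re (ip (v l) (v m))))"
      by (simp add: fc_nth sum_distrib_left sum_distrib_right mult_ac)
    also have "\<dots> = (\<Sum>l\<in>UNIV. \<Sum>a\<in>UNIV. \<Sum>m\<in>UNIV. f (d a) * (u a $ l * u a $ m * Re (ip (v l) (v m))))"
      by (rule sum.cong[OF refl], rule sum.swap)
    also have "\<dots> = (\<Sum>a\<in>UNIV. \<Sum>l\<in>UNIV. \<Sum>m\<in>UNIV. f (d a) * (u a $ l * u a $ m * Re (ip (v l) (v m))))"
      by (rule sum.swap)
    finally show ?thesis by (simp add: q_def sum_distrib_left)
  qed
  have "(\<Sum>a\<in>UNIV. f (d a) * q a) \<le> (\<Sum>a\<in>UNIV. c * q a)"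
    using gram_quadratic[OF S v] f unfolding q_def by (intro sum_mono mult_right_mono) auto
  also have "\<dots> = c * (\<Sum>a\<in>UNIV. 1 * q a)" by (simp add: sum_distrib_left)
  also have "(\<Sum>a\<in>UNIV. 1 * q a) = (\<Sum>l\<in>UNIV. \<Sum>m\<in>UNIV. mat 1 $ l $ m * Re (ip (v l) (v m)))"
    using expand[of "\<lambda>_. 1"] by (simp add: fc_one)
  also have "\<dots> = (\<Sum>l\<in>UNIV. (semi_norm ip (v l))\<^sup>2)"
    by (simp add: mat_def nrm_sq v if_distrib[of "\<lambda>x. x * _"] cong: if_cong)
  finally show ?thesis by (simp add: expand)
qed

end

section \<open>Bounds on the free Fisher information\<close>

context tracial_space
begin

text \<open>Conjugate variables are obtained by the Riesz lemma on polynomials. The definition of the Fisher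
  information refers to an arbitrary choice of them in \<open>L\<^sup>2(W\<^sup>*(Y))\<close>; density of the polynomials there
  makes the bound on polynomials a bound on the norm.\<close>

theorem free_fisher_information_bound:
  fixes Y :: "'n::finite \<Rightarrow> 'h oper"
  assumes Y: "self_adjoint_tuple M Y" and c: "\<And>i. 0 \<le> c i"
    and bound: "\<And>i p. cmod (inner2 \<tau> (poly_eval Y (cyclic_diff i V)) (poly_eval Y p)
        - tensor_inner \<tau> tensor_one (bipoly_eval Y (free_diff i p))) \<le> c i * m.nrm (poly_eval Y p)"
  shows "ennreal_sqrt (free_fisher_information \<tau> V Y) \<le> ennreal (sqrt (\<Sum>i\<in>UNIV. (c i)\<^sup>2))"
proof -
  have YM: "Y i \<in> M" for i using Y by (simp add: self_adjoint_tuple_def)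
  note pM = poly_eval_M[of Y, OF YM]
  let ?N = "vn_generated (range Y)"
  have N: "?N \<subseteq> M" "range (poly_eval Y) \<subseteq> ?N" using vn_generated_self_adjoint[OF Y] by simp_all
  have L2_Comp: "f \<in> m.Comp" "\<And>k. f k \<in> ?N" if "f \<in> L2 \<tau> ?N" for f
    using that N(1) by (auto simp: L2_def hcompletion_def)
  define W where "W i = poly_eval Y (cyclic_diff i V)" for i
  have WM: "W i \<in> M" for i unfolding W_def by (rule pM)
  define \<phi> where "\<phi> i p = inner2 \<tau> (W i) (poly_eval Y p) - tensor_inner \<tau> tensor_one (bipoly_eval Y (free_diff i p))"
    for i p
  define ipY where "ipY = (\<lambda>p q. inner2 \<tau> (poly_eval Y p) (poly_eval Y q))"
  have "semi_inner UNIV pm_scale ipY"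
    unfolding ipY_def
    by (rule m.pullback[of "poly_eval Y"]) (simp_all add: pM poly_eval_add poly_eval_scale pm_scale_minus_one)
  then interpret VY: semi_inner UNIV pm_scale ipY .
  have nrmY: "VY.nrm p = m.nrm (poly_eval Y p)" for p by (simp add: semi_norm_def ipY_def)
  have "\<exists>g. g \<in> VY.Comp \<and> (\<forall>p. (\<lambda>k. ipY (g k) p) \<longlonglongrightarrow> \<phi> i p)" for i
  proof -
    obtain g where "g \<in> VY.Comp" "\<And>p. (\<lambda>k. ipY (g k) p) \<longlonglongrightarrow> \<phi> i p"
    proof (rule VY.Riesz[of "\<phi> i" "c i"])
      show "\<phi> i (p + q) = \<phi> i p + \<phi> i q" for p q
        by (simp add: \<phi>_def poly_eval_add m.ip_add WM pM free_diff_add bipoly_eval_add ti_add_right)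
      show "\<phi> i (pm_scale z p) = z * \<phi> i p" for z p
        by (simp add: \<phi>_def poly_eval_scale m.ip_sc WM pM free_diff_scale bipoly_eval_scale
            ti_scale_right right_diff_distrib)
      show "cmod (\<phi> i p) \<le> c i * VY.nrm p" for p
        unfolding nrmY \<phi>_def W_def by (rule bound)
    qed (use c in auto)
    then show ?thesis by blast
  qed
  then obtain g where gC: "\<And>i. g i \<in> VY.Comp" and gL: "\<And>i p. (\<lambda>k. ipY (g i k) p) \<longlonglongrightarrow> \<phi> i p"
    by metis
  have "conjugate_variables \<tau> Y (\<lambda>i k. W i - poly_eval Y (g i k))"
    unfolding conjugate_variables_def
  proof (intro conjI allI)
    fix i
    have nd: "m.nrm ((W i - poly_eval Y (g i k)) - (W i - poly_eval Y (g i l))) = VY.nrm (g i k - g i l)" for k l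
    proof -
      have "(W i - poly_eval Y (g i k)) - (W i - poly_eval Y (g i l)) = - poly_eval Y (g i k - g i l)"
        by (simp add: poly_eval_diff)
      then show ?thesis by (simp add: nrmY m.nrm_minus pM)
    qed
    have "W i - poly_eval Y (g i k) \<in> ?N" for k
      using N(2) by (simp add: W_def poly_eval_diff[symmetric] image_subset_iff)
    moreover have "\<exists>K. \<forall>k\<ge>K. \<forall>l\<ge>K. m.nrm ((W i - poly_eval Y (g i k)) - (W i - poly_eval Y (g i l))) < e"
      if "e > 0" for e unfolding nd by (rule VY.Comp_cauchy[OF gC that])
    ultimately show L2: "(\<lambda>k. W i - poly_eval Y (g i k)) \<in> L2 \<tau> ?N"
      unfolding L2_def hcompletion_def by blast
    fix p
    have "(\<lambda>k. inner2 \<tau> (W i - poly_eval Y (g i k)) (poly_eval Y p))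
        \<longlonglongrightarrow> inner2 \<tau> (W i) (poly_eval Y p) - \<phi> i p"
      using tendsto_diff[OF tendsto_const gL[of i p]] by (simp add: m.ip_diff_left WM pM ipY_def)
    then show "hinner (inner2 \<tau>) (\<lambda>k. W i - poly_eval Y (g i k)) (\<lambda>_. poly_eval Y p)
        = tensor_inner \<tau> tensor_one (bipoly_eval Y (free_diff i p))"
      using LIMSEQ_unique[OF m.hinner_const_right[OF L2_Comp(1)[OF L2] pM]] by (simp add: \<phi>_def)
  qed
  then have ex: "\<exists>\<xi>. conjugate_variables \<tau> Y \<xi>" by blast
  define \<xi> where "\<xi> = (SOME \<xi>. conjugate_variables \<tau> Y \<xi>)"
  have \<xi>: "conjugate_variables \<tau> Y \<xi>" unfolding \<xi>_def using ex by (rule someI_ex)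
  have le: "hnorm (inner2 \<tau>) (\<lambda>k. \<xi> i k - W i) \<le> c i" "0 \<le> hnorm (inner2 \<tau>) (\<lambda>k. \<xi> i k - W i)" for i
  proof -
    have L2: "\<xi> i \<in> L2 \<tau> ?N" using \<xi> by (simp add: conjugate_variables_def)
    have \<xi>C: "\<xi> i \<in> m.Comp" by (rule L2_Comp(1)[OF L2])
    have C: "(\<lambda>k. \<xi> i k - W i) \<in> m.Comp" by (rule m.Comp_diff[OF \<xi>C m.Comp_const[OF WM]])
    show "0 \<le> hnorm (inner2 \<tau>) (\<lambda>k. \<xi> i k - W i)" by (rule m.hnorm_nonneg[OF C])
    show "hnorm (inner2 \<tau>) (\<lambda>k. \<xi> i k - W i) \<le> c i"
    proof (rule m.hnorm_le_of_dense[OF C _ c])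
      show "range (poly_eval Y) \<subseteq> M" using pM by blast
      fix k and e :: real assume "e > 0"
      then obtain p where p: "m.nrm (\<xi> i k - poly_eval Y p) < e"
        using poly_eval_dense[OF Y L2_Comp(2)[OF L2]] by blast
      have "\<xi> i k - W i - poly_eval Y (p - cyclic_diff i V) = \<xi> i k - poly_eval Y p"
        by (simp add: poly_eval_diff W_def)
      then show "\<exists>w\<in>range (poly_eval Y). m.nrm (\<xi> i k - W i - w) < e" using p by (metis rangeI)
    next
      fix w assume "w \<in> range (poly_eval Y)"
      then obtain p where w: "w = poly_eval Y p" by blast
      have "hinner (inner2 \<tau>) (\<lambda>k. \<xi> i k - W i) (\<lambda>_. w)
          = hinner (inner2 \<tau>) (\<xi> i) (\<lambda>_. w) - hinner (inner2 \<tau>) (\<lambda>_. W i) (\<lambda>_. w)"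
        using m.hinner_diff_left[OF \<xi>C m.Comp_const[OF WM] m.Comp_const[OF pM]] w by simp
      also have "\<dots> = - \<phi> i p"
        using \<xi> by (simp add: conjugate_variables_def w \<phi>_def hinner_def)
      finally show "cmod (hinner (inner2 \<tau>) (\<lambda>k. \<xi> i k - W i) (\<lambda>_. w)) \<le> c i * m.nrm w"
        using bound[of i p] by (simp add: \<phi>_def w W_def norm_minus_commute)
    qed
  qed
  have "free_fisher_information \<tau> V Y
      = ennreal (\<Sum>i\<in>UNIV. (hnorm (inner2 \<tau>) (\<lambda>k. \<xi> i k - W i))\<^sup>2)"
    using ex by (simp add: free_fisher_information_def \<xi>_def W_def Let_def)
  then have "ennreal_sqrt (free_fisher_information \<tau> V Y)
      = ennreal (sqrt (\<Sum>i\<in>UNIV. (hnorm (inner2 \<tau>) (\<lambda>k. \<xi> i k - W i))\<^sup>2))"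
    by (simp add: ennreal_sqrt_def sum_nonneg)
  also have "\<dots> \<le> ennreal (sqrt (\<Sum>i\<in>UNIV. (c i)\<^sup>2))"
    using le by (intro ennreal_leI real_sqrt_le_mono sum_mono power_mono)
  finally show ?thesis .
qed


section \<open>Words in several families\<close>

lemma poly_eval_word_mult:
  assumes "\<And>i. X i \<in> bounded_ops"
  shows "poly_eval X (foldr left_mult w q) = word_eval X w o\<^sub>L poly_eval X q"
  by (induction w) (simp_all add: poly_eval_left_mult assms comp_assoc_blinfun)

lemma subalg_poly_eval:
  assumes XM: "\<And>i. X i \<in> M"
  shows "subalg (range (poly_eval X))"
proof -
  have comp: "poly_eval X p o\<^sub>L poly_eval X q \<in> range (poly_eval X)" for p q
  proof (induction p rule: pm_induct)
    case zero
    have "poly_eval X 0 \<in> range (poly_eval X)" by (rule rangeI)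
    then show ?case by simp
  next
    case (single w z)
    have "poly_eval X (Poly_Mapping.single w z) o\<^sub>L poly_eval X q
        = poly_eval X (pm_scale z (foldr left_mult w q))"
      by (simp add: poly_eval_single poly_eval_scale poly_eval_word_mult XM M_bounded op_scaleC_comp_left)
    then show ?case by (metis rangeI)
  next
    case (add p p')
    then obtain r r' where "poly_eval X p o\<^sub>L poly_eval X q = poly_eval X r"
      "poly_eval X p' o\<^sub>L poly_eval X q = poly_eval X r'" by auto
    then have "poly_eval X (p + p') o\<^sub>L poly_eval X q = poly_eval X (r + r')"
      by (simp add: poly_eval_add comp_add_left)
    then show ?case by (metis rangeI)
  qed
  have "poly_eval X (Poly_Mapping.single [] 1) = id_blinfun" by (simp add: poly_eval_single)
  then have "id_blinfun \<in> range (poly_eval X)" by (metis rangeI)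
  moreover have "range (poly_eval X) \<subseteq> M" using poly_eval_M[of X] XM by blast
  ultimately show ?thesis
    using comp by (auto simp: subalg_def poly_eval_add[symmetric] poly_eval_scale[symmetric])
qed

lemma word_eval_in_poly: "word_eval X w \<in> range (poly_eval X)"
proof -
  have "poly_eval X (Poly_Mapping.single w 1) = word_eval X w" by (simp add: poly_eval_single)
  then show ?thesis by (metis rangeI)
qed

lemma adj_word_eval:
  assumes "\<And>i. X i \<in> M" "\<And>i. adj (X i) = X i"
  shows "adj (word_eval X w) = word_eval X (rev w)"
proof (induction w)
  case (Cons i w)
  have "adj (X i o\<^sub>L word_eval X w) = adj (word_eval X w) o\<^sub>L X i"
    using assms by (simp add: adj_comp M_bounded word_eval_M)
  then show ?case using Cons by (simp add: word_eval_append)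
qed (simp add: adj_id)

lemma free_algs_poly_eval:
  assumes "free_from \<tau> S X"
  shows "free_algs (range (poly_eval S)) (range (poly_eval X))"
  using assms unfolding free_algs_def free_from_def alternating_def by blast

lemma oprod_map: "oprod (map (\<lambda>j. (Y j, D j)) w) = word_eval Y w"
  by (simp add: word_eval_def o_def)

lemma leibniz_map: "leibniz (map (\<lambda>j. (Y j, D j)) w) a b
    = (\<Sum>k<length w. D (w ! k) (a o\<^sub>L word_eval Y (take k w)) (word_eval Y (drop (Suc k) w) o\<^sub>L b))"
  unfolding leibniz_sum take_map drop_map oprod_map by (rule sum.cong) simp_all

lemma defect_map: "defect \<theta> (map (\<lambda>j. (Y j, D j)) w) = \<tau> (\<theta> o\<^sub>L word_eval Y w)
    - (\<Sum>k<length w. D (w ! k) (word_eval Y (take k w)) (word_eval Y (drop (Suc k) w)))"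
  by (simp only: defect_def oprod_map leibniz_map comp_id_left comp_id_right)

lemma range_list: "set L \<subseteq> range f \<Longrightarrow> \<exists>w. L = map f w"
  by (metis ex_map_conv image_iff subsetD)

lemma malg_sum:
  fixes c :: "'i \<Rightarrow> real"
  assumes "finite I" "\<And>i. i \<in> I \<Longrightarrow> (A i, D i) \<in> malg G"
  shows "(\<Sum>i\<in>I. c i *\<^sub>R A i, \<lambda>a b. \<Sum>i\<in>I. complex_of_real (c i) * D i a b) \<in> malg G"
  using assms
proof (induction I rule: finite_induct)
  case empty
  have "mscale 0 mone \<in> malg G" by (intro malg_scale malg_one)
  then show ?case by (simp add: mscale_def mone_def)
next
  case (insert i I)
  have "madd (mscale (complex_of_real (c i)) (A i, D i))
      (\<Sum>i\<in>I. c i *\<^sub>R A i, \<lambda>a b. \<Sum>i\<in>I. complex_of_real (c i) * D i a b) \<in> malg G"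
    using insert by (intro malg_add malg_scale) auto
  then show ?case using insert.hyps by (simp add: madd_def mscale_def op_scaleC_of_real)
qed

lemma malg_word:
  assumes "\<And>j. (X j, \<lambda>a b. 0) \<in> G" shows "(word_eval X w, \<lambda>a b. 0) \<in> malg G"
proof (induction w)
  case Nil
  have "mone \<in> malg G" by (rule malg_one)
  then show ?case by (simp add: mone_def)
next
  case (Cons j w)
  have "mmult (X j, \<lambda>a b. 0) (word_eval X w, \<lambda>a b. 0) \<in> malg G"
    by (rule malg_mult[OF malg_gen[OF assms] Cons])
  then show ?case by (simp add: mmult_def)
qed

lemma ti_single_right: "tensor_inner \<tau> v (Poly_Mapping.single (a, b) 1)
    = (\<Sum>x\<in>Poly_Mapping.keys v. cnj (Poly_Mapping.lookup v x) * (\<tau> (adj (fst x) o\<^sub>L a) * \<tau> (b o\<^sub>L adj (snd x))))"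
  by (simp add: tensor_inner_def case_prod_unfold)

lemma bilin_ti: assumes v: "v \<in> alg_tensor_op M"
  shows "bilin (\<lambda>a b. tensor_inner \<tau> v (Poly_Mapping.single (a, b) 1))"
proof -
  have M: "adj (fst x) \<in> M" "adj (snd x) \<in> M" if "x \<in> Poly_Mapping.keys v" for x
    using v that by (auto simp: alg_tensor_op_def intro!: M_adj)
  show ?thesis
    unfolding ti_single_right
    by (rule bilinI; simp add: sum_distrib_left sum.distrib[symmetric]; intro sum.cong refl)
      (simp_all add: M comp_add_left comp_add_right op_scaleC_comp_left op_scaleC_comp_right
        tau_add tau_sc M_comp M_sc M_add M_bounded algebra_simps)
qed

lemma ti_tensor_one: "tensor_inner \<tau> tensor_one (Poly_Mapping.single (a, b) z) = z * (\<tau> a * \<tau> b)"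
  by (simp add: tensor_one_def ti_single adj_id)

lemma bipoly_eval_free_diff_word: "bipoly_eval Y (free_diff j (Poly_Mapping.single w z))
    = (\<Sum>k | k < length w \<and> w ! k = j.
        Poly_Mapping.single (word_eval Y (take k w), word_eval Y (drop (Suc k) w)) z)"
  by (simp add: free_diff_single bipoly_eval_sum bipoly_eval_single)

lemma sum_split_letters:
  fixes f :: "'n::finite \<Rightarrow> nat \<Rightarrow> 'b::comm_monoid_add"
  shows "(\<Sum>j\<in>UNIV. \<Sum>k | k < length w \<and> w ! k = j. f j k) = (\<Sum>k<length w. f (w ! k) k)"
proof -
  have "(\<Sum>j\<in>UNIV. \<Sum>k | k < length w \<and> w ! k = j. f j k)
      = (\<Sum>j\<in>UNIV. \<Sum>k<length w. if w ! k = j then f j k else 0)"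
  proof (rule sum.cong[OF refl])
    fix j
    have "{k. k < length w \<and> w ! k = j} = {k \<in> {..<length w}. w ! k = j}" by auto
    then show "(\<Sum>k | k < length w \<and> w ! k = j. f j k) = (\<Sum>k<length w. if w ! k = j then f j k else 0)"
      by (simp only: sum.inter_filter[OF finite_lessThan])
  qed
  also have "\<dots> = (\<Sum>k<length w. \<Sum>j\<in>UNIV. if w ! k = j then f j k else 0)" by (rule sum.swap)
  also have "\<dots> = (\<Sum>k<length w. f (w ! k) k)" by simp
  finally show ?thesis .
qed


section \<open>Integration by parts for semicircular families\<close>

lemma semicircular_moment:
  assumes "semicircular_family M \<tau> C S"
  shows "\<tau> (word_eval S w) = nc_moment (\<lambda>i j. complex_of_real (C $ i $ j)) w"
  using assms by (simp add: semicircular_family_def nc_moment_def nc_sum_def NC2_eq)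

text \<open>Schwinger--Dyson equation for \<open>S\<close>, extended to words in \<open>S\<close> and the free family \<open>X\<close>.\<close>

theorem semicircular_integration_by_parts:
  fixes X S :: "'n::finite \<Rightarrow> 'h oper"
  assumes X: "self_adjoint_tuple M X" and S: "semicircular_family M \<tau> C S" and free: "free_from \<tau> S X"
    and L: "set L \<subseteq> malg (range (\<lambda>j. (S j, \<lambda>a b. complex_of_real (C $ i $ j) * \<tau> a * \<tau> b)) \<union> range (\<lambda>j. (X j, \<lambda>a b. 0)))"
  shows "\<tau> (S i o\<^sub>L oprod L) = leibniz L id_blinfun id_blinfun"
proof -
  have SM: "S j \<in> M" for j using S by (simp add: semicircular_family_def self_adjoint_tuple_def)
  have XM: "X j \<in> M" for j using X by (simp add: self_adjoint_tuple_def)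
  let ?c = "\<lambda>i j. complex_of_real (C $ i $ j)"
  have SD: "\<tau> (S i o\<^sub>L word_eval S w)
      = (\<Sum>k<length w. ?c i (w ! k) * \<tau> (word_eval S (take k w)) * \<tau> (word_eval S (drop (Suc k) w)))" for w
    using semicircular_moment[OF S, of "i # w"] by (simp add: semicircular_moment[OF S] nc_moment_Cons mult.assoc)
  have single: "X j \<in> range (poly_eval X)" for X :: "'n \<Rightarrow> 'h oper" and j
    using word_eval_in_poly[of X "[j]"] by simp
  have "defect (S i) L = 0"
  proof (rule free_integration_by_parts[OF subalg_poly_eval[of S, OF SM] subalg_poly_eval[of X, OF XM]
        free_algs_poly_eval[OF free] _ _ _ _ _ L])
    show "S i \<in> range (poly_eval S)" by (rule single)
    show "\<tau> (S i) = 0" using SD[of "[]"] by simp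
  next
    fix p assume "p \<in> range (\<lambda>j. (S j, \<lambda>a b. ?c i j * \<tau> a * \<tau> b))"
    then obtain j where p: "p = (S j, \<lambda>a b. ?c i j * \<tau> a * \<tau> b)" by blast
    have "\<tau> a = 0" if "null_wrt (range (poly_eval S)) a" for a
    proof -
      have "id_blinfun \<in> range (poly_eval S)" using subalgD(3)[OF subalg_poly_eval[of S, OF SM]] .
      then have "\<tau> (id_blinfun o\<^sub>L (a o\<^sub>L id_blinfun)) = 0" using that unfolding null_wrt_def by blast
      then show ?thesis by simp
    qed
    then show "valid p \<and> fst p \<in> range (poly_eval S) \<and> null_form (range (poly_eval S)) (snd p)"
      by (auto simp: p valid_def bilin_tau_tau SM single null_form_def)
  next
    fix p assume "p \<in> range (\<lambda>j. (X j, \<lambda>a b. 0 :: complex))"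
    then show "fst p \<in> range (poly_eval X) \<and> snd p = (\<lambda>a b. 0)" using single by auto
  next
    fix L assume "set L \<subseteq> range (\<lambda>j. (S j, \<lambda>a b. ?c i j * \<tau> a * \<tau> b))"
    then obtain w where "L = map (\<lambda>j. (S j, \<lambda>a b. ?c i j * \<tau> a * \<tau> b)) w" using range_list by blast
    then show "defect (S i) L = 0" by (simp add: defect_map SD)
  qed
  then show ?thesis by (simp add: defect_def)
qed

end

section \<open>Transport of the Stein kernel along the interpolation\<close>

lemma sum_swap_pairs:
  fixes F :: "'a \<Rightarrow> 'b \<Rightarrow> 'c \<Rightarrow> 'd \<Rightarrow> 'e::comm_monoid_add"
  shows "(\<Sum>a\<in>A. \<Sum>b\<in>B. \<Sum>c\<in>C. \<Sum>d\<in>D. F a b c d) = (\<Sum>c\<in>C. \<Sum>d\<in>D. \<Sum>a\<in>A. \<Sum>b\<in>B. F a b c d)"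
proof -
  have "(\<Sum>a\<in>A. \<Sum>b\<in>B. \<Sum>c\<in>C. \<Sum>d\<in>D. F a b c d) = (\<Sum>a\<in>A. \<Sum>c\<in>C. \<Sum>b\<in>B. \<Sum>d\<in>D. F a b c d)"
    by (rule sum.cong[OF refl], rule sum.swap)
  also have "\<dots> = (\<Sum>c\<in>C. \<Sum>a\<in>A. \<Sum>b\<in>B. \<Sum>d\<in>D. F a b c d)" by (rule sum.swap)
  also have "\<dots> = (\<Sum>c\<in>C. \<Sum>a\<in>A. \<Sum>d\<in>D. \<Sum>b\<in>B. F a b c d)"
    by (rule sum.cong[OF refl], rule sum.cong[OF refl], rule sum.swap)
  also have "\<dots> = (\<Sum>c\<in>C. \<Sum>d\<in>D. \<Sum>a\<in>A. \<Sum>b\<in>B. F a b c d)"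
    by (rule sum.cong[OF refl], rule sum.swap)
  finally show ?thesis .
qed

lemma quadratic_congruence:
  fixes K C :: "real^'n^'n::finite" and f :: "'n \<Rightarrow> 'n \<Rightarrow> real"
  shows "(\<Sum>j\<in>UNIV. \<Sum>k\<in>UNIV. C $ j $ k * (\<Sum>m\<in>UNIV. \<Sum>n\<in>UNIV. K $ m $ j * K $ n $ k * f m n))
    = (\<Sum>m\<in>UNIV. \<Sum>n\<in>UNIV. (K ** C ** transpose K) $ m $ n * f m n)"
proof -
  have "(\<Sum>j\<in>UNIV. \<Sum>k\<in>UNIV. C $ j $ k * (\<Sum>m\<in>UNIV. \<Sum>n\<in>UNIV. K $ m $ j * K $ n $ k * f m n))
      = (\<Sum>j\<in>UNIV. \<Sum>k\<in>UNIV. \<Sum>m\<in>UNIV. \<Sum>n\<in>UNIV. K $ m $ j * C $ j $ k * K $ n $ k * f m n)"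
    by (simp add: sum_distrib_left mult_ac)
  also have "\<dots> = (\<Sum>m\<in>UNIV. \<Sum>n\<in>UNIV. \<Sum>j\<in>UNIV. \<Sum>k\<in>UNIV. K $ m $ j * C $ j $ k * K $ n $ k * f m n)"
    by (rule sum_swap_pairs)
  also have "\<dots> = (\<Sum>m\<in>UNIV. \<Sum>n\<in>UNIV. \<Sum>k\<in>UNIV. \<Sum>j\<in>UNIV. K $ m $ j * C $ j $ k * K $ n $ k * f m n)"
    by (rule sum.cong[OF refl], rule sum.cong[OF refl], rule sum.swap)
  also have "\<dots> = (\<Sum>m\<in>UNIV. \<Sum>n\<in>UNIV. (K ** C ** transpose K) $ m $ n * f m n)"
    by (simp add: matrix_matrix_mult_def transpose_def sum_distrib_right)
  finally show ?thesis .
qed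

context tracial_space
begin

lemma bilin_limit:
  assumes "\<And>k. bilin (D k)" "\<And>a b. a \<in> M \<Longrightarrow> b \<in> M \<Longrightarrow> (\<lambda>k. D k a b) \<longlonglongrightarrow> D' a b"
  shows "bilin D'"
proof (rule bilinI)
  note B = bilinD[OF assms(1)] and L = assms(2)
  fix a b c assume M: "a \<in> M" "b \<in> M"
  have "(\<lambda>k. c * D k a b) \<longlonglongrightarrow> D' (op_scaleC c a) b"
    using L[OF M_sc[OF M(1)] M(2), of c] by (simp add: B M)
  then show "D' (op_scaleC c a) b = c * D' a b"
    using LIMSEQ_unique[OF _ tendsto_mult[OF tendsto_const L[OF M]]] by blast
  have "(\<lambda>k. c * D k b a) \<longlonglongrightarrow> D' b (op_scaleC c a)"
    using L[OF M(2) M_sc[OF M(1)], of c] by (simp add: B M)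
  then show "D' b (op_scaleC c a) = c * D' b a"
    using LIMSEQ_unique[OF _ tendsto_mult[OF tendsto_const L[OF M(2,1)]]] by blast
  fix a' assume M': "a' \<in> M"
  have "(\<lambda>k. D k a b + D k a' b) \<longlonglongrightarrow> D' (a + a') b"
    using L[OF M_add[OF M(1) M'] M(2)] by (simp add: B M M')
  then show "D' (a + a') b = D' a b + D' a' b"
    using LIMSEQ_unique[OF _ tendsto_add[OF L[OF M] L[OF M' M(2)]]] by blast
  have "(\<lambda>k. D k b a + D k b a') \<longlonglongrightarrow> D' b (a + a')"
    using L[OF M(2) M_add[OF M(1) M']] by (simp add: B M M')
  then show "D' b (a + a') = D' b a + D' b a'"
    using LIMSEQ_unique[OF _ tendsto_add[OF L[OF M(2,1)] L[OF M(2) M']]] by blast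
qed

text \<open>The form that a vector \<open>G\<close> of the completed tensor product induces on elementary tensors.\<close>

definition tform :: "(nat \<Rightarrow> 'h tensor) \<Rightarrow> 'h oper \<Rightarrow> 'h oper \<Rightarrow> complex" where
  "tform G a b = hinner (tensor_inner \<tau>) G (\<lambda>_. Poly_Mapping.single (a, b) 1)"

lemma tform_LIMSEQ: "G \<in> t.Comp \<Longrightarrow> a \<in> M \<Longrightarrow> b \<in> M \<Longrightarrow>
    (\<lambda>k. tensor_inner \<tau> (G k) (Poly_Mapping.single (a, b) 1)) \<longlonglongrightarrow> tform G a b"
  unfolding tform_def by (intro t.hinner_const_right T_single)

lemma bilin_tform: "G \<in> t.Comp \<Longrightarrow> bilin (tform G)"
  by (rule bilin_limit[OF bilin_ti tform_LIMSEQ]) (auto intro: t.Comp_in)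

lemma tform_null:
  fixes X :: "'n \<Rightarrow> 'h oper"
  assumes XM: "\<And>i. X i \<in> M" and Xa: "\<And>i. adj (X i) = X i"
    and G: "(\<lambda>k. bipoly_eval X (g k)) \<in> t.Comp"
  shows "null_form (range (poly_eval X)) (tform (\<lambda>k. bipoly_eval X (g k)))"
  unfolding null_form_def
proof (intro ballI impI)
  fix a b assume M: "a \<in> M" "b \<in> M"
    and n: "null_wrt (range (poly_eval X)) a \<or> null_wrt (range (poly_eval X)) b"
  have idX: "id_blinfun \<in> range (poly_eval X)" using word_eval_in_poly[of X "[]"] by simp
  have "tensor_inner \<tau> (bipoly_eval X q) (Poly_Mapping.single (a, b) 1) = 0" for q
  proof (induction q rule: pm_induct)
    case zero
    then show ?case by (simp add: t.ip_zero_left T_single M)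
  next
    case (single x z)
    obtain v w where x: "x = (v, w)" by (cases x)
    have "\<tau> (adj (word_eval X v) o\<^sub>L a) * \<tau> (b o\<^sub>L adj (word_eval X w)) = 0"
      using n
    proof
      assume "null_wrt (range (poly_eval X)) a"
      then have "\<tau> (word_eval X (rev v) o\<^sub>L (a o\<^sub>L id_blinfun)) = 0"
        using word_eval_in_poly idX unfolding null_wrt_def by blast
      then show ?thesis by (simp add: adj_word_eval XM Xa)
    next
      assume "null_wrt (range (poly_eval X)) b"
      then have "\<tau> (id_blinfun o\<^sub>L (b o\<^sub>L word_eval X (rev w))) = 0"
        using word_eval_in_poly idX unfolding null_wrt_def by blast
      then show ?thesis by (simp add: adj_word_eval XM Xa)
    qed
    then show ?case by (simp add: x bipoly_eval_single ti_single)
  next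
    case (add p q)
    then show ?case by (simp add: bipoly_eval_add t.ip_add_left bipoly_eval_T XM T_single M)
  qed
  then show "tform (\<lambda>k. bipoly_eval X (g k)) a b = 0"
    using tform_LIMSEQ[OF G M] by (simp add: LIMSEQ_const_iff)
qed

end

text \<open>The interpolation is \<open>Y = e(C) X + r(C) S\<close>; the condition \<open>e\<^sup>2 + r\<^sup>2 = 1\<close> on the spectrum makes
  \<open>V\<^sub>C\<close> the potential of its stationary law. Diagonalizing \<open>C\<close> once turns every matrix of the argument
  into a function of \<open>C\<close>.\<close>

locale interpolation = tracial_space M \<tau> + orthonormal_frame u d
  for M :: "'h::complex_hilbert oper set" and \<tau> and u :: "'n::finite \<Rightarrow> real^'n" and d +
  fixes X S :: "'n \<Rightarrow> 'h oper" and e r :: "real \<Rightarrow> real"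
  assumes X: "self_adjoint_tuple M X" and S: "semicircular_family M \<tau> (fc (\<lambda>x. x)) S"
    and free: "free_from \<tau> S X"
    and d_pos: "\<And>a. 0 < d a" and r_pos: "\<And>a. 0 < r (d a)"
    and e_r: "\<And>a. (e (d a))\<^sup>2 + (r (d a))\<^sup>2 = 1"
begin

abbreviation E where "E \<equiv> fc e"
abbreviation R where "R \<equiv> fc r"
abbreviation C where "C \<equiv> fc (\<lambda>x. x)"
abbreviation Cinv where "Cinv \<equiv> fc (\<lambda>x. 1 / x)"

text \<open>\<open>K = E R\<^sup>-\<^sup>1 C\<^sup>-\<^sup>1\<close>, the matrix that solves \<open>K C R = E\<close>.\<close>

definition K where "K = fc (\<lambda>x. e x / (r x * x))"

definition Y where "Y j = (\<Sum>m\<in>UNIV. E $ j $ m *\<^sub>R X m) + (\<Sum>m\<in>UNIV. R $ j $ m *\<^sub>R S m)"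

text \<open>\<open>\<theta> = C\<^sup>-\<^sup>1 X\<close> is the gradient of \<open>V\<^sub>C\<close> at \<open>X\<close>.\<close>

definition \<theta> where "\<theta> l = (\<Sum>m\<in>UNIV. Cinv $ l $ m *\<^sub>R X m)"

lemma XM: "X j \<in> M" and Xa: "adj (X j) = X j"
  using X by (auto simp: self_adjoint_tuple_def)

lemma SM: "S j \<in> M" and Sa: "adj (S j) = S j"
  using S by (auto simp: self_adjoint_tuple_def semicircular_family_def)

lemma YM: "Y j \<in> M"
  unfolding Y_def by (intro M_add M_sum M_scaleR XM SM)

lemma adj_real_sum:
  assumes "\<And>m. Z m \<in> M" "\<And>m. adj (Z m) = Z m"
  shows "adj (\<Sum>m\<in>I. c m *\<^sub>R Z m) = (\<Sum>m\<in>I. c m *\<^sub>R Z m)"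
proof (induction I rule: infinite_finite_induct)
  case (insert i I)
  have 1: "c i *\<^sub>R Z i \<in> bounded_ops" "(\<Sum>m\<in>I. c m *\<^sub>R Z m) \<in> bounded_ops"
    using assms(1) by (auto intro!: M_bounded M_scaleR M_sum)
  have "adj (c i *\<^sub>R Z i) = c i *\<^sub>R Z i"
    using adj_sc[OF M_bounded[OF assms(1)[of i]], of "complex_of_real (c i)"]
    by (simp add: op_scaleC_of_real assms(2))
  then show ?case using insert 1 by (simp add: adj_add)
qed (simp_all add: adj_zero)

lemma Ya: "adj (Y j) = Y j"
proof -
  have "(\<Sum>m\<in>UNIV. E $ j $ m *\<^sub>R X m) \<in> bounded_ops" "(\<Sum>m\<in>UNIV. R $ j $ m *\<^sub>R S m) \<in> bounded_ops"
    by (auto intro!: M_bounded M_scaleR M_sum XM SM)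
  then show ?thesis
    by (simp add: Y_def adj_add adj_real_sum[of X, OF XM Xa] adj_real_sum[of S, OF SM Sa])
qed

lemma Y_self_adjoint: "self_adjoint_tuple M Y"
  by (simp add: self_adjoint_tuple_def YM Ya)

lemma Y_marked:
  assumes "\<And>m. (X m, \<beta> m) \<in> malg G" "\<And>m. (S m, \<sigma> m) \<in> malg G"
  shows "(Y j, \<lambda>a b. (\<Sum>m\<in>UNIV. complex_of_real (E $ j $ m) * \<beta> m a b)
    + (\<Sum>m\<in>UNIV. complex_of_real (R $ j $ m) * \<sigma> m a b)) \<in> malg G"
  using malg_add[OF malg_sum[of UNIV X \<beta> G "\<lambda>m. E $ j $ m"] malg_sum[of UNIV S \<sigma> G "\<lambda>m. R $ j $ m"]] assms
  by (simp add: madd_def Y_def)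

lemma semicircular_ibp:
  "\<tau> (S i o\<^sub>L (word_eval X v o\<^sub>L (word_eval Y w o\<^sub>L word_eval X v')))
    = (\<Sum>k<length w. complex_of_real ((C ** R) $ i $ (w ! k))
        * (\<tau> (word_eval X v o\<^sub>L word_eval Y (take k w)) * \<tau> (word_eval Y (drop (Suc k) w) o\<^sub>L word_eval X v')))"
proof -
  let ?G = "range (\<lambda>j. (S j, \<lambda>a b. complex_of_real (C $ i $ j) * \<tau> a * \<tau> b)) \<union> range (\<lambda>j. (X j, \<lambda>a b. 0))"
  define D where "D j = (\<lambda>a b. (\<Sum>m\<in>UNIV. complex_of_real (E $ j $ m) * 0)
    + (\<Sum>m\<in>UNIV. complex_of_real (R $ j $ m) * (complex_of_real (C $ i $ m) * \<tau> a * \<tau> b)))" for j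
  have D: "D j a b = complex_of_real ((C ** R) $ i $ j) * (\<tau> a * \<tau> b)" for j a b
    by (simp add: D_def matrix_matrix_mult_def sum_distrib_left fc_symmetric[of r j] mult_ac)
  have "(Y j, D j) \<in> malg ?G" for j
    unfolding D_def by (rule Y_marked) (auto intro: malg_gen)
  moreover have "(word_eval X v, \<lambda>a b. 0) \<in> malg ?G" for v by (rule malg_word) simp
  ultimately have "set ((word_eval X v, \<lambda>a b. 0) # map (\<lambda>j. (Y j, D j)) w @ [(word_eval X v', \<lambda>a b. 0)]) \<subseteq> malg ?G"
    by auto
  from semicircular_integration_by_parts[OF X S free this]
  show ?thesis
    by (simp add: leibniz_append leibniz_map op_prod_append D o_def flip: word_eval_def)
qed

lemma two_semicirculars:
  "\<tau> (S i o\<^sub>L (word_eval X v o\<^sub>L (S j o\<^sub>L word_eval X v')))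
    = complex_of_real (C $ i $ j) * (\<tau> (word_eval X v) * \<tau> (word_eval X v'))"
proof -
  let ?G = "range (\<lambda>j. (S j, \<lambda>a b. complex_of_real (C $ i $ j) * \<tau> a * \<tau> b)) \<union> range (\<lambda>j. (X j, \<lambda>a b. 0))"
  have "(word_eval X v, \<lambda>a b. 0) \<in> malg ?G" for v by (rule malg_word) simp
  moreover have "(S j, \<lambda>a b. complex_of_real (C $ i $ j) * \<tau> a * \<tau> b) \<in> malg ?G" by (rule malg_gen) simp
  ultimately have "set [(word_eval X v, \<lambda>a b. 0), (S j, \<lambda>a b. complex_of_real (C $ i $ j) * \<tau> a * \<tau> b),
      (word_eval X v', \<lambda>a b. 0)] \<subseteq> malg ?G" by auto
  from semicircular_integration_by_parts[OF X S free this] show ?thesis by simp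
qed

text \<open>If \<open>t\<close> satisfies a Stein identity for words in \<open>X\<close>, it satisfies one for words in \<open>Y\<close>, because
  \<open>S\<close> is free from \<open>X\<close> and the derivation in \<open>X\<close> acts on \<open>Y\<close> through the matrix \<open>E\<close>.\<close>

lemma stein_ibp:
  assumes t: "t \<in> range (poly_eval X)"
    and D: "\<And>j. bilin (D j)" "\<And>j. null_form (range (poly_eval X)) (D j)"
    and words: "\<And>w. \<tau> (t o\<^sub>L word_eval X w)
      = (\<Sum>k<length w. D (w ! k) (word_eval X (take k w)) (word_eval X (drop (Suc k) w)))"
  shows "\<tau> (t o\<^sub>L word_eval Y w) = (\<Sum>k<length w. \<Sum>m\<in>UNIV. complex_of_real (E $ (w ! k) $ m)
    * D m (word_eval Y (take k w)) (word_eval Y (drop (Suc k) w)))"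
proof -
  let ?GX = "range (\<lambda>j. (X j, D j))" and ?GS = "range (\<lambda>j. (S j, \<lambda>a b. 0 :: complex))"
  define F where "F j = (\<lambda>a b. (\<Sum>m\<in>UNIV. complex_of_real (E $ j $ m) * D m a b)
    + (\<Sum>m\<in>UNIV. complex_of_real (R $ j $ m) * 0))" for j
  have "(Y j, F j) \<in> malg (?GX \<union> ?GS)" for j
    unfolding F_def by (rule Y_marked) (auto intro: malg_gen)
  then have L: "set (map (\<lambda>j. (Y j, F j)) w) \<subseteq> malg (?GX \<union> ?GS)" by auto
  have single: "Z j \<in> range (poly_eval Z)" for Z :: "'n \<Rightarrow> 'h oper" and j
    using word_eval_in_poly[of Z "[j]"] by simp
  have "defect t (map (\<lambda>j. (Y j, F j)) w) = 0"
  proof (rule free_integration_by_parts[OF subalg_poly_eval[of X, OF XM] subalg_poly_eval[of S, OF SM]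
        free_algs_sym[OF free_algs_poly_eval[OF free]] t _ _ _ _ L])
    show "\<tau> t = 0" using words[of "[]"] by simp
  next
    fix p assume "p \<in> ?GX"
    then show "valid p \<and> fst p \<in> range (poly_eval X) \<and> null_form (range (poly_eval X)) (snd p)"
      using D single by (auto simp: valid_def XM)
  next
    fix p assume "p \<in> ?GS"
    then show "fst p \<in> range (poly_eval S) \<and> snd p = (\<lambda>a b. 0)" using single by auto
  next
    fix L assume "set L \<subseteq> ?GX"
    then obtain w where "L = map (\<lambda>j. (X j, D j)) w" using range_list by blast
    then show "defect t L = 0" by (simp add: defect_map words)
  qed
  then show ?thesis by (simp add: defect_map F_def)
qed

text \<open>\<open>sharp q j\<close> replaces every \<open>a \<otimes> b\<close> in \<open>q\<close> by \<open>a S\<^sub>j b\<close>. It is isometric up to the covariance, and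
  its adjoint differentiates with respect to \<open>S\<^sub>j\<close>; this is how a kernel is turned into a score.\<close>

definition sharp :: "'n ncbipoly \<Rightarrow> 'n \<Rightarrow> 'h oper" where
  "sharp q j = pm_sum (\<lambda>x c. op_scaleC c (word_eval X (fst x) o\<^sub>L (S j o\<^sub>L word_eval X (snd x)))) q"

lemma sharp_zero [simp]: "sharp 0 j = 0"
  by (simp add: sharp_def)

lemma sharp_single: "sharp (Poly_Mapping.single (v, w) c) j
    = op_scaleC c (word_eval X v o\<^sub>L (S j o\<^sub>L word_eval X w))"
  by (simp add: sharp_def pm_sum_single)

lemma sharp_add: "sharp (p + q) j = sharp p j + sharp q j"
  unfolding sharp_def by (rule pm_sum_add) (simp_all add: op_scaleC_add_left)

lemma sharp_M: "sharp q j \<in> M"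
  unfolding sharp_def pm_sum_def by (intro M_sum M_sc M_comp word_eval_M XM SM)

lemma sharp_adj_word:
  assumes Z: "Z \<in> M"
  shows "inner2 \<tau> (word_eval X v o\<^sub>L (S j o\<^sub>L word_eval X w)) Z
    = \<tau> (S j o\<^sub>L (word_eval X (rev v) o\<^sub>L (Z o\<^sub>L word_eval X (rev w))))"
proof -
  have M: "word_eval X v \<in> M" for v by (rule word_eval_M) (rule XM)
  have "adj (word_eval X v o\<^sub>L (S j o\<^sub>L word_eval X w)) = (word_eval X (rev w) o\<^sub>L S j) o\<^sub>L word_eval X (rev v)"
    by (simp add: adj_comp M_bounded M SM M_comp adj_word_eval XM Xa Sa)
  then have "inner2 \<tau> (word_eval X v o\<^sub>L (S j o\<^sub>L word_eval X w)) Z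
      = \<tau> (word_eval X (rev w) o\<^sub>L (S j o\<^sub>L (word_eval X (rev v) o\<^sub>L Z)))"
    by (simp add: inner2_def comp_assoc_blinfun)
  also have "\<dots> = \<tau> ((S j o\<^sub>L (word_eval X (rev v) o\<^sub>L Z)) o\<^sub>L word_eval X (rev w))"
    by (intro tau_comm M_comp M SM Z)
  finally show ?thesis by (simp add: comp_assoc_blinfun)
qed

lemma inner_sharp_word:
  "inner2 \<tau> (sharp q j) (word_eval Y w) = (\<Sum>k<length w. complex_of_real ((C ** R) $ j $ (w ! k))
    * tensor_inner \<tau> (bipoly_eval X q)
        (Poly_Mapping.single (word_eval Y (take k w), word_eval Y (drop (Suc k) w)) 1))"
proof (induction q rule: pm_induct)
  case zero
  then show ?case
    by (simp add: m.ip_zero_left t.ip_zero_left T_single word_eval_M YM)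
next
  case (single x c)
  obtain v v' where x: "x = (v, v')" by (cases x)
  have M: "word_eval X v \<in> M" "word_eval Y v \<in> M" for v by (rule word_eval_M, rule XM YM)+
  show ?case
    by (simp add: x sharp_single m.ip_sc_left M SM M_comp sharp_adj_word semicircular_ibp
        bipoly_eval_single ti_single adj_word_eval XM Xa sum_distrib_left mult_ac)
next
  case (add p q)
  then show ?case
    by (simp add: sharp_add m.ip_add_left sharp_M word_eval_M YM bipoly_eval_add t.ip_add_left
        bipoly_eval_T XM T_single sum.distrib distrib_left)
qed

lemma inner_sharp_sharp:
  "inner2 \<tau> (sharp p i) (sharp q j)
    = complex_of_real (C $ i $ j) * tensor_inner \<tau> (bipoly_eval X p) (bipoly_eval X q)"
proof (induction p rule: pm_induct)
  case zero
  then show ?case by (simp add: m.ip_zero_left t.ip_zero_left sharp_M bipoly_eval_T XM)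
next
  case (single x c)
  obtain v v' where x: "x = (v, v')" by (cases x)
  have M: "word_eval X v \<in> M" for v by (rule word_eval_M, rule XM)
  show ?case
  proof (induction q rule: pm_induct)
    case zero
    then show ?case by (simp add: m.ip_zero t.ip_zero sharp_M bipoly_eval_T XM)
  next
    case (single y z)
    obtain w w' where y: "y = (w, w')" by (cases y)
    have "\<tau> (S i o\<^sub>L (word_eval X (rev v) o\<^sub>L ((word_eval X w o\<^sub>L (S j o\<^sub>L word_eval X w')) o\<^sub>L word_eval X (rev v'))))
        = \<tau> (S i o\<^sub>L (word_eval X (rev v @ w) o\<^sub>L (S j o\<^sub>L word_eval X (w' @ rev v'))))"
      by (simp add: word_eval_append comp_assoc_blinfun)
    also have "\<dots> = complex_of_real (C $ i $ j) * (\<tau> (word_eval X (rev v @ w)) * \<tau> (word_eval X (w' @ rev v')))"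
      by (rule two_semicirculars)
    finally show ?case
      by (simp add: x y sharp_single m.ip_sc_left m.ip_sc M SM M_comp M_sc sharp_adj_word
          bipoly_eval_single ti_single adj_word_eval XM Xa word_eval_append mult_ac)
  next
    case (add q q')
    then show ?case
      by (simp add: sharp_add m.ip_add sharp_M bipoly_eval_add ti_add_right distrib_left)
  qed
next
  case (add p p')
  then show ?case
    by (simp add: sharp_add m.ip_add_left sharp_M bipoly_eval_add t.ip_add_left bipoly_eval_T XM distrib_left)
qed

end

context semi_inner
begin

lemma ip_real_comb:
  assumes "\<And>m. h m \<in> K" "\<And>n. h' n \<in> K"
  shows "ip (\<Sum>m\<in>A. sc (complex_of_real (a m)) (h m)) (\<Sum>n\<in>B. sc (complex_of_real (b n)) (h' n))
    = (\<Sum>m\<in>A. \<Sum>n\<in>B. complex_of_real (a m * b n) * ip (h m) (h' n))"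
proof -
  have "ip (\<Sum>m\<in>A. sc (complex_of_real (a m)) (h m)) (\<Sum>n\<in>B. sc (complex_of_real (b n)) (h' n))
      = (\<Sum>m\<in>A. ip (sc (complex_of_real (a m)) (h m)) (\<Sum>n\<in>B. sc (complex_of_real (b n)) (h' n)))"
    by (intro ip_sum_left K_sum K_sc assms)
  also have "\<dots> = (\<Sum>m\<in>A. \<Sum>n\<in>B. ip (sc (complex_of_real (a m)) (h m)) (sc (complex_of_real (b n)) (h' n)))"
    by (intro sum.cong refl ip_sum K_sc assms)
  also have "\<dots> = (\<Sum>m\<in>A. \<Sum>n\<in>B. complex_of_real (a m * b n) * ip (h m) (h' n))"
    by (simp add: ip_sc ip_sc_left K_sc assms mult_ac)
  finally show ?thesis .
qed

lemma hinner_const_add: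
  assumes f: "f \<in> Comp" and K: "x \<in> K" "y \<in> K"
  shows "hinner ip f (\<lambda>_. x + y) = hinner ip f (\<lambda>_. x) + hinner ip f (\<lambda>_. y)"
proof (rule LIMSEQ_unique[OF hinner_const_right[OF f K_add[OF K]]])
  show "(\<lambda>k. ip (f k) (x + y)) \<longlonglongrightarrow> hinner ip f (\<lambda>_. x) + hinner ip f (\<lambda>_. y)"
    using tendsto_add[OF hinner_const_right[OF f K(1)] hinner_const_right[OF f K(2)]]
    by (simp add: ip_add Comp_in[OF f] K)
qed

lemma hinner_const_sc:
  assumes f: "f \<in> Comp" and K: "x \<in> K"
  shows "hinner ip f (\<lambda>_. sc c x) = c * hinner ip f (\<lambda>_. x)"
proof (rule LIMSEQ_unique[OF hinner_const_right[OF f K_sc[OF K]]])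
  show "(\<lambda>k. ip (f k) (sc c x)) \<longlonglongrightarrow> c * hinner ip f (\<lambda>_. x)"
    using tendsto_mult[OF tendsto_const hinner_const_right[OF f K], of c]
    by (simp add: ip_sc Comp_in[OF f] K)
qed

end

lemma sum_comp_left:
  fixes T :: "'i \<Rightarrow> 'h::real_normed_vector \<Rightarrow>\<^sub>L 'h" and Z :: "'h \<Rightarrow>\<^sub>L 'h"
  shows "(\<Sum>l\<in>I. c l *\<^sub>R T l) o\<^sub>L Z = (\<Sum>l\<in>I. c l *\<^sub>R (T l o\<^sub>L Z))"
proof -
  have scaleR_comp: "(x *\<^sub>R U) o\<^sub>L Z = x *\<^sub>R (U o\<^sub>L Z)" for x and U :: "'h \<Rightarrow>\<^sub>L 'h"
    by (rule blinfun_eqI) (simp add: blinfun.scaleR_left)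
  show ?thesis
    by (induction I rule: infinite_finite_induct) (simp_all add: comp_add_left scaleR_comp)
qed

lemma matrix_action_assoc:
  fixes A B :: "real^'n^'n::finite" and Z :: "'n \<Rightarrow> 'v::real_vector"
  shows "(\<Sum>l\<in>UNIV. A $ i $ l *\<^sub>R (\<Sum>m\<in>UNIV. B $ l $ m *\<^sub>R Z m)) = (\<Sum>m\<in>UNIV. (A ** B) $ i $ m *\<^sub>R Z m)"
proof -
  have "(\<Sum>l\<in>UNIV. A $ i $ l *\<^sub>R (\<Sum>m\<in>UNIV. B $ l $ m *\<^sub>R Z m))
      = (\<Sum>l\<in>UNIV. \<Sum>m\<in>UNIV. (A $ i $ l * B $ l $ m) *\<^sub>R Z m)"
    by (simp add: scaleR_sum_right)
  also have "\<dots> = (\<Sum>m\<in>UNIV. \<Sum>l\<in>UNIV. (A $ i $ l * B $ l $ m) *\<^sub>R Z m)" by (rule sum.swap)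
  also have "\<dots> = (\<Sum>m\<in>UNIV. (A ** B) $ i $ m *\<^sub>R Z m)"
    by (simp add: matrix_matrix_mult_def scaleR_sum_left)
  finally show ?thesis .
qed

lemma bipoly_eval_diff: "bipoly_eval X (p - q) = bipoly_eval X p - bipoly_eval X q"
  using bipoly_eval_add[of X p "- q"] bipoly_eval_scale[of X "-1" q] by (simp add: pm_scale_minus_one)

context interpolation
begin

definition ipX :: "'n ncbipoly \<Rightarrow> 'n ncbipoly \<Rightarrow> complex" where
  "ipX = (\<lambda>p q. tensor_inner \<tau> (bipoly_eval X p) (bipoly_eval X q))"

lemma ipX_semi_inner: "semi_inner UNIV pm_scale ipX"
  unfolding ipX_def
  by (rule t.pullback[of "bipoly_eval X"])
    (simp_all add: bipoly_eval_T XM bipoly_eval_add bipoly_eval_scale pm_scale_minus_one)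

sublocale vx: semi_inner UNIV pm_scale ipX
  by (rule ipX_semi_inner)

lemma vx_nrm: "vx.nrm p = t.nrm (bipoly_eval X p)"
  by (simp add: semi_norm_def ipX_def)

lemma vx_Comp: "g \<in> vx.Comp \<Longrightarrow> (\<lambda>k. bipoly_eval X (g k)) \<in> t.Comp"
  by (simp add: hcompletion_def bipoly_eval_T XM vx_nrm bipoly_eval_diff)

text \<open>A kernel lives over all of \<open>M\<close>, while freeness concerns polynomials in \<open>X\<close> and \<open>S\<close>. Projecting it
  onto the span of \<open>\<complex>\<langle>X\<rangle> \<otimes> \<complex>\<langle>X\<rangle>\<^sup>o\<^sup>p\<close> keeps its pairing with that span and does not increase its norm.\<close>

lemma project_to_X:
  assumes \<Delta>: "\<Delta> \<in> t.Comp"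
  obtains g where "g \<in> vx.Comp" "hnorm ipX g \<le> hnorm (tensor_inner \<tau>) \<Delta>"
    "\<And>v w. tform (\<lambda>k. bipoly_eval X (g k)) (word_eval X v) (word_eval X w)
      = tform \<Delta> (word_eval X v) (word_eval X w)"
proof -
  note bT = bipoly_eval_T[of X, OF XM]
  obtain g where g: "g \<in> vx.Comp" "\<And>q. (\<lambda>k. ipX (g k) q) \<longlonglongrightarrow> hinner (tensor_inner \<tau>) \<Delta> (\<lambda>_. bipoly_eval X q)"
    "hnorm ipX g \<le> hnorm (tensor_inner \<tau>) \<Delta>"
  proof (rule vx.Riesz[of "\<lambda>q. hinner (tensor_inner \<tau>) \<Delta> (\<lambda>_. bipoly_eval X q)" "hnorm (tensor_inner \<tau>) \<Delta>"])
    show "cmod (hinner (tensor_inner \<tau>) \<Delta> (\<lambda>_. bipoly_eval X q)) \<le> hnorm (tensor_inner \<tau>) \<Delta> * vx.nrm q" for q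
      using t.hinner_Cauchy_Schwarz[OF \<Delta> t.Comp_const[OF bT], of q] by (simp add: t.hnorm_const vx_nrm)
    show "0 \<le> hnorm (tensor_inner \<tau>) \<Delta>" by (rule t.hnorm_nonneg[OF \<Delta>])
  qed (simp_all add: bipoly_eval_add bipoly_eval_scale t.hinner_const_add t.hinner_const_sc \<Delta> bT)
  have "tform (\<lambda>k. bipoly_eval X (g k)) (word_eval X v) (word_eval X w)
      = tform \<Delta> (word_eval X v) (word_eval X w)" for v w
  proof -
    have "(\<lambda>k. ipX (g k) (Poly_Mapping.single (v, w) 1)) \<longlonglongrightarrow> tform \<Delta> (word_eval X v) (word_eval X w)"
      using g(2)[of "Poly_Mapping.single (v, w) 1"] by (simp add: tform_def bipoly_eval_single)
    moreover have "(\<lambda>k. ipX (g k) (Poly_Mapping.single (v, w) 1))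
        \<longlonglongrightarrow> tform (\<lambda>k. bipoly_eval X (g k)) (word_eval X v) (word_eval X w)"
      using tform_LIMSEQ[OF vx_Comp[OF g(1)] word_eval_M[of X v, OF XM] word_eval_M[of X w, OF XM]]
      by (simp add: ipX_def bipoly_eval_single)
    ultimately show ?thesis using LIMSEQ_unique by blast
  qed
  then show thesis using that g by blast
qed

text \<open>Stein's identity for \<open>X\<close> contributes \<open>E\<^sup>2\<close> and the semicircular family \<open>C\<^sup>-\<^sup>1 R C R\<close> to the
  coefficient of \<open>1 \<otimes> 1\<close>; their sum is the identity, so the score only sees the centred kernel.\<close>

lemma E_R_identity: "(E ** E) $ i $ j + ((Cinv ** R) ** (C ** R)) $ i $ j = (if i = j then 1 else 0)"
proof -
  have "E ** E + (Cinv ** R) ** (C ** R) = fc (\<lambda>_. 1)"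
    unfolding fc_mult fc_add using d_pos e_r
    by (intro fc_cong) (simp add: less_imp_neq[symmetric] power2_eq_square)
  then have "(E ** E + (Cinv ** R) ** (C ** R)) $ i $ j = mat 1 $ i $ j" by (simp only: fc_one)
  then show ?thesis by (simp add: mat_def)
qed

lemma K_C_R: "K ** (C ** R) = E"
  unfolding K_def fc_mult using d_pos r_pos by (intro fc_cong) (simp add: less_imp_neq[symmetric])

text \<open>\<open>W = C\<^sup>-\<^sup>1 Y\<close> is the gradient of \<open>V\<^sub>C\<close> at \<open>Y\<close>.\<close>

definition W where "W i = (\<Sum>l\<in>UNIV. Cinv $ i $ l *\<^sub>R Y l)"

lemma W_eq: "W i = (\<Sum>l\<in>UNIV. E $ i $ l *\<^sub>R \<theta> l) + (\<Sum>l\<in>UNIV. (Cinv ** R) $ i $ l *\<^sub>R S l)"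
proof -
  have comm: "Cinv ** E = E ** Cinv" by (simp add: fc_mult mult.commute)
  have "W i = (\<Sum>l\<in>UNIV. Cinv $ i $ l *\<^sub>R (\<Sum>m\<in>UNIV. E $ l $ m *\<^sub>R X m))
      + (\<Sum>l\<in>UNIV. Cinv $ i $ l *\<^sub>R (\<Sum>m\<in>UNIV. R $ l $ m *\<^sub>R S m))"
    by (simp add: W_def Y_def scaleR_add_right sum.distrib)
  then show ?thesis
    unfolding \<theta>_def matrix_action_assoc comm .
qed

lemma \<theta>M: "\<theta> l \<in> M"
  unfolding \<theta>_def by (intro M_sum M_scaleR XM)

lemma WM: "W i \<in> M"
  unfolding W_def by (intro M_sum M_scaleR YM)

lemma inner_W:
  assumes Z: "Z \<in> M"
  shows "inner2 \<tau> (W i) Z = (\<Sum>l\<in>UNIV. complex_of_real (E $ i $ l) * \<tau> (\<theta> l o\<^sub>L Z))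
    + (\<Sum>l\<in>UNIV. complex_of_real ((Cinv ** R) $ i $ l) * \<tau> (S l o\<^sub>L Z))"
proof -
  have "adj (W i) = W i" unfolding W_def by (rule adj_real_sum[of Y, OF YM Ya])
  then have "inner2 \<tau> (W i) Z = \<tau> (W i o\<^sub>L Z)" by (simp add: inner2_def)
  also have "\<dots> = \<tau> ((\<Sum>l\<in>UNIV. E $ i $ l *\<^sub>R (\<theta> l o\<^sub>L Z)) + (\<Sum>l\<in>UNIV. (Cinv ** R) $ i $ l *\<^sub>R (S l o\<^sub>L Z)))"
    unfolding W_eq comp_add_left sum_comp_left ..
  also have "\<dots> = \<tau> (\<Sum>l\<in>UNIV. E $ i $ l *\<^sub>R (\<theta> l o\<^sub>L Z)) + \<tau> (\<Sum>l\<in>UNIV. (Cinv ** R) $ i $ l *\<^sub>R (S l o\<^sub>L Z))"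
    by (intro tau_add M_sum M_scaleR M_comp \<theta>M SM Z)
  finally show ?thesis
    using Z by (simp add: tau_sum tau_scaleR M_scaleR M_comp \<theta>M SM)
qed

text \<open>The score \<open>C\<^sup>-\<^sup>1 Y - \<xi>\<close> of the interpolation, where \<open>\<xi>\<close> are the conjugate variables, is represented
  by the vectors \<open>\<eta>\<close> obtained from the projected centred kernel \<open>G\<close> of \<open>X\<close> by
  \<open>\<eta> = (E G K) # S\<close>: integration by parts in \<open>X\<close> produces \<open>E G E\<close>, integration by parts in \<open>S\<close> would
  produce \<open>E G K C R\<close>, and \<open>K C R = E\<close>.\<close>

theorem score_bound:
  assumes \<Delta>: "\<And>l j. \<Delta> l j \<in> t.Comp"
    and kernel: "\<And>l w. \<tau> (\<theta> l o\<^sub>L word_eval X w) = (\<Sum>k<length w.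
        tform (\<Delta> l (w ! k)) (word_eval X (take k w)) (word_eval X (drop (Suc k) w))
        + (if l = w ! k then \<tau> (word_eval X (take k w)) * \<tau> (word_eval X (drop (Suc k) w)) else 0))"
    and c1: "\<And>a. (e (d a))\<^sup>2 / ((r (d a))\<^sup>2 * d a) \<le> c1" and c2: "\<And>a. (e (d a))\<^sup>2 \<le> c2"
  obtains N where "\<And>i. 0 \<le> N i"
    "(\<Sum>i\<in>UNIV. N i) \<le> c1 * c2 * (\<Sum>l\<in>UNIV. \<Sum>j\<in>UNIV. (hnorm (tensor_inner \<tau>) (\<Delta> l j))\<^sup>2)"
    "\<And>i p. cmod (inner2 \<tau> (W i) (poly_eval Y p) - tensor_inner \<tau> tensor_one (bipoly_eval Y (free_diff i p)))
      \<le> sqrt (N i) * m.nrm (poly_eval Y p)"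
proof -
  have "\<exists>g. g \<in> vx.Comp \<and> hnorm ipX g \<le> hnorm (tensor_inner \<tau>) (\<Delta> l j) \<and>
      (\<forall>v w. tform (\<lambda>k. bipoly_eval X (g k)) (word_eval X v) (word_eval X w)
        = tform (\<Delta> l j) (word_eval X v) (word_eval X w))" for l j
    using project_to_X[OF \<Delta>[of l j]] by metis
  then obtain g where gC: "\<And>l j. g l j \<in> vx.Comp"
    and gN: "\<And>l j. hnorm ipX (g l j) \<le> hnorm (tensor_inner \<tau>) (\<Delta> l j)"
    and gW: "\<And>l j v w. tform (\<lambda>k. bipoly_eval X (g l j k)) (word_eval X v) (word_eval X w)
        = tform (\<Delta> l j) (word_eval X v) (word_eval X w)" by metis
  define G where "G l j k = bipoly_eval X (g l j k)" for l j k
  have GC: "G l j \<in> t.Comp" for l j unfolding G_def by (rule vx_Comp[OF gC])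
  have GT: "G l j k \<in> alg_tensor_op M" for l j k unfolding G_def by (rule bipoly_eval_T) (rule XM)
  have Gfun: "G l j = (\<lambda>k. bipoly_eval X (g l j k))" for l j by (rule ext) (simp add: G_def)
  note wM = word_eval_M[of Y, OF YM]
  note pM = poly_eval_M[of Y, OF YM]
  define tt where "tt w k = \<tau> (word_eval Y (take k w)) * \<tau> (word_eval Y (drop (Suc k) w))" for w k
  define P where "P w k = Poly_Mapping.single (word_eval Y (take k w), word_eval Y (drop (Suc k) w)) (1 :: complex)"
    for w k
  have PT: "P w k \<in> alg_tensor_op M" for w k unfolding P_def by (intro T_single wM)
  define \<gamma> where "\<gamma> l m w k = tform (G l m) (word_eval Y (take k w)) (word_eval Y (drop (Suc k) w))" for l m w k
  have \<gamma>_lim: "(\<lambda>n. tensor_inner \<tau> (G l m n) (P w k)) \<longlonglongrightarrow> \<gamma> l m w k" for l m w k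
    unfolding \<gamma>_def P_def by (rule tform_LIMSEQ[OF GC wM wM])
  have stein: "\<tau> (\<theta> l o\<^sub>L word_eval Y w) = (\<Sum>k<length w.
      (\<Sum>m\<in>UNIV. complex_of_real (E $ (w ! k) $ m) * \<gamma> l m w k) + complex_of_real (E $ (w ! k) $ l) * tt w k)" for l w
  proof -
    define D where "D m = (\<lambda>a b. tform (G l m) a b + (if l = m then 1 else 0) * \<tau> a * \<tau> b)" for m
    have idX: "id_blinfun \<in> range (poly_eval X)" using word_eval_in_poly[of X "[]"] by simp
    have "\<tau> (\<theta> l o\<^sub>L word_eval Y w) = (\<Sum>k<length w. \<Sum>m\<in>UNIV. complex_of_real (E $ (w ! k) $ m)
        * D m (word_eval Y (take k w)) (word_eval Y (drop (Suc k) w)))"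
    proof (rule stein_ibp)
      have "poly_eval X (\<Sum>m\<in>UNIV. Poly_Mapping.single [m] (complex_of_real (Cinv $ l $ m))) = \<theta> l"
        by (simp add: poly_eval_sum poly_eval_single op_scaleC_of_real \<theta>_def)
      then show "\<theta> l \<in> range (poly_eval X)" by (metis rangeI)
      show "bilin (D m)" for m
      proof (rule bilinI)
        note B = bilinD[OF bilin_tform[OF GC]]
        fix a b c assume M: "a \<in> M" "b \<in> M"
        show "D m (op_scaleC c a) b = c * D m a b" "D m b (op_scaleC c a) = c * D m b a"
          by (simp_all add: D_def B M tau_sc algebra_simps)
        fix a' assume M': "a' \<in> M"
        show "D m (a + a') b = D m a b + D m a' b" "D m b (a + a') = D m b a + D m b a'"
          by (simp_all add: D_def B M M' tau_add algebra_simps)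
      qed
      show "null_form (range (poly_eval X)) (D m)" for m
        unfolding null_form_def
      proof (intro ballI impI)
        fix a b assume M: "a \<in> M" "b \<in> M"
          and n: "null_wrt (range (poly_eval X)) a \<or> null_wrt (range (poly_eval X)) b"
        have z: "\<tau> x = 0" if "null_wrt (range (poly_eval X)) x" for x
        proof -
          have "\<tau> (id_blinfun o\<^sub>L (x o\<^sub>L id_blinfun)) = 0" using that idX unfolding null_wrt_def by blast
          then show ?thesis by simp
        qed
        have "tform (G l m) a b = 0"
          using tform_null[of X "g l m", OF XM Xa vx_Comp[OF gC]] n M unfolding null_form_def Gfun by blast
        moreover have "\<tau> a = 0 \<or> \<tau> b = 0" using n z by blast
        ultimately show "D m a b = 0" by (auto simp: D_def)
      qed
      show "\<tau> (\<theta> l o\<^sub>L word_eval X w)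
          = (\<Sum>k<length w. D (w ! k) (word_eval X (take k w)) (word_eval X (drop (Suc k) w)))" for w
        unfolding kernel D_def Gfun gW by (intro sum.cong) auto
    qed
    also have "\<dots> = (\<Sum>k<length w.
        (\<Sum>m\<in>UNIV. complex_of_real (E $ (w ! k) $ m) * \<gamma> l m w k) + complex_of_real (E $ (w ! k) $ l) * tt w k)"
    proof (rule sum.cong[OF refl])
      fix k
      have "(\<Sum>m\<in>UNIV. complex_of_real (E $ (w ! k) $ m) * D m (word_eval Y (take k w)) (word_eval Y (drop (Suc k) w)))
          = (\<Sum>m\<in>UNIV. complex_of_real (E $ (w ! k) $ m) * \<gamma> l m w k
              + (if l = m then complex_of_real (E $ (w ! k) $ m) * tt w k else 0))"
        by (intro sum.cong refl) (simp add: D_def \<gamma>_def tt_def algebra_simps)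
      also have "\<dots> = (\<Sum>m\<in>UNIV. complex_of_real (E $ (w ! k) $ m) * \<gamma> l m w k) + complex_of_real (E $ (w ! k) $ l) * tt w k"
        by (simp add: sum.distrib)
      finally show "(\<Sum>m\<in>UNIV. complex_of_real (E $ (w ! k) $ m) * D m (word_eval Y (take k w)) (word_eval Y (drop (Suc k) w)))
          = (\<Sum>m\<in>UNIV. complex_of_real (E $ (w ! k) $ m) * \<gamma> l m w k) + complex_of_real (E $ (w ! k) $ l) * tt w k" .
    qed
    finally show ?thesis .
  qed
  have semi: "\<tau> (S l o\<^sub>L word_eval Y w) = (\<Sum>k<length w. complex_of_real ((C ** R) $ l $ (w ! k)) * tt w k)" for l w
    using semicircular_ibp[of l "[]" w "[]"] by (simp add: tt_def)
  define \<phi> where "\<phi> i p = inner2 \<tau> (W i) (poly_eval Y p) - tensor_inner \<tau> tensor_one (bipoly_eval Y (free_diff i p))"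
    for i p
  have one_word: "tensor_inner \<tau> tensor_one (bipoly_eval Y (free_diff i (Poly_Mapping.single w 1)))
      = (\<Sum>k<length w. if i = w ! k then tt w k else 0)" for i w
  proof -
    have set_eq: "{k. k < length w \<and> w ! k = i} = {k \<in> {..<length w}. i = w ! k}" by auto
    have "tensor_inner \<tau> tensor_one (bipoly_eval Y (free_diff i (Poly_Mapping.single w 1)))
        = (\<Sum>k | k < length w \<and> w ! k = i. tensor_inner \<tau> tensor_one (P w k))"
      unfolding bipoly_eval_free_diff_word P_def[symmetric]
      by (rule t.ip_sum) (simp_all add: tensor_one_T PT)
    also have "\<dots> = (\<Sum>k | k < length w \<and> w ! k = i. tt w k)"
      by (simp add: P_def ti_tensor_one tt_def)
    finally show ?thesis by (simp only: set_eq sum.inter_filter[OF finite_lessThan])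
  qed
  have \<phi>_word: "\<phi> i (Poly_Mapping.single w 1)
      = (\<Sum>k<length w. \<Sum>m\<in>UNIV. complex_of_real (E $ (w ! k) $ m) * (\<Sum>l\<in>UNIV. complex_of_real (E $ i $ l) * \<gamma> l m w k))"
    for i w
  proof -
    have "inner2 \<tau> (W i) (word_eval Y w)
        = (\<Sum>l\<in>UNIV. complex_of_real (E $ i $ l) * (\<Sum>k<length w. (\<Sum>m\<in>UNIV. complex_of_real (E $ (w ! k) $ m) * \<gamma> l m w k)
            + complex_of_real (E $ (w ! k) $ l) * tt w k))
        + (\<Sum>l\<in>UNIV. complex_of_real ((Cinv ** R) $ i $ l) * (\<Sum>k<length w. complex_of_real ((C ** R) $ l $ (w ! k)) * tt w k))"
      unfolding inner_W[OF wM] stein semi ..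
    also have "\<dots> = (\<Sum>l\<in>UNIV. \<Sum>k<length w. complex_of_real (E $ i $ l) * (\<Sum>m\<in>UNIV. complex_of_real (E $ (w ! k) $ m) * \<gamma> l m w k)
            + complex_of_real (E $ i $ l) * complex_of_real (E $ (w ! k) $ l) * tt w k
            + complex_of_real ((Cinv ** R) $ i $ l) * complex_of_real ((C ** R) $ l $ (w ! k)) * tt w k)"
      by (simp add: sum_distrib_left distrib_left sum.distrib mult.assoc)
    also have "\<dots> = (\<Sum>k<length w. \<Sum>l\<in>UNIV. complex_of_real (E $ i $ l) * (\<Sum>m\<in>UNIV. complex_of_real (E $ (w ! k) $ m) * \<gamma> l m w k)
            + complex_of_real (E $ i $ l) * complex_of_real (E $ (w ! k) $ l) * tt w k
            + complex_of_real ((Cinv ** R) $ i $ l) * complex_of_real ((C ** R) $ l $ (w ! k)) * tt w k)"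
      by (rule sum.swap)
    also have "\<dots> = (\<Sum>k<length w. (\<Sum>m\<in>UNIV. complex_of_real (E $ (w ! k) $ m) * (\<Sum>l\<in>UNIV. complex_of_real (E $ i $ l) * \<gamma> l m w k))
            + (if i = w ! k then tt w k else 0))"
    proof (rule sum.cong[OF refl])
      fix k
      let ?j = "w ! k"
      have 1: "(\<Sum>l\<in>UNIV. complex_of_real (E $ i $ l) * (\<Sum>m\<in>UNIV. complex_of_real (E $ ?j $ m) * \<gamma> l m w k))
          = (\<Sum>m\<in>UNIV. complex_of_real (E $ ?j $ m) * (\<Sum>l\<in>UNIV. complex_of_real (E $ i $ l) * \<gamma> l m w k))"
      proof -
        have "(\<Sum>l\<in>UNIV. complex_of_real (E $ i $ l) * (\<Sum>m\<in>UNIV. complex_of_real (E $ ?j $ m) * \<gamma> l m w k))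
            = (\<Sum>l\<in>UNIV. \<Sum>m\<in>UNIV. complex_of_real (E $ ?j $ m) * (complex_of_real (E $ i $ l) * \<gamma> l m w k))"
          by (simp add: sum_distrib_left mult.left_commute)
        also have "\<dots> = (\<Sum>m\<in>UNIV. \<Sum>l\<in>UNIV. complex_of_real (E $ ?j $ m) * (complex_of_real (E $ i $ l) * \<gamma> l m w k))"
          by (rule sum.swap)
        finally show ?thesis by (simp add: sum_distrib_left)
      qed
      have "(\<Sum>l\<in>UNIV. complex_of_real (E $ i $ l) * complex_of_real (E $ ?j $ l) * tt w k)
          + (\<Sum>l\<in>UNIV. complex_of_real ((Cinv ** R) $ i $ l) * complex_of_real ((C ** R) $ l $ ?j) * tt w k)
          = complex_of_real ((\<Sum>l\<in>UNIV. E $ i $ l * E $ l $ ?j) + (\<Sum>l\<in>UNIV. (Cinv ** R) $ i $ l * (C ** R) $ l $ ?j)) * tt w k"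
        by (simp add: sum_distrib_right distrib_right fc_symmetric[of e ?j])
      also have "(\<Sum>l\<in>UNIV. E $ i $ l * E $ l $ ?j) + (\<Sum>l\<in>UNIV. (Cinv ** R) $ i $ l * (C ** R) $ l $ ?j)
          = (E ** E) $ i $ ?j + ((Cinv ** R) ** (C ** R)) $ i $ ?j"
        by (simp add: matrix_matrix_mult_def[of E] matrix_matrix_mult_def[of "Cinv ** R"])
      finally have 2: "(\<Sum>l\<in>UNIV. complex_of_real (E $ i $ l) * complex_of_real (E $ ?j $ l) * tt w k)
          + (\<Sum>l\<in>UNIV. complex_of_real ((Cinv ** R) $ i $ l) * complex_of_real ((C ** R) $ l $ ?j) * tt w k)
          = (if i = ?j then tt w k else 0)"
        unfolding E_R_identity by simp
      show "(\<Sum>l\<in>UNIV. complex_of_real (E $ i $ l) * (\<Sum>m\<in>UNIV. complex_of_real (E $ ?j $ m) * \<gamma> l m w k)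
            + complex_of_real (E $ i $ l) * complex_of_real (E $ ?j $ l) * tt w k
            + complex_of_real ((Cinv ** R) $ i $ l) * complex_of_real ((C ** R) $ l $ ?j) * tt w k)
          = (\<Sum>m\<in>UNIV. complex_of_real (E $ ?j $ m) * (\<Sum>l\<in>UNIV. complex_of_real (E $ i $ l) * \<gamma> l m w k))
            + (if i = ?j then tt w k else 0)"
        unfolding sum.distrib 1 add.assoc 2 ..
    qed
    finally show ?thesis by (simp add: \<phi>_def one_word poly_eval_single sum.distrib)
  qed
  define H where "H i m n = (\<Sum>l\<in>UNIV. pm_scale (complex_of_real (E $ i $ l)) (g l m n))" for i m n
  define h where "h i j n = (\<Sum>m\<in>UNIV. pm_scale (complex_of_real (K $ m $ j)) (H i m n))" for i j n
  define \<eta> where "\<eta> i n = (\<Sum>j\<in>UNIV. sharp (h i j n) j)" for i n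
  have \<eta>M: "\<eta> i n \<in> M" for i n unfolding \<eta>_def by (intro M_sum sharp_M)
  have ti_comb: "tensor_inner \<tau> (bipoly_eval X (\<Sum>m\<in>UNIV. pm_scale (complex_of_real (c m)) (f m))) Z
      = (\<Sum>m\<in>UNIV. complex_of_real (c m) * tensor_inner \<tau> (bipoly_eval X (f m)) Z)"
    if "Z \<in> alg_tensor_op M" for c and f :: "'n \<Rightarrow> 'n ncbipoly" and Z
  proof -
    have T: "bipoly_eval X q \<in> alg_tensor_op M" for q by (rule bipoly_eval_T) (rule XM)
    have "tensor_inner \<tau> (\<Sum>m\<in>UNIV. pm_scale (complex_of_real (c m)) (bipoly_eval X (f m))) Z
        = (\<Sum>m\<in>UNIV. tensor_inner \<tau> (pm_scale (complex_of_real (c m)) (bipoly_eval X (f m))) Z)"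
      by (intro t.ip_sum_left that t.K_sc T)
    then show ?thesis by (simp add: bipoly_eval_sum bipoly_eval_scale t.ip_sc_left T that)
  qed
  have \<eta>_word: "inner2 \<tau> (\<eta> i n) (word_eval Y w)
      = (\<Sum>k<length w. \<Sum>m\<in>UNIV. complex_of_real (E $ (w ! k) $ m)
          * (\<Sum>l\<in>UNIV. complex_of_real (E $ i $ l) * tensor_inner \<tau> (G l m n) (P w k)))" for i n w
  proof -
    define s where "s m k = (\<Sum>l\<in>UNIV. complex_of_real (E $ i $ l) * tensor_inner \<tau> (G l m n) (P w k))" for m k
    have "inner2 \<tau> (\<eta> i n) (word_eval Y w) = (\<Sum>j\<in>UNIV. inner2 \<tau> (sharp (h i j n) j) (word_eval Y w))"
      unfolding \<eta>_def by (intro m.ip_sum_left wM sharp_M)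
    also have "\<dots> = (\<Sum>j\<in>UNIV. \<Sum>k<length w. complex_of_real ((C ** R) $ j $ (w ! k))
        * (\<Sum>m\<in>UNIV. complex_of_real (K $ m $ j) * s m k))"
      unfolding inner_sharp_word P_def[symmetric] h_def H_def s_def G_def by (simp only: ti_comb PT)
    also have "\<dots> = (\<Sum>k<length w. \<Sum>j\<in>UNIV. \<Sum>m\<in>UNIV. complex_of_real (K $ m $ j * (C ** R) $ j $ (w ! k)) * s m k)"
      by (subst sum.swap) (simp add: sum_distrib_left sum_distrib_right mult_ac)
    also have "\<dots> = (\<Sum>k<length w. \<Sum>m\<in>UNIV. \<Sum>j\<in>UNIV. complex_of_real (K $ m $ j * (C ** R) $ j $ (w ! k)) * s m k)"
      by (rule sum.cong[OF refl], rule sum.swap)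
    also have "\<dots> = (\<Sum>k<length w. \<Sum>m\<in>UNIV. complex_of_real ((K ** (C ** R)) $ m $ (w ! k)) * s m k)"
      by (simp add: matrix_matrix_mult_def[of K] sum_distrib_right)
    also have "\<dots> = (\<Sum>k<length w. \<Sum>m\<in>UNIV. complex_of_real (E $ (w ! k) $ m) * s m k)"
      unfolding K_C_R by (simp only: fc_symmetric[of e])
    finally show ?thesis by (simp only: s_def)
  qed
  have \<eta>_lim: "(\<lambda>n. inner2 \<tau> (\<eta> i n) (poly_eval Y p)) \<longlonglongrightarrow> \<phi> i p" for i p
  proof (induction p rule: pm_induct)
    case zero
    then show ?case by (simp add: \<phi>_def m.ip_zero \<eta>M WM t.ip_zero tensor_one_T)
  next
    case (single w c)
    have "(\<lambda>n. c * inner2 \<tau> (\<eta> i n) (word_eval Y w)) \<longlonglongrightarrow> c * \<phi> i (Poly_Mapping.single w 1)"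
      unfolding \<eta>_word \<phi>_word by (intro tendsto_intros \<gamma>_lim)
    moreover have "Poly_Mapping.single w c = pm_scale c (Poly_Mapping.single w 1)" by simp
    then have "\<phi> i (Poly_Mapping.single w c) = c * \<phi> i (Poly_Mapping.single w 1)"
      by (simp only: \<phi>_def poly_eval_scale m.ip_sc WM pM free_diff_scale bipoly_eval_scale
            ti_scale_right right_diff_distrib)
    ultimately show ?case by (simp add: poly_eval_single m.ip_sc \<eta>M wM)
  next
    case (add p q)
    have "\<phi> i (p + q) = \<phi> i p + \<phi> i q"
      by (simp add: \<phi>_def poly_eval_add m.ip_add WM pM free_diff_add bipoly_eval_add ti_add_right)
    then show ?case using tendsto_add[OF add] by (simp add: poly_eval_add m.ip_add \<eta>M pM)
  qed
  have KCK: "K ** C ** transpose K = fc (\<lambda>x. (e x / (r x * x)) * x * (e x / (r x * x)))"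
    unfolding K_def fc_transpose fc_mult ..
  have KCK_le: "e (d a) / (r (d a) * d a) * d a * (e (d a) / (r (d a) * d a)) \<le> c1" for a
  proof -
    have "e (d a) / (r (d a) * d a) * d a * (e (d a) / (r (d a) * d a)) = (e (d a))\<^sup>2 / ((r (d a))\<^sup>2 * d a)"
      using d_pos[of a] r_pos[of a] by (simp add: power2_eq_square)
    then show ?thesis using c1[of a] by simp
  qed
  have \<eta>_nrm: "(m.nrm (\<eta> i n))\<^sup>2
      = (\<Sum>m\<in>UNIV. \<Sum>m'\<in>UNIV. (K ** C ** transpose K) $ m $ m' * Re (ipX (H i m n) (H i m' n)))" for i n
  proof -
    have "inner2 \<tau> (\<eta> i n) (\<eta> i n) = (\<Sum>j\<in>UNIV. inner2 \<tau> (sharp (h i j n) j) (\<eta> i n))"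
      unfolding \<eta>_def by (intro m.ip_sum_left M_sum sharp_M)
    also have "\<dots> = (\<Sum>j\<in>UNIV. \<Sum>k\<in>UNIV. inner2 \<tau> (sharp (h i j n) j) (sharp (h i k n) k))"
      unfolding \<eta>_def by (intro sum.cong refl m.ip_sum sharp_M)
    also have "\<dots> = (\<Sum>j\<in>UNIV. \<Sum>k\<in>UNIV. complex_of_real (C $ j $ k) * ipX (h i j n) (h i k n))"
      by (simp add: inner_sharp_sharp ipX_def)
    also have "\<dots> = (\<Sum>j\<in>UNIV. \<Sum>k\<in>UNIV. complex_of_real (C $ j $ k)
        * (\<Sum>m\<in>UNIV. \<Sum>m'\<in>UNIV. complex_of_real (K $ m $ j * K $ m' $ k) * ipX (H i m n) (H i m' n)))"
      unfolding h_def by (simp only: vx.ip_real_comb[OF UNIV_I UNIV_I])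
    finally have "Re (inner2 \<tau> (\<eta> i n) (\<eta> i n)) = (\<Sum>j\<in>UNIV. \<Sum>k\<in>UNIV. C $ j $ k
        * (\<Sum>m\<in>UNIV. \<Sum>m'\<in>UNIV. K $ m $ j * K $ m' $ k * Re (ipX (H i m n) (H i m' n))))"
      by simp
    then show ?thesis by (simp only: m.nrm_sq[OF \<eta>M] quadratic_congruence)
  qed
  have H_ip: "ipX (H i m n) (H i m' n) = (\<Sum>l\<in>UNIV. \<Sum>l'\<in>UNIV. complex_of_real (E $ i $ l * E $ i $ l') * ipX (g l m n) (g l' m' n))"
    for i m m' n unfolding H_def by (rule vx.ip_real_comb) auto
  define N where "N i = (\<Sum>m\<in>UNIV. \<Sum>m'\<in>UNIV. (K ** C ** transpose K) $ m $ m'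
      * Re (\<Sum>l\<in>UNIV. \<Sum>l'\<in>UNIV. complex_of_real (E $ i $ l * E $ i $ l') * hinner ipX (g l m) (g l' m')))" for i
  have N_lim: "(\<lambda>n. (m.nrm (\<eta> i n))\<^sup>2) \<longlonglongrightarrow> N i" for i
    unfolding \<eta>_nrm H_ip N_def by (intro tendsto_intros vx.ip_Comp_LIMSEQ gC)
  have N0: "0 \<le> N i" for i by (rule LIMSEQ_le_const[OF N_lim]) simp
  have c1_nonneg: "0 \<le> c1"
  proof -
    have "0 \<le> (e (d undefined))\<^sup>2 / ((r (d undefined))\<^sup>2 * d undefined)"
      using d_pos by (intro divide_nonneg_nonneg mult_nonneg_nonneg) (auto intro: less_imp_le)
    then show ?thesis using c1[of undefined] by linarith
  qed
  have c2_nonneg: "0 \<le> c2" using c2[of undefined] zero_le_power2 order_trans by blast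
  have finite_bound: "(\<Sum>i\<in>UNIV. (m.nrm (\<eta> i n))\<^sup>2) \<le> c1 * c2 * (\<Sum>l\<in>UNIV. \<Sum>m\<in>UNIV. (vx.nrm (g l m n))\<^sup>2)" for n
  proof -
    have "(\<Sum>i\<in>UNIV. (m.nrm (\<eta> i n))\<^sup>2) \<le> (\<Sum>i\<in>UNIV. c1 * (\<Sum>m\<in>UNIV. (vx.nrm (H i m n))\<^sup>2))"
      unfolding \<eta>_nrm KCK
      by (intro sum_mono fc_gram_bound[OF ipX_semi_inner] UNIV_I KCK_le)
    also have "\<dots> = c1 * (\<Sum>m\<in>UNIV. \<Sum>i\<in>UNIV. (vx.nrm (H i m n))\<^sup>2)"
      by (subst sum.swap) (simp add: sum_distrib_left)
    also have "\<dots> \<le> c1 * (\<Sum>m\<in>UNIV. c2 * (\<Sum>l\<in>UNIV. (vx.nrm (g l m n))\<^sup>2))"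
    proof (intro mult_left_mono sum_mono c1_nonneg)
      fix m
      have "(\<Sum>i\<in>UNIV. (vx.nrm (H i m n))\<^sup>2)
          = (\<Sum>i\<in>UNIV. \<Sum>l\<in>UNIV. \<Sum>l'\<in>UNIV. E $ l $ i * E $ i $ l' * Re (ipX (g l m n) (g l' m n)))"
        by (simp add: vx.nrm_sq H_ip fc_symmetric[of e _ i for i])
      also have "\<dots> = (\<Sum>l\<in>UNIV. \<Sum>l'\<in>UNIV. \<Sum>i\<in>UNIV. E $ l $ i * E $ i $ l' * Re (ipX (g l m n) (g l' m n)))"
        by (subst sum.swap, rule sum.cong[OF refl], rule sum.swap)
      also have "\<dots> = (\<Sum>l\<in>UNIV. \<Sum>l'\<in>UNIV. (E ** E) $ l $ l' * Re (ipX (g l m n) (g l' m n)))"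
        by (simp add: matrix_matrix_mult_def sum_distrib_right)
      also have "\<dots> \<le> c2 * (\<Sum>l\<in>UNIV. (vx.nrm (g l m n))\<^sup>2)"
        unfolding fc_mult using c2
        by (intro fc_gram_bound[OF ipX_semi_inner]) (simp_all add: power2_eq_square)
      finally show "(\<Sum>i\<in>UNIV. (vx.nrm (H i m n))\<^sup>2) \<le> c2 * (\<Sum>l\<in>UNIV. (vx.nrm (g l m n))\<^sup>2)" .
    qed
    also have "\<dots> = c1 * c2 * (\<Sum>m\<in>UNIV. \<Sum>l\<in>UNIV. (vx.nrm (g l m n))\<^sup>2)"
      by (simp add: sum_distrib_left mult.assoc)
    also have "(\<Sum>m\<in>UNIV. \<Sum>l\<in>UNIV. (vx.nrm (g l m n))\<^sup>2) = (\<Sum>l\<in>UNIV. \<Sum>m\<in>UNIV. (vx.nrm (g l m n))\<^sup>2)"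
      by (rule sum.swap)
    finally show ?thesis .
  qed
  have "(\<Sum>i\<in>UNIV. N i) \<le> c1 * c2 * (\<Sum>l\<in>UNIV. \<Sum>m\<in>UNIV. (hnorm ipX (g l m))\<^sup>2)"
  proof (rule LIMSEQ_le)
    show "(\<lambda>n. \<Sum>i\<in>UNIV. (m.nrm (\<eta> i n))\<^sup>2) \<longlonglongrightarrow> (\<Sum>i\<in>UNIV. N i)"
      by (intro tendsto_sum N_lim)
    show "(\<lambda>n. c1 * c2 * (\<Sum>l\<in>UNIV. \<Sum>m\<in>UNIV. (vx.nrm (g l m n))\<^sup>2))
        \<longlonglongrightarrow> c1 * c2 * (\<Sum>l\<in>UNIV. \<Sum>m\<in>UNIV. (hnorm ipX (g l m))\<^sup>2)"
      by (intro tendsto_mult tendsto_const tendsto_sum vx.hnorm_sq gC)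
  qed (use finite_bound in blast)
  also have "\<dots> \<le> c1 * c2 * (\<Sum>l\<in>UNIV. \<Sum>j\<in>UNIV. (hnorm (tensor_inner \<tau>) (\<Delta> l j))\<^sup>2)"
    by (intro mult_left_mono sum_mono power_mono gN vx.hnorm_nonneg gC mult_nonneg_nonneg c1_nonneg c2_nonneg)
  finally have N_sum: "(\<Sum>i\<in>UNIV. N i) \<le> c1 * c2 * (\<Sum>l\<in>UNIV. \<Sum>j\<in>UNIV. (hnorm (tensor_inner \<tau>) (\<Delta> l j))\<^sup>2)" .
  have "cmod (\<phi> i p) \<le> sqrt (N i) * m.nrm (poly_eval Y p)" for i p
  proof (rule LIMSEQ_le[OF tendsto_norm[OF \<eta>_lim]])
    have "(\<lambda>n. sqrt ((m.nrm (\<eta> i n))\<^sup>2)) \<longlonglongrightarrow> sqrt (N i)" by (intro tendsto_real_sqrt N_lim)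
    then show "(\<lambda>n. m.nrm (\<eta> i n) * m.nrm (poly_eval Y p)) \<longlonglongrightarrow> sqrt (N i) * m.nrm (poly_eval Y p)"
      by (intro tendsto_mult tendsto_const) (simp add: m.nrm_nonneg \<eta>M)
    show "\<exists>n0. \<forall>n\<ge>n0. cmod (inner2 \<tau> (\<eta> i n) (poly_eval Y p)) \<le> m.nrm (\<eta> i n) * m.nrm (poly_eval Y p)"
      using m.Cauchy_Schwarz[OF \<eta>M pM] by blast
  qed
  then show thesis using that[OF N0 N_sum] unfolding \<phi>_def by blast
qed

end

section \<open>The smoothing estimate\<close>

lemma poly_eval_gaussian_gradient:
  fixes Z :: "'n::finite \<Rightarrow> 'h::complex_hilbert oper"
  assumes sym: "\<And>i j. matrix_inv C $ i $ j = matrix_inv C $ j $ i"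
  shows "poly_eval Z (cyclic_diff i (gaussian_potential C)) = (\<Sum>j\<in>UNIV. matrix_inv C $ i $ j *\<^sub>R Z j)"
proof -
  let ?c = "\<lambda>a b. matrix_inv C $ a $ b / 2"
  have "poly_eval Z (cyclic_diff i (gaussian_potential C))
      = (\<Sum>a\<in>UNIV. \<Sum>b\<in>UNIV. (if a = i then ?c a b *\<^sub>R Z b else 0) + (if b = i then ?c a b *\<^sub>R Z a else 0))"
    unfolding gaussian_potential_def cyclic_diff_sum poly_eval_sum cyclic_diff_quadratic
  proof (intro sum.cong refl)
    fix a b
    have "poly_eval Z (Poly_Mapping.single [j] (complex_of_real x)) = x *\<^sub>R Z j" for j x
      by (simp add: poly_eval_single op_scaleC_of_real)
    then show "poly_eval Z ((if a = i then Poly_Mapping.single [b] (complex_of_real (?c a b)) else 0)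
          + (if b = i then Poly_Mapping.single [a] (complex_of_real (?c a b)) else 0))
        = (if a = i then ?c a b *\<^sub>R Z b else 0) + (if b = i then ?c a b *\<^sub>R Z a else 0)"
      by (simp only: poly_eval_add poly_eval_zero if_distrib[of "poly_eval Z"])
  qed
  also have "\<dots> = (\<Sum>a\<in>UNIV. \<Sum>b\<in>UNIV. if a = i then ?c a b *\<^sub>R Z b else 0)
      + (\<Sum>a\<in>UNIV. \<Sum>b\<in>UNIV. if b = i then ?c a b *\<^sub>R Z a else 0)"
    by (simp only: sum.distrib)
  also have "(\<Sum>a\<in>UNIV. \<Sum>b\<in>UNIV. if a = i then ?c a b *\<^sub>R Z b else 0) = (\<Sum>b\<in>UNIV. ?c i b *\<^sub>R Z b)"
    by (subst sum.swap) simp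
  also have "(\<Sum>a\<in>UNIV. \<Sum>b\<in>UNIV. if b = i then ?c a b *\<^sub>R Z a else 0) = (\<Sum>a\<in>UNIV. ?c i a *\<^sub>R Z a)"
    by (simp add: sym[of _ i])
  also have "(\<Sum>b\<in>UNIV. ?c i b *\<^sub>R Z b) + (\<Sum>a\<in>UNIV. ?c i a *\<^sub>R Z a) = (\<Sum>j\<in>UNIV. matrix_inv C $ i $ j *\<^sub>R Z j)"
    by (simp add: sum.distrib[symmetric] scaleR_left_distrib[symmetric])
  finally show ?thesis .
qed

context tracial_space
begin

lemma hinner_const_sum:
  assumes f: "f \<in> t.Comp" and x: "\<And>i. i \<in> I \<Longrightarrow> x i \<in> alg_tensor_op M"
  shows "hinner (tensor_inner \<tau>) f (\<lambda>_. \<Sum>i\<in>I. x i) = (\<Sum>i\<in>I. hinner (tensor_inner \<tau>) f (\<lambda>_. x i))"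
proof -
  have "(\<lambda>k. \<Sum>i\<in>I. tensor_inner \<tau> (f k) (x i)) \<longlonglongrightarrow> (\<Sum>i\<in>I. hinner (tensor_inner \<tau>) f (\<lambda>_. x i))"
    by (intro tendsto_sum t.hinner_const_right f x)
  moreover have "tensor_inner \<tau> (f k) (\<Sum>i\<in>I. x i) = (\<Sum>i\<in>I. tensor_inner \<tau> (f k) (x i))" for k
    by (intro t.ip_sum t.Comp_in[OF f] x)
  ultimately show ?thesis
    using LIMSEQ_unique[OF t.hinner_const_right[OF f t.K_sum[of I x, OF x]]] by simp
qed

text \<open>Testing the kernel against polynomial tuples with a single nonzero entry, a word, gives one identity
  for each row of the kernel.\<close>

lemma free_stein_kernel_words:
  fixes X :: "'n::finite \<Rightarrow> 'h oper"
  assumes XM: "\<And>i. X i \<in> M" and A: "free_stein_kernel M \<tau> V X A"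
  shows "inner2 \<tau> (poly_eval X (cyclic_diff l V)) (word_eval X w)
    = (\<Sum>k<length w. tform (A l (w ! k)) (word_eval X (take k w)) (word_eval X (drop (Suc k) w)))"
proof -
  have AC: "A i j \<in> t.Comp" for i j
    using A by (simp add: free_stein_kernel_def L2_tensor_Comp)
  note wM = word_eval_M[of X, OF XM]
  define Q where "Q = (\<lambda>i. if i = l then Poly_Mapping.single w (1 :: complex) else 0)"
  have zero: "hinner (tensor_inner \<tau>) (A i j) (\<lambda>_. 0) = 0" for i j
    using hinner_const_sum[OF AC, of "{}"] by simp
  have "(\<Sum>i\<in>UNIV. inner2 \<tau> (poly_eval X (cyclic_diff i V)) (poly_eval X (Q i)))
      = (\<Sum>i\<in>UNIV. if i = l then inner2 \<tau> (poly_eval X (cyclic_diff l V)) (word_eval X w) else 0)"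
    by (intro sum.cong refl)
      (auto simp: Q_def poly_eval_single m.ip_zero poly_eval_M[of X, OF XM])
  moreover have "hs_inner \<tau> A (jacobian_eval X Q)
      = (\<Sum>i\<in>UNIV. if i = l then (\<Sum>j\<in>UNIV. \<Sum>k | k < length w \<and> w ! k = j.
          tform (A l j) (word_eval X (take k w)) (word_eval X (drop (Suc k) w))) else 0)"
    unfolding hs_inner_def jacobian_eval_def
  proof (intro sum.cong refl)
    fix i
    show "(\<Sum>j\<in>UNIV. hinner (tensor_inner \<tau>) (A i j) (\<lambda>_. bipoly_eval X (free_diff j (Q i))))
        = (if i = l then (\<Sum>j\<in>UNIV. \<Sum>k | k < length w \<and> w ! k = j.
          tform (A l j) (word_eval X (take k w)) (word_eval X (drop (Suc k) w))) else 0)"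
    proof (cases "i = l")
      case True
      have "hinner (tensor_inner \<tau>) (A l j) (\<lambda>_. \<Sum>k | k < length w \<and> w ! k = j.
            Poly_Mapping.single (word_eval X (take k w), word_eval X (drop (Suc k) w)) 1)
          = (\<Sum>k | k < length w \<and> w ! k = j. tform (A l j) (word_eval X (take k w)) (word_eval X (drop (Suc k) w)))"
        for j unfolding tform_def by (intro hinner_const_sum AC T_single wM)
      then show ?thesis using True by (simp add: Q_def bipoly_eval_free_diff_word)
    qed (simp add: Q_def zero)
  qed
  moreover have "(\<Sum>i\<in>UNIV. inner2 \<tau> (poly_eval X (cyclic_diff i V)) (poly_eval X (Q i)))
      = hs_inner \<tau> A (jacobian_eval X Q)"
    using A by (simp add: free_stein_kernel_def)
  ultimately show ?thesis by (simp add: sum_split_letters)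
qed

lemma tform_centred:
  assumes A: "A \<in> t.Comp" and M: "a \<in> M" "b \<in> M"
  shows "tform A a b = tform (\<lambda>k. A k - identity_L2_matrix l j k) a b + (if l = j then \<tau> a * \<tau> b else 0)"
proof -
  have I: "identity_L2_matrix l j \<in> t.Comp"
    unfolding identity_L2_matrix_def using t.Comp_const[OF tensor_one_T] t.Comp_const[OF T_zero] by simp
  have "tform (identity_L2_matrix l j) a b = (if l = j then \<tau> a * \<tau> b else 0)"
    by (simp add: tform_def identity_L2_matrix_def hinner_def ti_tensor_one t.ip_zero_left T_single M)
  then show ?thesis
    using t.hinner_diff_left[OF A I t.Comp_const[OF T_single[OF M]]] by (simp add: tform_def)
qed

end

theorem lemma3:
  fixes M :: "('h::complex_hilbert \<Rightarrow>\<^sub>L 'h) set"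
    and \<tau> :: "('h \<Rightarrow>\<^sub>L 'h) \<Rightarrow> complex"
    and X S :: "'n::finite \<Rightarrow> ('h \<Rightarrow>\<^sub>L 'h)"
    and C :: "real^'n^'n"
  assumes "tracial_W_star_probability_space M \<tau>"
    and "self_adjoint_tuple M X"
    and "pos_definite C"
    and "semicircular_family M \<tau> C S"
    and "free_from \<tau> S X"
  shows "\<forall>t>0. ennreal_sqrt
            (free_fisher_information \<tau> (gaussian_potential C) (ou_interpolation C X S t))
          \<le> ennreal (exp (- 2 * t / mat_opnorm C) / sqrt (1 - exp (- 2 * t / mat_opnorm C))
                     * sqrt (mat_opnorm (matrix_inv C)))
            * free_stein_discrepancy M \<tau> (gaussian_potential C) X"
proof (intro allI impI)
  fix t :: real assume t: "0 < t"
  interpret tracial_space M \<tau> by unfold_locales (rule assms(1))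
  obtain u :: "'n \<Rightarrow> real^'n" and d where orth: "\<And>a b. u a \<bullet> u b = (if a = b then 1 else 0)"
    and eig: "\<And>a. C *v u a = d a *\<^sub>R u a"
    using symmetric_matrix_spectral[of C] assms(3) unfolding pos_definite_def by blast
  interpret orthonormal_frame u d by unfold_locales (rule orth)
  have d_pos: "0 < d a" for a
  proof -
    have "u a \<noteq> 0" using orth[of a a] by auto
    then have "0 < u a \<bullet> (C *v u a)" using assms(3) by (simp add: pos_definite_def)
    then show ?thesis by (simp add: eig orth)
  qed
  have C: "C = fc (\<lambda>x. x)" by (rule matrix_eq_fc) (rule eig)
  have Cinv: "matrix_inv C = fc (\<lambda>x. 1 / x)"
    unfolding C using d_pos by (intro matrix_inv_fc) (simp add: less_imp_neq[symmetric])
  define e where "e = (\<lambda>x. exp (- t / x))"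
  define r where "r x = sqrt (1 - exp (- 2 * t / x))" for x
  have lt1: "exp (- 2 * t / x) < 1" if "0 < x" for x
    using t that by (simp add: divide_neg_pos)
  have exp_fc: "mat_exp (s *\<^sub>R matrix_inv C) = fc (\<lambda>x. exp (s / x))" for s
    unfolding Cinv fc_scaleR mat_exp_fc by simp
  have E: "mat_exp ((- t) *\<^sub>R matrix_inv C) = fc e" unfolding exp_fc e_def ..
  have R: "mat_sqrt (mat 1 - mat_exp ((- 2 * t) *\<^sub>R matrix_inv C)) = fc r"
  proof -
    have "mat 1 - mat_exp ((- 2 * t) *\<^sub>R matrix_inv C) = fc (\<lambda>x. 1 - exp (- 2 * t / x))"
      unfolding exp_fc fc_one[symmetric] fc_diff ..
    moreover have "0 \<le> 1 - exp (- 2 * t / d a)" for a using lt1[OF d_pos[of a]] by linarith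
    ultimately show ?thesis by (simp add: mat_sqrt_fc r_def[abs_def])
  qed
  have e_sq: "(e x)\<^sup>2 = exp (- 2 * t / x)" for x
    by (simp add: e_def exp_double[symmetric] power2_eq_square flip: exp_add)
  have r_sq: "(r (d a))\<^sup>2 = 1 - exp (- 2 * t / d a)" for a
    using lt1[OF d_pos[of a]] by (simp add: r_def)
  interpret I: interpolation M \<tau> u d X S e r
  proof
    show "self_adjoint_tuple M X" "free_from \<tau> S X" by fact+
    show "semicircular_family M \<tau> (fc (\<lambda>x. x)) S" using assms(4) C by simp
    fix a
    show "0 < d a" by (rule d_pos)
    show "0 < r (d a)" using lt1[OF d_pos[of a]] by (simp add: r_def)
    show "(e (d a))\<^sup>2 + (r (d a))\<^sup>2 = 1" by (simp add: e_sq r_sq)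
  qed
  have Y: "ou_interpolation C X S t = I.Y"
    unfolding ou_interpolation_def E R by (rule ext) (simp add: mat_act_def I.Y_def)
  let ?V = "gaussian_potential C"
  have gradient: "poly_eval Z (cyclic_diff i ?V) = (\<Sum>j\<in>UNIV. fc (\<lambda>x. 1 / x) $ i $ j *\<^sub>R Z j)"
    for Z :: "'n \<Rightarrow> 'h oper" and i
    using poly_eval_gaussian_gradient[of C Z i] unfolding Cinv by (simp add: fc_symmetric)
  define q where "q = exp (- 2 * t / mat_opnorm C)"
  define \<mu> where "\<mu> = mat_opnorm (matrix_inv C)"
  \<comment> \<open>Both \<open>e\<^sup>2\<close> and \<open>e\<^sup>2 / r\<^sup>2\<close> increase with the eigenvalue, so upper bounds for the eigenvalues of \<open>C\<close>
      and of its inverse control every factor.\<close>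
  have d_le: "d a \<le> mat_opnorm C" for a
    unfolding C using eigenvalue_le_opnorm[of "\<lambda>x. x" a] .
  have inv_le: "1 / d a \<le> \<mu>" for a
    unfolding \<mu>_def Cinv using eigenvalue_le_opnorm[of "\<lambda>x. 1 / x" a] .
  have pos: "0 < mat_opnorm C" "0 < \<mu>"
    using d_pos[of undefined] d_le[of undefined] inv_le[of undefined] less_le_trans
      divide_pos_pos[OF zero_less_one d_pos] by blast+
  have q: "0 < q" "q < 1" unfolding q_def using lt1[OF pos(1)] by simp_all
  have exp_le: "exp (- 2 * t / d a) \<le> q" for a
    unfolding q_def using d_pos[of a] d_le[of a] t pos(1) by (simp add: frac_le)
  define k where "k = q / sqrt (1 - q) * sqrt \<mu>"
  have k_pos: "0 < k" unfolding k_def using q pos by simp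
  have k_sq: "q / (1 - q) * \<mu> * q = k\<^sup>2"
    using q pos by (simp add: k_def power_mult_distrib power_divide) (simp add: power2_eq_square)
  have c1: "(e (d a))\<^sup>2 / ((r (d a))\<^sup>2 * d a) \<le> q / (1 - q) * \<mu>" for a
  proof -
    have "(e (d a))\<^sup>2 / ((r (d a))\<^sup>2 * d a) = exp (- 2 * t / d a) / (1 - exp (- 2 * t / d a)) * (1 / d a)"
      by (simp add: e_sq r_sq)
    also have "\<dots> \<le> q / (1 - q) * \<mu>"
      using exp_le[of a] q lt1[OF d_pos[of a]] d_pos[of a] inv_le[of a] pos
      by (intro mult_mono frac_le) (auto intro: less_imp_le)
    finally show ?thesis .
  qed
  define L where "L = ennreal_sqrt (free_fisher_information \<tau> ?V (ou_interpolation C X S t))"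
  have bound: "L \<le> ennreal k * ennreal (hs_norm \<tau> (\<lambda>i j k. A i j k - identity_L2_matrix i j k))"
    if A: "free_stein_kernel M \<tau> ?V X A" for A
  proof -
    define \<Delta> where "\<Delta> l j = (\<lambda>k. A l j k - identity_L2_matrix l j k)" for l j
    have AC: "A l j \<in> t.Comp" for l j
      using A by (simp add: free_stein_kernel_def L2_tensor_Comp)
    have IC: "identity_L2_matrix l j \<in> t.Comp" for l j :: 'n
      unfolding identity_L2_matrix_def using t.Comp_const[OF tensor_one_T] t.Comp_const[OF T_zero] by simp
    have \<Delta>C: "\<Delta> l j \<in> t.Comp" for l j
      unfolding \<Delta>_def by (rule t.Comp_diff[OF AC IC])
    note wM = word_eval_M[of X, OF I.XM]
    have kernel: "\<tau> (I.\<theta> l o\<^sub>L word_eval X w) = (\<Sum>k<length w.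
        tform (\<Delta> l (w ! k)) (word_eval X (take k w)) (word_eval X (drop (Suc k) w))
        + (if l = w ! k then \<tau> (word_eval X (take k w)) * \<tau> (word_eval X (drop (Suc k) w)) else 0))" for l w
    proof -
      have "adj (I.\<theta> l) = I.\<theta> l" unfolding I.\<theta>_def by (rule I.adj_real_sum[of X, OF I.XM I.Xa])
      then have "\<tau> (I.\<theta> l o\<^sub>L word_eval X w) = inner2 \<tau> (I.\<theta> l) (word_eval X w)"
        by (simp add: inner2_def)
      also have "\<dots> = (\<Sum>k<length w. tform (A l (w ! k)) (word_eval X (take k w)) (word_eval X (drop (Suc k) w)))"
        using free_stein_kernel_words[of X ?V A l w, OF I.XM A] by (simp add: gradient I.\<theta>_def)
      also have "\<dots> = (\<Sum>k<length w.
          tform (\<Delta> l (w ! k)) (word_eval X (take k w)) (word_eval X (drop (Suc k) w))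
          + (if l = w ! k then \<tau> (word_eval X (take k w)) * \<tau> (word_eval X (drop (Suc k) w)) else 0))"
        unfolding \<Delta>_def by (intro sum.cong refl tform_centred[OF AC wM wM])
      finally show ?thesis .
    qed
    have e_le: "(e (d a))\<^sup>2 \<le> q" for a unfolding e_sq by (rule exp_le)
    obtain N where N: "\<And>i. 0 \<le> N i"
      "(\<Sum>i\<in>UNIV. N i) \<le> q / (1 - q) * \<mu> * q * (\<Sum>l\<in>UNIV. \<Sum>j\<in>UNIV. (hnorm (tensor_inner \<tau>) (\<Delta> l j))\<^sup>2)"
      "\<And>i p. cmod (inner2 \<tau> (I.W i) (poly_eval I.Y p)
        - tensor_inner \<tau> tensor_one (bipoly_eval I.Y (free_diff i p))) \<le> sqrt (N i) * m.nrm (poly_eval I.Y p)"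
      using I.score_bound[of \<Delta>, OF \<Delta>C kernel c1 e_le] by metis
    have "L \<le> ennreal (sqrt (\<Sum>i\<in>UNIV. (sqrt (N i))\<^sup>2))"
      unfolding L_def Y
    proof (rule free_fisher_information_bound[OF I.Y_self_adjoint])
      show "cmod (inner2 \<tau> (poly_eval I.Y (cyclic_diff i ?V)) (poly_eval I.Y p)
          - tensor_inner \<tau> tensor_one (bipoly_eval I.Y (free_diff i p))) \<le> sqrt (N i) * m.nrm (poly_eval I.Y p)" for i p
        using N(3)[of i p] by (simp add: gradient I.W_def)
    qed (simp add: N(1))
    also have "(\<Sum>i\<in>UNIV. (sqrt (N i))\<^sup>2) = (\<Sum>i\<in>UNIV. N i)" by (simp add: N(1))
    also have "ennreal (sqrt (\<Sum>i\<in>UNIV. N i)) \<le> ennreal (k * hs_norm \<tau> \<Delta>)"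
    proof (rule ennreal_leI)
      have "sqrt (\<Sum>i\<in>UNIV. N i) \<le> sqrt (k\<^sup>2 * (\<Sum>l\<in>UNIV. \<Sum>j\<in>UNIV. (hnorm (tensor_inner \<tau>) (\<Delta> l j))\<^sup>2))"
        using N(2) unfolding k_sq by (rule real_sqrt_le_mono)
      also have "\<dots> = k * hs_norm \<tau> \<Delta>"
        using k_pos by (simp add: hs_norm_def real_sqrt_mult)
      finally show "sqrt (\<Sum>i\<in>UNIV. N i) \<le> k * hs_norm \<tau> \<Delta>" .
    qed
    also have "\<dots> = ennreal k * ennreal (hs_norm \<tau> \<Delta>)"
      using k_pos by (intro ennreal_mult) (simp_all add: hs_norm_def sum_nonneg)
    finally show ?thesis unfolding \<Delta>_def .
  qed
  have "L / ennreal k \<le> free_stein_discrepancy M \<tau> ?V X"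
    unfolding free_stein_discrepancy_def
  proof (rule INF_greatest)
    fix A assume "A \<in> {A. free_stein_kernel M \<tau> ?V X A}"
    then show "L / ennreal k \<le> ennreal (hs_norm \<tau> (\<lambda>i j k. A i j k - identity_L2_matrix i j k))"
      using bound[of A] k_pos by (intro divide_le_posI_ennreal) simp_all
  qed
  then have "ennreal k * (L / ennreal k) \<le> ennreal k * free_stein_discrepancy M \<tau> ?V X"
    by (rule mult_left_mono) simp
  moreover have "ennreal k * (L / ennreal k) = L"
    using k_pos by (simp add: ennreal_times_divide mult.commute[of "ennreal k"] mult_divide_eq_ennreal)
  ultimately show "ennreal_sqrt (free_fisher_information \<tau> ?V (ou_interpolation C X S t))
      \<le> ennreal (exp (- 2 * t / mat_opnorm C) / sqrt (1 - exp (- 2 * t / mat_opnorm C))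
          * sqrt (mat_opnorm (matrix_inv C))) * free_stein_discrepancy M \<tau> ?V X"
    by (simp add: L_def k_def q_def \<mu>_def)
qed

end
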